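(* Let $\varphi$ be a linear fractional self-map of $B_N$ having exactly one fixed point $z_0$ in $\overline{B_N}$, with $z_0\in B_N$. Suppose that $\dim L_U(\varphi,z_0)=0$ and $\|\varphi\|_\infty=1$. Then $C_\varphi$ is not essentially normal on $H^2(B_N)$, nor on $A^2_s(B_N)$ for any real $s>-1$.
   Context: $B_N$ is the open unit ball of $\mathbb{C}^N$ with $\langle z,w\rangle=\sum_j z_j\overline{w_j}$. A linear fractional map is $\varphi(z)=\frac{Az+B}{\langle z,C\rangle+d}$ with $A$ an $N\times N$ complex matrix, $B,C\in\mathbb{C}^N$, $d\in\mathbb{C}$; it is a self-map of $B_N$ if it maps $B_N$ into $B_N$. $\|\varphi\|_\infty=\sup_{z\in B_N}|\varphi(z)|$. For a fixed point $z_0\in B_N$ of $\varphi$, the unitary space is $L_U(\varphi,z_0)=\bigoplus_{|\lambda|=1}\ker(d\varphi_{z_0}-\lambda I)^N$, where $d\varphi_{z_0}$ is the derivative of $\varphi$ at $z_0$. $H^2(B_N)$ is the Hardy space ($\|f\|^2=\sup_{0<r<1}\int_{\partial B_N}|f(r\zeta)|^2d\sigma(\zeta)$, $\sigma$ normalized surface measure), and for $s>-1$, $A^2_s(B_N)$ is the space of holomorphic $f$ with $\int_{B_N}|f|^2\frac{\Gamma(N+s+1)}{N!\Gamma(s+1)}(1-|z|^2)^sdv(z)<\infty$ ($v$ normalized volume measure). $C_\varphi f=f\circ\varphi$. A bounded operator $T$ is essentially normal if $T^*T-TT^*$ is compact. *)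

theory Defs
  imports "HOL-Analysis.Analysis"
begin

text \<open>C^N is modelled as complex ^ 'n (N = CARD('n)); its norm is the Euclidean norm,
  so ball 0 1 is the open unit ball B_N and cball 0 1 its closure.\<close>

definition cinner :: "complex ^ 'n \<Rightarrow> complex ^ 'n \<Rightarrow> complex" where
  "cinner z w = (\<Sum>j\<in>UNIV. z $ j * cnj (w $ j))"

definition lfm :: "complex ^ 'n ^ 'n \<Rightarrow> complex ^ 'n \<Rightarrow> complex ^ 'n \<Rightarrow> complex
     \<Rightarrow> complex ^ 'n \<Rightarrow> complex ^ 'n" where
  "lfm A B C d = (\<lambda>z. (1 / (cinner z C + d)) *s (A *v z + B))"

definition lfm_self_map :: "complex ^ 'n ^ 'n \<Rightarrow> complex ^ 'n \<Rightarrow> complex ^ 'n \<Rightarrow> complex \<Rightarrow> bool" where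
  "lfm_self_map A B C d \<longleftrightarrow>
     (\<forall>z\<in>ball 0 1. cinner z C + d \<noteq> 0 \<and> lfm A B C d z \<in> ball 0 1)"

definition lfm_fixed_points_closed :: "complex ^ 'n ^ 'n \<Rightarrow> complex ^ 'n \<Rightarrow> complex ^ 'n \<Rightarrow> complex
     \<Rightarrow> (complex ^ 'n) set" where
  "lfm_fixed_points_closed A B C d =
     {z\<in>cball 0 1. cinner z C + d \<noteq> 0 \<and> lfm A B C d z = z}"

definition sup_norm_ball :: "(complex ^ 'n \<Rightarrow> complex ^ 'n) \<Rightarrow> real" where
  "sup_norm_ball \<phi> = (SUP z\<in>ball 0 1. norm (\<phi> z))"

definition unitary_space :: "(complex ^ 'n \<Rightarrow> complex ^ 'n) \<Rightarrow> complex ^ 'n \<Rightarrow> (complex ^ 'n) set" where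
  "unitary_space \<phi> z0 =
     (let D = frechet_derivative \<phi> (at z0) in
      span (\<Union>c\<in>{c::complex. cmod c = 1}.
              {v. ((\<lambda>w. D w - c *s w) ^^ CARD('n)) v = 0}))"

definition holo_ball :: "(complex ^ 'n \<Rightarrow> complex) \<Rightarrow> bool" where
  "holo_ball f \<longleftrightarrow> (\<forall>z\<in>ball 0 1. \<exists>D. (f has_derivative D) (at z) \<and>
                                   (\<forall>c w. D (c *s w) = c * D w))"

text \<open>Normalized volume measure v on B_N, and normalized surface measure sigma on the sphere
  (the image of v under z -> z/|z|).\<close>
definition vol_ball :: "(complex ^ 'n) measure" where
  "vol_ball = uniform_measure lborel (ball 0 1)"

definition sigma_sphere :: "(complex ^ 'n) measure" where
  "sigma_sphere = distr vol_ball borel sgn"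

definition hardy_norm2 :: "(complex ^ 'n \<Rightarrow> complex) \<Rightarrow> ennreal" where
  "hardy_norm2 f = (SUP r\<in>{0<..<1::real}.
      \<integral>\<^sup>+ \<zeta>. ennreal ((cmod (f (r *\<^sub>R \<zeta>)))\<^sup>2) \<partial>sigma_sphere)"

definition bergman_norm2 :: "real \<Rightarrow> (complex ^ 'n \<Rightarrow> complex) \<Rightarrow> ennreal" where
  "bergman_norm2 s f =
     (\<integral>\<^sup>+ z. ennreal ((cmod (f z))\<^sup>2 *
         (Gamma (real CARD('n) + s + 1) / (fact CARD('n) * Gamma (s + 1))) *
         (1 - (norm z)\<^sup>2) powr s) \<partial>vol_ball)"

definition fspace :: "((complex ^ 'n \<Rightarrow> complex) \<Rightarrow> ennreal) \<Rightarrow> (complex ^ 'n \<Rightarrow> complex) set" where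
  "fspace Q = {f. holo_ball f \<and> Q f < \<infinity>}"

definition fnorm :: "((complex ^ 'n \<Rightarrow> complex) \<Rightarrow> ennreal) \<Rightarrow> (complex ^ 'n \<Rightarrow> complex) \<Rightarrow> real" where
  "fnorm Q f = sqrt (enn2real (Q f))"

text \<open>Inner product, by polarization (linear in the first argument).\<close>
definition finner :: "((complex ^ 'n \<Rightarrow> complex) \<Rightarrow> ennreal) \<Rightarrow> (complex ^ 'n \<Rightarrow> complex)
     \<Rightarrow> (complex ^ 'n \<Rightarrow> complex) \<Rightarrow> complex" where
  "finner Q f g = (1/4) * (\<Sum>k\<in>{0..3::nat}. \<i> ^ k *
      complex_of_real ((fnorm Q (\<lambda>z. f z + \<i> ^ k * g z))\<^sup>2))"

text \<open>Compact operator on the space: maps the space into itself and every bounded sequence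
  has a subsequence whose image is norm-Cauchy (the space is complete).\<close>
definition compact_op :: "((complex ^ 'n \<Rightarrow> complex) \<Rightarrow> ennreal)
     \<Rightarrow> ((complex ^ 'n \<Rightarrow> complex) \<Rightarrow> (complex ^ 'n \<Rightarrow> complex)) \<Rightarrow> bool" where
  "compact_op Q K \<longleftrightarrow> (\<forall>f\<in>fspace Q. K f \<in> fspace Q) \<and>
     (\<forall>fs. (\<forall>n. fs n \<in> fspace Q) \<and> bounded (range (\<lambda>n. fnorm Q (fs n))) \<longrightarrow>
        (\<exists>r::nat\<Rightarrow>nat. strict_mono r \<and>
           (\<forall>e>0. \<exists>M. \<forall>m\<ge>M. \<forall>n\<ge>(M::nat).
              fnorm Q (\<lambda>z. K (fs (r m)) z - K (fs (r n)) z) < e)))"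

definition ess_normal :: "((complex ^ 'n \<Rightarrow> complex) \<Rightarrow> ennreal)
     \<Rightarrow> ((complex ^ 'n \<Rightarrow> complex) \<Rightarrow> (complex ^ 'n \<Rightarrow> complex)) \<Rightarrow> bool" where
  "ess_normal Q T \<longleftrightarrow> (\<forall>f\<in>fspace Q. T f \<in> fspace Q) \<and>
     (\<exists>S. (\<forall>g\<in>fspace Q. S g \<in> fspace Q) \<and>
          (\<forall>f\<in>fspace Q. \<forall>g\<in>fspace Q. finner Q (T f) g = finner Q f (S g)) \<and>
          compact_op Q (\<lambda>f z. S (T f) z - T (S f) z))"

definition comp_op :: "(complex ^ 'n \<Rightarrow> complex ^ 'n) \<Rightarrow> (complex ^ 'n \<Rightarrow> complex) \<Rightarrow> (complex ^ 'n \<Rightarrow> complex)" where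
  "comp_op \<phi> f = f \<circ> \<phi>"

end

theory Submission
  imports Defs "HOL-Complex_Analysis.Complex_Analysis"
    "HOL-Computational_Algebra.Fundamental_Theorem_Algebra"
begin

text \<open>Since \<open>\<phi>\<close> has no boundary fixed point and no unimodular eigenvalue at \<open>z0\<close>, it is conjugate, by a
  linear fractional change of coordinates that is regular on the closed ball, to a linear map all of
  whose eigenvalues lie in the open unit disc. So no orbit stays on the sphere, and as \<open>\<phi>\<close>
  touches the sphere, there are \<open>\<zeta>\<close> and \<open>\<eta> = \<phi> \<zeta>\<close> on the sphere with \<open>|\<phi> \<eta>| < 1\<close>. Let \<open>p\<close> be the function
  \<open>exp (t (\<langle>z, \<eta>\<rangle> - 1))\<close>, which for large \<open>t\<close> is concentrated near \<open>\<eta>\<close>. The contact at \<open>\<zeta>\<close> keeps \<open>\<parallel>C p\<parallel>\<^sup>2\<close> at least a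
  fixed multiple of \<open>\<parallel>p\<parallel>\<^sup>2\<close> for suitable arbitrarily large \<open>t\<close>, whereas \<open>\<parallel>C\<^sup>* p\<parallel>\<^sup>2 = \<langle>C C\<^sup>* p, p\<rangle>\<close> is \<open>o(\<parallel>p\<parallel>\<^sup>2)\<close> because \<open>\<phi>\<close> maps a
  neighbourhood of \<open>\<eta>\<close> into a compact subset of the ball. Hence \<open>\<langle>(C\<^sup>* C - C C\<^sup>*) p, p\<rangle> / \<parallel>p\<parallel>\<^sup>2\<close> stays away from 0
  along a sequence of normalized \<open>p\<close> that tends weakly to 0, and \<open>C\<^sup>* C - C C\<^sup>*\<close> is not compact.\<close>

section \<open>Linear fractional maps with an interior fixed point\<close>

text \<open>The norms of the peaks are never computed. Let \<open>a t\<close> be the squared norm of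
  a peak, the same for every centre by rotation. The contact estimate bounds the norm after
  composition below by \<open>a (M * t)\<close> only, and comparing this with \<open>a t\<close>
  needs a doubling property. Polynomial growth of point evaluations bounds \<open>a\<close> below by
  a power of \<open>1 / t\<close>, so \<open>a\<close> cannot drop by a large fixed factor at every
  scale. This is why only suitable \<open>t\<close> occur, and why one argument serves all the
  spaces.

  For the adjoint, the integral is split at a cap around \<eta>. On the cap, \<open>S p\<close>
  composed with \<phi> is controlled by the norm of \<open>S p\<close> itself, with a factor that is
  small for a small cap because peaks at the scale of the cap have small norm; this term is absorbed
  into the left side. Off the cap the peak is exponentially small, hence negligible against
  \<open>a\<close>. The adjoint is just a map \<open>S\<close> with the right pairing, neither
  linear nor bounded by assumption; the remaining bounds are extracted from compactness of the
  commutator.\<close>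

lemma cinner_simps:
  fixes x y z :: "complex ^ 'n"
  shows "cinner (x + y) z = cinner x z + cinner y z"
    and "cinner (x - y) z = cinner x z - cinner y z"
    and "cinner (- x) z = - cinner x z"
    and "cinner (c *s x) z = c * cinner x z"
    and "cinner (r *\<^sub>R x) z = of_real r * cinner x z"
    and "cinner 0 z = 0" "cinner x 0 = 0"
  unfolding cinner_def vector_add_component vector_minus_component vector_uminus_component
    vector_smult_component vector_scaleR_component
  by (simp_all add: algebra_simps sum.distrib sum_subtractf sum_negf sum_distrib_left scaleR_conv_of_real)

lemma scaleR_eq_smult: "r *\<^sub>R x = of_real r *s x" for x :: "complex ^ 'n"
  by (simp add: vec_eq_iff scaleR_conv_of_real[where 'a = complex])

lemma Re_cinner: "Re (cinner z w) = inner z w" for z w :: "complex ^ 'n"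
  unfolding cinner_def inner_vec_def inner_complex_def by (simp add: algebra_simps)

lemma cinner_self: "cinner z z = of_real ((norm z)\<^sup>2)" for z :: "complex ^ 'n"
proof -
  have "Im (cinner z z) = 0"
    unfolding cinner_def by (simp add: algebra_simps)
  moreover have "Re (cinner z z) = (norm z)\<^sup>2"
    by (simp add: Re_cinner dot_square_norm)
  ultimately show ?thesis by (simp add: complex_eq_iff)
qed

lemma norm_smult: "norm (c *s x) = cmod c * norm x" for x :: "complex ^ 'n"
  unfolding norm_vec_def vector_smult_component norm_mult
  by (simp add: L2_set_right_distrib)

lemma cinner_bound: "cmod (cinner z w) \<le> norm z * norm w" for z w :: "complex ^ 'n"
proof (cases "cinner z w = 0")
  case False
  define u where "u = cnj (cinner z w) / of_real (cmod (cinner z w))"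
  have "cmod u = 1" using False by (simp add: u_def norm_divide)
  have "u * cinner z w = of_real (cmod (cinner z w))"
    using False complex_norm_square[of "cinner z w"]
    by (simp add: u_def field_simps power2_eq_square)
  then have "cmod (cinner z w) = Re (cinner (u *s z) w)"
    by (metis Re_complex_of_real cinner_simps(4))
  also have "\<dots> \<le> norm (u *s z) * norm w"
    unfolding Re_cinner by (rule norm_cauchy_schwarz)
  finally show ?thesis by (simp add: norm_smult \<open>cmod u = 1\<close>)
qed simp

lemma bounded_linear_cinner: "bounded_linear (\<lambda>z. cinner z w)" for w :: "complex ^ 'n"
  by (rule bounded_linear_intro[where K = "norm w"]) (auto simp: cinner_simps cinner_bound scaleR_conv_of_real[where 'a = complex])

lemma bounded_linear_matrix_vector: "bounded_linear (\<lambda>z. A *v z)" for A :: "complex ^ 'n ^ 'n"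
  by (intro linear_conv_bounded_linear[THEN iffD1] linearI)
     (simp_all add: matrix_vector_right_distrib scaleR_eq_smult vec.scale)

lemmas continuous_on_cinner [continuous_intros] =
  bounded_linear.continuous_on[OF bounded_linear_cinner]

lemmas continuous_on_matrix_vector [continuous_intros] =
  bounded_linear.continuous_on[OF bounded_linear_matrix_vector]

lemma continuous_on_smult [continuous_intros]:
  fixes f :: "'a::topological_space \<Rightarrow> complex" and g :: "'a \<Rightarrow> complex ^ 'n"
  assumes "continuous_on S f" "continuous_on S g"
  shows "continuous_on S (\<lambda>x. f x *s g x)"
  unfolding vector_scalar_mult_def by (intro continuous_intros assms)

lemma bounded_linear_smult_left: "bounded_linear (\<lambda>c. c *s x)" for x :: "complex ^ 'n"
  by (rule bounded_linear_intro[where K = "norm x"])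
     (simp_all add: norm_smult scaleR_eq_smult vec.scale_left_distrib scaleR_conv_of_real[where 'a = complex])

lemma bounded_linear_smult_right: "bounded_linear (\<lambda>x. c *s x)" for c :: complex
  by (rule bounded_linear_intro[where K = "cmod c"])
     (simp_all add: norm_smult scaleR_eq_smult vec.scale_right_distrib mult.commute)

text \<open>A tangential displacement of size \<theta> leaves the ball only to second order, so
  pulling the base point in by \<open>\<theta>\<^sup>2\<close> compensates. Inequalities known only
  on the closed ball can thus be tested to first order in tangent directions, the errors being left
  to \<open>eq_zero_if_quadratically_small\<close>.\<close>

lemma tangential_disc_in_cball:
  fixes \<zeta> u :: "'a::real_inner"
  assumes "norm \<zeta> = 1" "inner u \<zeta> = 0" "norm u \<le> 1" "\<bar>\<theta>\<bar> \<le> 1"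
  shows "norm ((1 - \<theta>\<^sup>2) *\<^sub>R \<zeta> + \<theta> *\<^sub>R u) \<le> 1"
proof -
  have "(norm ((1 - \<theta>\<^sup>2) *\<^sub>R \<zeta> + \<theta> *\<^sub>R u))\<^sup>2 = (1 - \<theta>\<^sup>2)\<^sup>2 + \<theta>\<^sup>2 * (norm u)\<^sup>2"
    using assms(1,2) unfolding norm_eq_1 power2_norm_eq_inner
    by (simp add: inner_add_left inner_add_right inner_commute[of \<zeta> u] power2_eq_square)
  also have "\<dots> \<le> (1 - \<theta>\<^sup>2)\<^sup>2 + \<theta>\<^sup>2 * 1"
    using assms(3) by (intro add_left_mono mult_left_mono) (auto simp: power_le_one)
  also have "\<dots> = 1 - \<theta>\<^sup>2 * (1 - \<theta>\<^sup>2)"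
    by (simp add: power2_eq_square algebra_simps)
  also have "\<dots> \<le> 1"
    using assms(4) by (simp add: abs_square_le_1)
  finally show ?thesis by (metis norm_ge_zero one_power2 power2_le_imp_le zero_le_one)
qed

lemma eq_zero_if_quadratically_small:
  fixes a K :: real
  assumes "\<And>\<theta>. 0 < \<theta> \<Longrightarrow> \<theta> \<le> 1 \<Longrightarrow> \<theta> * a \<le> K * \<theta>\<^sup>2" and "a \<ge> 0"
  shows "a = 0"
proof (rule ccontr)
  assume "a \<noteq> 0"
  then have a: "a > 0" using assms(2) by simp
  have K: "K > 0" using assms(1)[of 1] a by simp
  define \<theta> where "\<theta> = min 1 (a / (2 * K))"
  have \<theta>: "0 < \<theta>" "\<theta> \<le> 1" "\<theta> \<le> a / (2 * K)" using a K by (auto simp: \<theta>_def)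
  have "\<theta> * a \<le> \<theta> * (K * \<theta>)"
    using assms(1)[OF \<theta>(1,2)] by (simp add: power2_eq_square algebra_simps)
  then have "a \<le> K * \<theta>" using \<theta>(1) by simp
  also have "\<dots> \<le> K * (a / (2 * K))" using K \<theta>(3) by (intro mult_left_mono) auto
  also have "\<dots> = a / 2" using K by simp
  finally show False using a by simp
qed

lemma bounded_bilinear_smult: "bounded_bilinear (\<lambda>c (x :: complex ^ 'n). c *s x)"
proof
  show "\<exists>K. \<forall>a b. norm (a *s b :: complex ^ 'n) \<le> norm a * norm b * K"
    by (rule exI[of _ 1]) (simp add: norm_smult)
qed (simp_all add: vec.scale_left_distrib vec.scale_right_distrib scaleR_eq_smult scaleR_conv_of_real[where 'a = complex] mult_ac)

locale lfm_interior_fixed_point =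
  fixes A :: "complex ^ 'n ^ 'n" and B C z0 :: "complex ^ 'n" and d :: complex
  assumes self_map: "lfm_self_map A B C d"
    and fixed_points: "lfm_fixed_points_closed A B C d = {z0}"
    and z0_ball: "z0 \<in> ball 0 1"
    and dim_unitary: "dim (unitary_space (lfm A B C d) z0) = 0"
    and sup_norm: "sup_norm_ball (lfm A B C d) = 1"
begin

abbreviation "\<phi> \<equiv> lfm A B C d"

definition "D z = cinner z C + d"

definition "N z = A *v z + B"

lemma \<phi>_eq: "\<phi> z = (1 / D z) *s N z"
  by (simp add: lfm_def D_def N_def)

lemma D_ball: "z \<in> ball 0 1 \<Longrightarrow> D z \<noteq> 0"
  using self_map by (auto simp: lfm_self_map_def D_def)

lemma D_eq_0_imp: "D z = 0 \<Longrightarrow> norm z \<ge> 1"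
  by (rule ccontr) (use D_ball[of z] in simp)

lemma \<phi>_ball: "z \<in> ball 0 1 \<Longrightarrow> \<phi> z \<in> ball 0 1"
  using self_map by (auto simp: lfm_self_map_def)

lemma D_diff: "D z - D w = cinner (z - w) C"
  by (simp add: D_def cinner_simps)

lemma N_diff: "N z - N w = A *v (z - w)"
  by (simp add: N_def vec.diff)

lemma continuous_on_D [continuous_intros]: "continuous_on S D"
  unfolding D_def by (intro continuous_intros)

lemma continuous_on_N [continuous_intros]: "continuous_on S N"
  unfolding N_def by (intro continuous_intros)

text \<open>This is the self-map property with the denominator cleared; in this form it passes to
  the closure before the denominator is known to be nonzero on the sphere.\<close>

lemma norm_N_le:
  assumes "z \<in> cball 0 1"
  shows "norm (N z) \<le> cmod (D z)"
proof -
  have "closure (ball 0 1) \<subseteq> {z. norm (N z) \<le> cmod (D z)}"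
  proof (rule closure_minimal)
    show "ball 0 1 \<subseteq> {z. norm (N z) \<le> cmod (D z)}"
    proof
      fix z :: "complex ^ 'n" assume z: "z \<in> ball 0 1"
      have "norm (\<phi> z) < 1" using \<phi>_ball[OF z] by simp
      then show "z \<in> {z. norm (N z) \<le> cmod (D z)}"
        using D_ball[OF z] by (simp add: \<phi>_eq norm_smult norm_divide field_simps)
    qed
    show "closed {z. norm (N z) \<le> cmod (D z)}"
      by (intro closed_Collect_le continuous_intros)
  qed
  then show ?thesis using assms by auto
qed

lemma \<phi>_z0: "\<phi> z0 = z0"
  using fixed_points by (auto simp: lfm_fixed_points_closed_def)

lemma exists_\<phi>_near_sphere:
  assumes "r < 1"
  obtains z where "z \<in> ball 0 1" "norm (\<phi> z) > r"
proof -
  have "\<exists>z\<in>ball 0 1. r < norm (\<phi> z)"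
  proof (rule ccontr)
    assume "\<not> ?thesis"
    then have "(SUP z\<in>ball 0 1. norm (\<phi> z)) \<le> r"
      by (intro cSUP_least) (auto simp: not_less)
    then show False using sup_norm assms by (simp add: sup_norm_ball_def)
  qed
  then show ?thesis using that by auto
qed

text \<open>If the denominator vanished at a boundary point \<open>w\<close>, so would the numerator; approaching \<open>w\<close>
  tangentially shows that the numerator vanishes on the kernel of \<open>\<langle>\<cdot>, C\<rangle>\<close>, and then \<open>\<phi>\<close> is
  constant.\<close>
lemma D_nonzero:
  assumes "w \<in> cball 0 1"
  shows "D w \<noteq> 0"
proof
  assume Dw: "D w = 0"
  have Nw: "N w = 0" using norm_N_le[OF assms] Dw by simp
  have w1: "norm w = 1" using assms D_eq_0_imp[OF Dw] by simp
  have Dz: "D z = cinner (z - w) C" for z using D_diff[of z w] Dw by simp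
  have Nz: "N z = A *v (z - w)" for z using N_diff[of z w] Nw by simp
  have ker: "A *v v = 0" if v: "cinner v C = 0" "norm v \<le> 1" for v
  proof -
    \<comment> \<open>\<open>D\<close> vanishes along the whole line
      \<open>w + \<theta> *\<^sub>R v\<close>, so this line avoids the open ball and must be tangent
      to the sphere at \<open>w\<close>.\<close>
    have "norm (w + \<theta> *\<^sub>R v) \<ge> 1" for \<theta>
      using D_eq_0_imp[of "w + \<theta> *\<^sub>R v"] Dz[of "w + \<theta> *\<^sub>R v"] v by (auto simp: cinner_simps)
    then have w_le: "1 \<le> (norm (w + \<theta> *\<^sub>R v))\<^sup>2" for \<theta>
      by (rule one_le_power)
    have "(norm (w + \<theta> *\<^sub>R v))\<^sup>2 = 1 + 2 * \<theta> * inner v w + \<theta>\<^sup>2 * (norm v)\<^sup>2" for \<theta>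
      using w1 unfolding power2_norm_eq_inner norm_eq_1
      by (simp add: inner_add_left inner_add_right inner_commute[of w v] power2_eq_square distrib_left)
    then have *: "0 \<le> 2 * \<theta> * inner v w + \<theta>\<^sup>2 * (norm v)\<^sup>2" for \<theta>
      using w_le[of \<theta>] by simp
    have vw: "inner v w = 0"
    proof -
      have "\<bar>inner v w\<bar> = 0"
      proof (rule eq_zero_if_quadratically_small[where K = "(norm v)\<^sup>2"])
        fix \<theta> :: real assume "0 < \<theta>" "\<theta> \<le> 1"
        have "0 \<le> \<theta>\<^sup>2 * (norm v)\<^sup>2" by simp
        moreover have "2 * (\<theta> * \<bar>inner v w\<bar>) \<le> \<theta>\<^sup>2 * (norm v)\<^sup>2"
          using *[of \<theta>] *[of "- \<theta>"] by (cases "inner v w \<ge> 0") simp_all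
        ultimately have "\<theta> * \<bar>inner v w\<bar> \<le> \<theta>\<^sup>2 * (norm v)\<^sup>2" by linarith
        then show "\<theta> * \<bar>inner v w\<bar> \<le> (norm v)\<^sup>2 * \<theta>\<^sup>2" by (simp only: mult.commute)
      qed simp
      then show ?thesis by simp
    qed
    have "norm (A *v v) = 0"
    proof (rule eq_zero_if_quadratically_small[where K = "cmod (cinner w C) + norm (A *v w)"])
      fix \<theta> :: real assume \<theta>: "0 < \<theta>" "\<theta> \<le> 1"
      define z where "z = (1 - \<theta>\<^sup>2) *\<^sub>R w + \<theta> *\<^sub>R v"
      have "norm z \<le> 1" unfolding z_def using w1 v vw \<theta> by (intro tangential_disc_in_cball) auto
      then have "norm (N z) \<le> cmod (D z)" by (intro norm_N_le) simp
      moreover have zw: "z - w = \<theta> *\<^sub>R v - \<theta>\<^sup>2 *\<^sub>R w"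
        by (simp add: z_def algebra_simps)
      moreover have "N z = \<theta> *\<^sub>R (A *v v) - \<theta>\<^sup>2 *\<^sub>R (A *v w)"
        by (simp add: Nz zw vec.diff vec.scale scaleR_eq_smult)
      moreover have "D z = - of_real (\<theta>\<^sup>2) * cinner w C"
        by (simp add: Dz zw cinner_simps v)
      ultimately have "norm (\<theta> *\<^sub>R (A *v v) - \<theta>\<^sup>2 *\<^sub>R (A *v w)) \<le> \<theta>\<^sup>2 * cmod (cinner w C)"
        by (simp add: norm_mult norm_power)
      then have "norm (\<theta> *\<^sub>R (A *v v)) \<le> \<theta>\<^sup>2 * cmod (cinner w C) + norm (\<theta>\<^sup>2 *\<^sub>R (A *v w))"
        using norm_triangle_sub[of "\<theta> *\<^sub>R (A *v v)" "\<theta>\<^sup>2 *\<^sub>R (A *v w)"] by linarith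
      then show "\<theta> * norm (A *v v) \<le> (cmod (cinner w C) + norm (A *v w)) * \<theta>\<^sup>2"
        using \<theta> by (simp add: algebra_simps)
    qed simp
    then show ?thesis by simp
  qed
  have ker': "A *v v = 0" if v: "cinner v C = 0" for v
  proof (cases "v = 0")
    case False
    have "A *v ((1 / norm v) *\<^sub>R v) = 0"
      by (intro ker) (use False v in \<open>auto simp: cinner_simps\<close>)
    then show ?thesis using False by (simp add: scaleR_eq_smult vec.scale)
  qed simp
  have "C \<noteq> 0" using D_ball[of 0] Dz[of 0] by (auto simp: cinner_simps)
  then have CC: "cinner C C \<noteq> 0" by (simp add: cinner_self)
  \<comment> \<open>A linear map vanishing on the kernel of \<open>\<lambda>x. cinner x C\<close>
    factors through it, so \<open>N\<close> is the fixed vector \<open>k\<close> times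
    \<open>D\<close>.\<close>
  define k where "k = (1 / cinner C C) *s (A *v C)"
  have Ax: "A *v x = cinner x C *s k" for x
  proof -
    have "A *v (x - (cinner x C / cinner C C) *s C) = 0"
      by (rule ker') (simp add: cinner_simps CC)
    then show ?thesis by (simp add: vec.diff vec.scale k_def)
  qed
  have const: "\<phi> z = k" if "z \<in> ball 0 1" for z
    using D_ball[OF that] by (simp add: \<phi>_eq Nz Ax Dz)
  \<comment> \<open>The constant value is the fixed point, which is interior; this contradicts the
    supremum norm 1.\<close>
  have "k = z0" using const[OF z0_ball] \<phi>_z0 by simp
  obtain z where "z \<in> ball 0 1" "norm (\<phi> z) > norm z0"
    using exists_\<phi>_near_sphere[of "norm z0"] z0_ball by auto
  then show False using const \<open>k = z0\<close> by auto
qed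

lemma continuous_on_\<phi>: "continuous_on (cball 0 1) \<phi>"
proof -
  have "continuous_on (cball 0 1) (\<lambda>z. (1 / D z) *s N z)"
    using D_nonzero by (intro continuous_on_smult continuous_on_divide continuous_on_D continuous_on_N continuous_on_const) auto
  then show ?thesis by (simp add: \<phi>_eq[abs_def])
qed

lemma \<phi>_cball:
  assumes "z \<in> cball 0 1"
  shows "\<phi> z \<in> cball 0 1"
  using norm_N_le[OF assms] D_nonzero[OF assms] by (simp add: \<phi>_eq norm_smult norm_divide field_simps)

lemma \<phi>_reaches_sphere:
  obtains z where "norm z = 1" "norm (\<phi> z) = 1"
proof -
  have "\<exists>z\<in>cball 0 1. \<forall>y\<in>cball 0 1. norm (\<phi> y) \<le> norm (\<phi> z)"
    by (intro continuous_attains_sup continuous_on_norm continuous_on_\<phi>) auto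
  then obtain z where z: "z \<in> cball 0 1" "\<And>y. y \<in> cball 0 1 \<Longrightarrow> norm (\<phi> y) \<le> norm (\<phi> z)"
    by auto
  have "norm (\<phi> z) \<ge> 1"
  proof (rule ccontr)
    assume "\<not> norm (\<phi> z) \<ge> 1"
    then obtain y where "y \<in> ball 0 1" "norm (\<phi> y) > norm (\<phi> z)"
      using exists_\<phi>_near_sphere[of "norm (\<phi> z)"] by auto
    then show False using z(2)[of y] by auto
  qed
  moreover have "norm (\<phi> z) \<le> 1" using \<phi>_cball[OF z(1)] by simp
  moreover have "norm z \<ge> 1" using \<phi>_ball[of z] \<open>norm (\<phi> z) \<ge> 1\<close> by (cases "norm z < 1") auto
  ultimately show ?thesis using that[of z] z(1) by simp
qed

section \<open>The derivative at the fixed point and its eigenvalues\<close>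

definition "P x = (1 / D z0) *s (A *v x - cinner x C *s z0)"

definition "c x = cinner x C / D z0"

lemma D_z0: "D z0 \<noteq> 0"
  using D_ball z0_ball by blast

lemma D_translate: "D (z0 + x) = D z0 * (1 + c x)"
  using D_diff[of "z0 + x" z0] D_z0 by (simp add: c_def field_simps)

lemma N_z0: "N z0 = D z0 *s z0"
proof -
  have "D z0 *s \<phi> z0 = N z0"
    unfolding \<phi>_eq using D_z0 by simp
  then show ?thesis by (simp add: \<phi>_z0)
qed

lemma N_translate: "N (z0 + x) = D z0 *s (P x + (1 + c x) *s z0)"
proof -
  have "N (z0 + x) = N z0 + A *v x"
    using N_diff[of "z0 + x" z0] by (simp add: algebra_simps)
  moreover have "D z0 *s P x = A *v x - cinner x C *s z0"
    using D_z0 by (simp add: P_def)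
  moreover have "D z0 * (1 + c x) = D z0 + cinner x C"
    using D_z0 by (simp add: c_def distrib_left)
  then have "D z0 *s ((1 + c x) *s z0) = D z0 *s z0 + cinner x C *s z0"
    by (metis vec.scale_left_distrib vec.scale_scale)
  ultimately show ?thesis
    by (simp add: N_z0 vec.scale_right_distrib del: vec.scale_scale)
qed

lemma \<phi>_translate:
  assumes "D (z0 + x) \<noteq> 0"
  shows "\<phi> (z0 + x) = z0 + (1 / (1 + c x)) *s P x"
proof -
  have "1 + c x \<noteq> 0" using assms D_translate by auto
  then show ?thesis
    using D_z0 unfolding \<phi>_eq N_translate D_translate vec.scale_right_distrib vec.scale_scale
    by (simp del: vec.scale_left_distrib)
qed

lemma c_linear: "c (x + y) = c x + c y" "c (x - y) = c x - c y" "c (a *s x) = a * c x" "c 0 = 0"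
  by (simp_all only: c_def cinner_simps add_divide_distrib diff_divide_distrib times_divide_eq_right div_0)

lemma P_linear:
  "P (x + y) = P x + P y" "P (x - y) = P x - P y" "P (a *s x) = a *s P x" "P 0 = 0"
  "P (r *\<^sub>R x) = r *\<^sub>R P x"
proof -
  show *: "P (x + y) = P x + P y" for x y
    unfolding P_def vec.add cinner_simps vec.scale_left_distrib vec.scale_right_distrib vec.scale_right_diff_distrib
    by simp
  show **: "P (a *s x) = a *s P x" for a x
    unfolding P_def vec.scale cinner_simps vec.scale_right_diff_distrib vec.scale_scale by (simp add: mult_ac)
  show "P (x - y) = P x - P y"
    using *[of "x - y" y] by simp
  show "P 0 = 0" using **[of 0] by simp
  show "P (r *\<^sub>R x) = r *\<^sub>R P x" by (simp only: scaleR_eq_smult **)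
qed

lemma bounded_linear_P: "bounded_linear P"
  by (intro linear_conv_bounded_linear[THEN iffD1] linearI) (simp_all add: P_linear)

lemma bounded_linear_c: "bounded_linear c"
  unfolding c_def by (rule bounded_linear_compose[OF bounded_linear_divide bounded_linear_cinner])

text \<open>After recentring at the fixed point (\<open>\<phi>_translate\<close>) the numerator
  \<open>P\<close> has no constant term, so the denominator contributes nothing to first
  order.\<close>

lemma frechet_\<phi>_z0: "frechet_derivative \<phi> (at z0) = P"
proof (rule frechet_derivative_at[symmetric])
  have eq: "z0 + (1 / (1 + c (z - z0))) *s P (z - z0) = \<phi> z" if "z \<in> ball 0 1" for z
    using \<phi>_translate[of "z - z0"] D_ball[OF that] by simp
  have diff: "((\<lambda>z. z - z0) has_derivative (\<lambda>z. z)) (at z0)"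
    using has_derivative_diff[OF has_derivative_ident has_derivative_const, of z0 "at z0"] by simp
  have P': "((\<lambda>z. P (z - z0)) has_derivative P) (at z0)"
    using bounded_linear.has_derivative[OF bounded_linear_P diff] by simp
  have "((\<lambda>z. 1 + c (z - z0)) has_derivative c) (at z0)"
    using has_derivative_add[OF has_derivative_const[of 1] bounded_linear.has_derivative[OF bounded_linear_c diff]] by simp
  from Deriv.has_derivative_inverse[OF _ this]
  have c'': "((\<lambda>z. 1 / (1 + c (z - z0))) has_derivative (\<lambda>x. - c x)) (at z0)"
    by (simp add: c_linear inverse_eq_divide)
  have "((\<lambda>z. z0 + (1 / (1 + c (z - z0))) *s P (z - z0)) has_derivative P) (at z0)"
    using has_derivative_add[OF has_derivative_const bounded_bilinear.FDERIV[OF bounded_bilinear_smult c'' P'], of z0]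
    by (simp add: P_linear c_linear)
  then show "(\<phi> has_derivative P) (at z0)"
    by (rule has_derivative_transform_within_open[OF _ open_ball z0_ball eq])
qed

lemma linear_P: "linear P"
  using bounded_linear_P by (rule bounded_linear.linear)

lemma P_pow_linear:
  "(P ^^ n) (x + y) = (P ^^ n) x + (P ^^ n) y" "(P ^^ n) (a *s x) = a *s (P ^^ n) x"
  by (induction n) (simp_all add: P_linear)

lemma cmod_eigenvalue_neq_1:
  assumes "P v = \<mu> *s v" "v \<noteq> 0"
  shows "cmod \<mu> \<noteq> 1"
proof
  assume \<mu>: "cmod \<mu> = 1"
  define E where "E w = P w - \<mu> *s w" for w
  have E0: "(E ^^ m) 0 = 0" for m
    by (induction m) (simp_all add: E_def P_linear)
  have "E v = 0" using assms(1) by (simp add: E_def)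
  \<comment> \<open>\<open>CARD('n)\<close> is positive: the first application of \<open>E\<close>
    kills \<open>v\<close>, and the others fix 0.\<close>
  then have "(E ^^ CARD('n)) v = 0"
    using E0[of "CARD('n) - 1"] funpow_Suc_right[of "CARD('n) - 1" E] by simp
  then have "v \<in> unitary_space \<phi> z0"
    unfolding unitary_space_def Let_def frechet_\<phi>_z0 E_def[abs_def]
    using \<mu> by (intro span_base) blast
  then show False using dim_unitary assms(2) by (auto simp: dim_eq_0)
qed

text \<open>On the complex line through \<open>z0\<close> in the direction of an eigenvector \<open>v\<close>, in the coordinate
  \<open>u = 1/s\<close> of the point \<open>z0 + s v\<close>, the map is \<open>u \<mapsto> (u + c v)/\<mu>\<close>. If \<open>|\<mu>| > 1\<close>, it
  contracts to \<open>c v/(\<mu> - 1)\<close>, which would be a second fixed point.\<close>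
lemma cmod_eigenvalue_le_1:
  assumes Pv: "P v = \<mu> *s v" and v: "v \<noteq> 0"
  shows "cmod \<mu> \<le> 1"
proof (rule ccontr)
  assume "\<not> cmod \<mu> \<le> 1"
  then have \<mu>: "cmod \<mu> > 1" by simp
  then have \<mu>0: "\<mu> \<noteq> 0" "\<mu> \<noteq> 1" by auto
  define u where "u = c v / (\<mu> - 1)"
  \<comment> \<open>The displacement \<open>s0 *s v\<close> has norm
    \<open>(1 - norm z0) / 2\<close>, so the orbit starts inside the ball.\<close>
  define s0 where "s0 = complex_of_real ((1 - norm z0) / (2 * norm v))"
  have z01: "norm z0 < 1" using z0_ball by simp
  have s0: "s0 \<noteq> 0" using v z01 by (simp add: s0_def)
  have step: "\<phi> (z0 + s *s v) = z0 + (\<mu> * s / (1 + s * c v)) *s v \<and> 1 + s * c v \<noteq> 0"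
    if "z0 + s *s v \<in> cball 0 1" for s
  proof -
    have "D (z0 + s *s v) \<noteq> 0" by (rule D_nonzero[OF that])
    then show ?thesis
      using \<phi>_translate[of "s *s v"] D_translate[of "s *s v"]
      by (simp add: P_linear c_linear Pv mult_ac)
  qed
  have orbit: "\<exists>s. z0 + s *s v \<in> ball 0 1 \<and> s \<noteq> 0 \<and> 1 / s = u + (1 / s0 - u) / \<mu> ^ n" for n
  proof (induction n)
    case 0
    have "norm (z0 + s0 *s v) \<le> norm z0 + norm (s0 *s v)" by (rule norm_triangle_ineq)
    also have "norm (s0 *s v) = (1 - norm z0) / 2"
      using v z01 unfolding norm_smult s0_def norm_of_real by simp
    also have "norm z0 + (1 - norm z0) / 2 < 1" using z01 by argo
    finally show ?case using s0 by (intro exI[of _ s0]) simp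
  next
    case (Suc n)
    then obtain s where s: "z0 + s *s v \<in> ball 0 1" "s \<noteq> 0" "1 / s = u + (1 / s0 - u) / \<mu> ^ n" by blast
    have s1: "z0 + s *s v \<in> cball 0 1" using s(1) by simp
    define s' where "s' = \<mu> * s / (1 + s * c v)"
    have "z0 + s' *s v \<in> ball 0 1"
      using \<phi>_ball[OF s(1)] step[OF s1] by (simp only: s'_def)
    moreover have s'0: "s' \<noteq> 0" using step[OF s1] s(2) \<mu>0 by (simp add: s'_def)
    moreover have "1 / s' = (1 / s + c v) / \<mu>"
      using step[OF s1] s(2) \<mu>0 by (simp add: s'_def field_simps)
    then have "1 / s' = (u + (1 / s0 - u) / \<mu> ^ n + c v) / \<mu>" by (simp only: s(3))
    then have "1 / s' = (u + c v) / \<mu> + (1 / s0 - u) / \<mu> ^ Suc n"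
      by (simp add: add_divide_distrib mult.commute)
    moreover have "(u + c v) / \<mu> = u"
    proof -
      have "c v = u * (\<mu> - 1)" using \<mu>0 by (simp add: u_def)
      then have "u + c v = u * \<mu>" by (simp add: algebra_simps)
      then show ?thesis using \<mu>0 by simp
    qed
    ultimately show ?case by (intro exI[of _ s']) simp
  qed
  then obtain s where s: "\<And>n. z0 + s n *s v \<in> ball 0 1" "\<And>n. s n \<noteq> 0"
      "\<And>n. 1 / s n = u + (1 / s0 - u) / \<mu> ^ n" by metis
  have "(\<lambda>n. u + (1 / s0 - u) * (1 / \<mu>) ^ n) \<longlonglongrightarrow> u + (1 / s0 - u) * 0"
    using \<mu> by (intro tendsto_intros LIMSEQ_power_zero) (simp add: norm_divide divide_less_eq_1)
  then have lim: "(\<lambda>n. 1 / s n) \<longlonglongrightarrow> u" by (simp add: s(3) power_divide)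
  \<comment> \<open>The orbit stays in the ball, so \<open>s n\<close> is bounded and
    \<open>1 / s n\<close> keeps away from 0. Hence its limit \<open>u\<close> is nonzero, and
    \<open>z0 + (1 / u) *s v\<close> is a genuine limit point of the orbit.\<close>
  have "cmod (1 / s n) \<ge> norm v / 2" for n
  proof -
    have "norm (s n *s v) \<le> norm (z0 + s n *s v) + norm z0"
      using norm_triangle_ineq4[of "z0 + s n *s v" z0] by simp
    then have "cmod (s n) * norm v \<le> 2" using s(1)[of n] z01 by (simp add: norm_smult)
    then show ?thesis using s(2)[of n] by (simp add: norm_divide field_simps)
  qed
  then have "cmod u \<ge> norm v / 2"
    by (intro tendsto_lowerbound[OF tendsto_norm[OF lim]]) auto
  then have u0: "u \<noteq> 0" using v by auto
  define z where "z = z0 + (1 / u) *s v"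
  have "(\<lambda>n. 1 / (1 / s n)) \<longlonglongrightarrow> 1 / u" by (intro tendsto_intros lim u0)
  then have "s \<longlonglongrightarrow> 1 / u" by simp
  then have "(\<lambda>n. z0 + s n *s v) \<longlonglongrightarrow> z"
    unfolding z_def
    by (intro tendsto_add tendsto_const bounded_linear.tendsto[OF bounded_linear_smult_left])
  then have z: "z \<in> cball 0 1"
    by (rule closed_sequentially[OF closed_cball, rotated]) (use s(1) in \<open>simp add: less_imp_le\<close>)
  have "c v = u * (\<mu> - 1)" using \<mu>0 by (simp add: u_def)
  then have "1 + (1 / u) * c v = \<mu>" using u0 by (simp add: add_eq_0_iff)
  then have "\<mu> * (1 / u) / (1 + (1 / u) * c v) = 1 / u" using \<mu>0 by simp
  then have "\<phi> z = z" using step[of "1 / u"] z unfolding z_def by metis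
  then have "z \<in> lfm_fixed_points_closed A B C d"
    using z D_nonzero[OF z] by (simp add: lfm_fixed_points_closed_def D_def)
  then have "z = z0" using fixed_points by simp
  then have "(1 / u) *s v = 0" by (simp add: z_def)
  then show False using u0 v by simp
qed

lemma cmod_eigenvalue_less_1: "P v = \<mu> *s v \<Longrightarrow> v \<noteq> 0 \<Longrightarrow> cmod \<mu> < 1"
  using cmod_eigenvalue_neq_1[of v \<mu>] cmod_eigenvalue_le_1[of v \<mu>] by simp

end

section \<open>Powers of the derivative tend to zero\<close>

lemma linear_recurrence_tendsto_0:
  fixes x y :: "nat \<Rightarrow> 'a::real_normed_vector" and q :: real
  assumes "q < 1" "q \<ge> 0" and y: "y \<longlonglongrightarrow> 0" and rec: "\<And>n. norm (x (Suc n)) \<le> q * norm (x n) + norm (y n)"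
  shows "x \<longlonglongrightarrow> 0"
proof (rule LIMSEQ_I)
  fix r :: real assume r: "r > 0"
  \<comment> \<open>With this choice \<open>r / 2\<close> is the fixed point of
    \<open>x \<mapsto> q * x + e\<close>.\<close>
  define e where "e = r / 2 * (1 - q)"
  have e: "e > 0" using r assms by (simp add: e_def)
  obtain n0 where n0: "\<And>n. n \<ge> n0 \<Longrightarrow> norm (y n) < e"
    using LIMSEQ_D[OF y e] by auto
  have *: "norm (x (n0 + k)) \<le> q ^ k * norm (x n0) + r / 2" for k
  proof (induction k)
    case (Suc k)
    have "norm (x (n0 + Suc k)) \<le> q * norm (x (n0 + k)) + e"
      using rec[of "n0 + k"] n0[of "n0 + k"] by simp
    also have "\<dots> \<le> q * (q ^ k * norm (x n0) + r / 2) + e"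
      using Suc assms by (intro add_right_mono mult_left_mono) auto
    also have "\<dots> = q ^ Suc k * norm (x n0) + r / 2" by (simp add: e_def field_simps)
    finally show ?case .
  qed (use r in simp)
  have "(\<lambda>k. q ^ k * norm (x n0)) \<longlonglongrightarrow> 0"
    using assms by (intro tendsto_mult_left_zero LIMSEQ_power_zero) simp
  from LIMSEQ_D[OF this, of "r / 2"] obtain k0 where k0: "\<And>k. k \<ge> k0 \<Longrightarrow> q ^ k * norm (x n0) < r / 2"
    using r assms by auto
  have "norm (x n - 0) < r" if "n \<ge> n0 + k0" for n
    using *[of "n - n0"] k0[of "n - n0"] that by fastforce
  then show "\<exists>no. \<forall>n\<ge>no. norm (x n - 0) < r" by blast
qed

context lfm_interior_fixed_point
begin

text \<open>This is the polynomial \<open>q\<close> in the operator \<open>P\<close>, applied to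
  \<open>x\<close>. The summation bound is a parameter instead of \<open>degree q\<close>, which
  makes it usable as the induction variable below.\<close>

definition "poly_act n q x = (\<Sum>i\<le>n. coeff q i *s (P ^^ i) x)"

lemma poly_act_mult_linear:
  assumes "degree q \<le> n"
  shows "poly_act (Suc n) ([:- r, 1:] * q) x = poly_act n q (P x - r *s x)"
proof -
  have coeff: "coeff ([:- r, 1:] * q) i = coeff (pCons 0 q) i - r * coeff q i" for i
    by simp
  have "poly_act (Suc n) ([:- r, 1:] * q) x =
      (\<Sum>i\<le>Suc n. coeff (pCons 0 q) i *s (P ^^ i) x) - (\<Sum>i\<le>Suc n. (r * coeff q i) *s (P ^^ i) x)"
    unfolding poly_act_def sum_subtractf[symmetric]
    by (simp only: coeff vec.scale_left_diff_distrib)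
  also have "(\<Sum>i\<le>Suc n. coeff (pCons 0 q) i *s (P ^^ i) x) = (\<Sum>i\<le>n. coeff q i *s (P ^^ i) (P x))"
    unfolding sum.atMost_Suc_shift by (simp add: funpow_swap1)
  also have "(\<Sum>i\<le>Suc n. (r * coeff q i) *s (P ^^ i) x) = (\<Sum>i\<le>n. (r * coeff q i) *s (P ^^ i) x)"
    using assms by (simp add: coeff_eq_0)
  also have "(\<Sum>i\<le>n. coeff q i *s (P ^^ i) (P x)) - (\<Sum>i\<le>n. (r * coeff q i) *s (P ^^ i) x)
      = poly_act n q (P x - r *s x)"
  proof -
    have *: "(P ^^ i) (P x - r *s x) = (P ^^ i) (P x) - r *s (P ^^ i) x" for i
      using P_pow_linear(1)[of i "P x - r *s x" "r *s x"] by (simp add: P_pow_linear algebra_simps)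
    show ?thesis unfolding poly_act_def sum_subtractf[symmetric] *
      by (intro sum.cong refl) (simp add: vec.scale_right_diff_distrib mult.commute)
  qed
  finally show ?thesis .
qed

lemma poly_act_linear:
  "poly_act n q (P x - r *s x) = P (poly_act n q x) - r *s poly_act n q x"
proof -
  have *: "(P ^^ i) (P x - r *s x) = P ((P ^^ i) x) - r *s (P ^^ i) x" for i
    using P_pow_linear(1)[of i "P x - r *s x" "r *s x"] by (simp add: P_pow_linear algebra_simps funpow_swap1)
  have "P (poly_act n q x) = (\<Sum>i\<le>n. coeff q i *s P ((P ^^ i) x))"
    unfolding poly_act_def linear_sum[OF linear_P] by (simp add: P_linear)
  moreover have "r *s poly_act n q x = (\<Sum>i\<le>n. coeff q i *s (r *s (P ^^ i) x))"
    unfolding poly_act_def vec.scale_sum_right by (simp add: mult.commute)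
  ultimately show ?thesis
    unfolding poly_act_def[of n q "P x - r *s x"] * by (simp only: vec.scale_right_diff_distrib sum_subtractf)
qed

text \<open>This stands in for the Jordan form. Split off a root \<open>r\<close> of
  \<open>q\<close> with cofactor \<open>p\<close>. If \<open>r\<close> lies in the open disc,
  \<open>p\<close> annihilates \<open>P x - r *s x\<close>, and the iterates of \<open>x\<close>
  satisfy a contracting recurrence with a null perturbation. Otherwise a nonzero
  \<open>poly_act n p x\<close> would be an eigenvector with eigenvalue \<open>r\<close>, so
  \<open>p\<close> already annihilates \<open>x\<close>.\<close>

lemma P_pow_tendsto_0_if_annihilated:
  assumes "q \<noteq> 0" "degree q \<le> n" "poly_act n q x = 0"
  shows "(\<lambda>k. (P ^^ k) x) \<longlonglongrightarrow> 0"
  using assms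
proof (induction n arbitrary: q x)
  case 0
  then have "coeff q 0 *s x = 0" "coeff q 0 \<noteq> 0"
    using leading_coeff_0_iff[of q] by (auto simp: poly_act_def)
  then have x: "x = 0" by simp
  have "(P ^^ k) 0 = 0" for k by (induction k) (simp_all add: P_linear)
  then show ?case by (simp add: x)
next
  case (Suc n)
  show ?case
  proof (cases "degree q = 0")
    case True
    have "poly_act (Suc n) q x = coeff q 0 *s x"
      unfolding poly_act_def sum.atMost_Suc_shift using True by (simp add: coeff_eq_0)
    moreover have "coeff q 0 \<noteq> 0" using Suc.prems(1) True leading_coeff_0_iff[of q] by simp
    ultimately have x: "x = 0" using Suc.prems(3) by simp
    have "(P ^^ k) 0 = 0" for k by (induction k) (simp_all add: P_linear)
    then show ?thesis by (simp add: x)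
  next
    case False
    then have "\<not> constant (poly q)" by (simp add: constant_degree)
    then obtain r where "poly q r = 0" using fundamental_theorem_of_algebra by blast
    then obtain p where q: "q = [:- r, 1:] * p" unfolding poly_eq_0_iff_dvd by (elim dvdE)
    have p0: "p \<noteq> 0" using q Suc.prems(1) by auto
    then have "degree q = Suc (degree p)" unfolding q by (subst degree_mult_eq) auto
    then have p: "degree p \<le> n" using Suc.prems(2) by simp
    define y where "y = P x - r *s x"
    have py: "poly_act n p y = 0"
      using Suc.prems(3) poly_act_mult_linear[OF p] unfolding q y_def by simp
    show ?thesis
    proof (cases "cmod r < 1")
      case True
      have y0: "(\<lambda>k. (P ^^ k) y) \<longlonglongrightarrow> 0" by (rule Suc.IH[OF p0 p py])
      have "norm ((P ^^ Suc k) x) \<le> cmod r * norm ((P ^^ k) x) + norm ((P ^^ k) y)" for k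
      proof -
        have "P x = r *s x + y" by (simp add: y_def)
        then have "(P ^^ Suc k) x = r *s (P ^^ k) x + (P ^^ k) y"
          unfolding funpow_Suc_right comp_apply by (simp only: P_pow_linear)
        then show ?thesis using norm_triangle_ineq[of "r *s (P ^^ k) x" "(P ^^ k) y"] by (simp add: norm_smult)
      qed
      then show ?thesis by (rule linear_recurrence_tendsto_0[OF True norm_ge_zero y0])
    next
      case False
      have eig: "P (poly_act n p x) = r *s poly_act n p x"
        using py by (simp only: y_def poly_act_linear right_minus_eq)
      have "poly_act n p x = 0"
      proof (rule ccontr)
        assume "poly_act n p x \<noteq> 0"
        then show False using cmod_eigenvalue_less_1[OF eig] False by simp
      qed
      then show ?thesis by (rule Suc.IH[OF p0 p])
    qed
  qed
qed

text \<open>The first \<open>n + 1\<close> iterates of \<open>x\<close> are linearly dependent for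
  \<open>n\<close> the real dimension. Dependence is a property of sets, so a repetition among the
  iterates is treated separately; it gives a difference of two monomials.\<close>

lemma exists_annihilating_poly: "\<exists>q n. q \<noteq> 0 \<and> degree q \<le> n \<and> poly_act n q x = 0"
proof -
  define n where "n = DIM(complex ^ 'n)"
  define v where "v i = (P ^^ i) x" for i
  show ?thesis
  proof (cases "inj_on v {..n}")
    case True
    have "n < card (v ` {..n})" by (simp only: card_image[OF True] card_atMost lessI)
    then have "dependent (v ` {..n})"
      by (intro dependent_biggerset) (simp add: n_def)
    then obtain u where u: "(\<Sum>w\<in>v ` {..n}. u w *\<^sub>R w) = 0" "\<exists>w\<in>v ` {..n}. u w \<noteq> 0"
      by (subst (asm) dependent_finite) auto
    define q where "q = Poly (map (\<lambda>i. complex_of_real (u (v i))) [0..<Suc n])"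
    have q: "coeff q i = complex_of_real (u (v i))" if "i \<le> n" for i
      using that by (simp add: q_def coeff_Poly_eq nth_default_def del: upt_Suc)
    have "degree q \<le> n"
      by (rule degree_le) (auto simp: q_def coeff_Poly_eq nth_default_def)
    moreover have "q \<noteq> 0" using u(2) q by force
    moreover have "poly_act n q x = 0"
    proof -
      have "poly_act n q x = (\<Sum>i\<le>n. u (v i) *\<^sub>R v i)"
        unfolding poly_act_def by (intro sum.cong refl) (simp add: q v_def scaleR_eq_smult)
      then show ?thesis using u(1) sum.reindex[OF True, of "\<lambda>w. u w *\<^sub>R w"] by simp
    qed
    ultimately show ?thesis by blast
  next
    case False
    then obtain i j where ij: "i \<le> n" "j \<le> n" "i \<noteq> j" "v i = v j" by (auto simp: inj_on_def)
    define q :: "complex poly" where "q = monom 1 i - monom 1 j"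
    have "coeff q i = 1" using ij by (simp add: q_def)
    then have "q \<noteq> 0" by force
    moreover have "degree q \<le> n"
      by (rule degree_le) (use ij in \<open>auto simp: q_def\<close>)
    moreover have "poly_act n q x = 0"
    proof -
      have "poly_act n q x = (\<Sum>k\<le>n. (if k = i then v k else 0) - (if k = j then v k else 0))"
        unfolding poly_act_def by (intro sum.cong refl) (simp add: q_def v_def vec.scale_left_diff_distrib)
      then show ?thesis using ij by (simp add: sum_subtractf)
    qed
    ultimately show ?thesis by blast
  qed
qed

lemma P_pow_tendsto_0: "(\<lambda>k. (P ^^ k) x) \<longlonglongrightarrow> 0"
  using exists_annihilating_poly[of x] P_pow_tendsto_0_if_annihilated by blast

section \<open>Linearization and escape of orbits from the sphere\<close>

text \<open>The functional \<open>l\<close> with \<open>l \<circ> (I - P) = c\<close> linearizes \<open>\<phi>\<close>: in the coordinate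
  \<open>y = x/(1 + l x)\<close>, where \<open>x = z - z0\<close>, the map \<open>\<phi>\<close> becomes \<open>P\<close>.\<close>
lemma linearizing_functional:
  obtains l :: "complex ^ 'n \<Rightarrow> complex"
  where "bounded_linear l" "\<And>a x. l (a *s x) = a * l x" "\<And>x. c x + l (P x) = l x"
proof -
  have lin: "linear (\<lambda>x. x - P x)"
    by (intro linearI) (simp_all add: P_linear scaleR_right_diff_distrib)
  have "inj (\<lambda>x. x - P x)"
    unfolding linear_injective_0[OF lin]
  proof (intro allI impI)
    fix x assume "x - P x = 0"
    then have "P x = 1 *s x" by simp
    then show "x = 0" using cmod_eigenvalue_less_1[of x 1] by auto
  qed
  then obtain G where G: "linear G" "\<And>x. G (x - P x) = x" "\<And>x. G x - P (G x) = x"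
    using linear_injective_isomorphism[OF lin] by blast
  \<comment> \<open>The inverse \<open>G\<close> of \<open>I - P\<close> is supplied as a real
    linear map; complex homogeneity is inherited from \<open>P\<close>.\<close>
  have G_smult: "G (a *s x) = a *s G x" for a x
  proof -
    have "a *s x = a *s G x - P (a *s G x)"
      unfolding P_linear vec.scale_right_diff_distrib[symmetric] G(3) ..
    then show ?thesis using G(2)[of "a *s G x"] by simp
  qed
  show ?thesis
  proof (rule that[of "\<lambda>x. c (G x)"])
    show "bounded_linear (\<lambda>x. c (G x))"
      using G(1) by (intro bounded_linear_compose[OF bounded_linear_c] linear_conv_bounded_linear[THEN iffD1])
    show "c (G (a *s x)) = a * c (G x)" for a x by (simp add: G_smult c_linear)
    show "c x + c (G (P x)) = c (G x)" for x
    proof -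
      have "G (x - P x) = G x - G (P x)" by (rule linear_diff[OF G(1)])
      then have "c x = c (G x - G (P x))" by (simp add: G(2))
      then show ?thesis by (simp add: c_linear)
    qed
  qed
qed

text \<open>The linearizing coordinate is singular where \<open>1 + l (z - z0) = 0\<close>. The part
  \<open>S\<close> of this hyperplane in the closed ball is compact, convex and invariant under
  \<phi>, so if nonempty it would contain a fixed point by Brouwer. That point would be
  \<open>z0\<close>, where the expression is 1. The coordinate is therefore regular along the orbit,
  where \<phi> acts as \<open>P\<close>, and the orbit tends to \<open>z0\<close>.\<close>

lemma \<phi>_iterates_enter_ball:
  assumes w: "w \<in> cball 0 1"
  shows "\<exists>n. norm ((\<phi> ^^ n) w) < 1"
proof -
  obtain l where l: "bounded_linear l" "\<And>a x. l (a *s x) = a * l x" "\<And>x. c x + l (P x) = l x"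
    using linearizing_functional by blast
  have l0: "l 0 = 0" by (rule linear_0[OF bounded_linear.linear[OF l(1)]])
  have ldiff: "l (x - y) = l x - l y" for x y
    by (rule linear_diff[OF bounded_linear.linear[OF l(1)]])
  have step: "1 + c (z - z0) \<noteq> 0 \<and> \<phi> z - z0 = (1 / (1 + c (z - z0))) *s P (z - z0)
      \<and> 1 + l (\<phi> z - z0) = (1 + l (z - z0)) / (1 + c (z - z0))" if "z \<in> cball 0 1" for z
  proof (intro conjI)
    have Dz: "D (z0 + (z - z0)) \<noteq> 0" using D_nonzero[OF that] by simp
    then show 1: "1 + c (z - z0) \<noteq> 0" unfolding D_translate by simp
    show 2: "\<phi> z - z0 = (1 / (1 + c (z - z0))) *s P (z - z0)"
      using \<phi>_translate[OF Dz] by simp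
    show "1 + l (\<phi> z - z0) = (1 + l (z - z0)) / (1 + c (z - z0))"
      unfolding 2 l(2) l(3)[of "z - z0", symmetric] using 1 by (simp add: field_simps)
  qed
  define S where "S = {z \<in> cball 0 1. 1 + l (z - z0) = 0}"
  have S_empty: "S = {}"
  proof (rule ccontr)
    assume "S \<noteq> {}"
    have cl: "continuous_on UNIV (\<lambda>z. 1 + l (z - z0))"
      by (intro continuous_on_add continuous_on_const bounded_linear.continuous_on[OF l(1)]
          continuous_on_diff continuous_on_id)
    have S_eq: "S = cball 0 1 \<inter> {z. 1 + l (z - z0) = 0}" by (auto simp: S_def)
    have "closed {z. 1 + l (z - z0) = 0}"
      using cl by (intro closed_Collect_eq continuous_on_const)
    then have "compact S" unfolding S_eq by (intro compact_Int_closed compact_cball)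
    moreover have "convex {z. 1 + l (z - z0) = 0}"
    proof (rule convexI)
      fix x y :: "complex ^ 'n" and u v :: real
      assume xy: "x \<in> {z. 1 + l (z - z0) = 0}" "y \<in> {z. 1 + l (z - z0) = 0}" "u + v = 1"
      have e: "u *\<^sub>R x + v *\<^sub>R y - z0 = of_real u *s (x - z0) - of_real (- v) *s (y - z0)"
        using arg_cong[OF xy(3), of "\<lambda>t. t *\<^sub>R z0"]
        by (simp add: scaleR_eq_smult[symmetric] algebra_simps)
      have "l (x - z0) = -1" "l (y - z0) = -1"
        using xy(1,2) by (simp_all add: add_eq_0_iff)
      then have "l (u *\<^sub>R x + v *\<^sub>R y - z0) = - of_real (u + v)"
        unfolding e ldiff l(2) by simp
      then show "u *\<^sub>R x + v *\<^sub>R y \<in> {z. 1 + l (z - z0) = 0}" using xy(3) by simp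
    qed
    then have "convex S" unfolding S_eq by (intro convex_Int convex_cball)
    moreover have "continuous_on S \<phi>"
      by (rule continuous_on_subset[OF continuous_on_\<phi>]) (auto simp: S_def)
    moreover have "\<phi> \<in> S \<rightarrow> S"
    proof
      fix z assume "z \<in> S"
      then have "z \<in> cball 0 1" "1 + l (z - z0) = 0" by (auto simp: S_def)
      moreover from step[OF this(1)]
      have "1 + l (\<phi> z - z0) = (1 + l (z - z0)) / (1 + c (z - z0))" by (elim conjE)
      ultimately have "1 + l (\<phi> z - z0) = 0" "\<phi> z \<in> cball 0 1"
        using \<phi>_cball by simp_all
      then show "\<phi> z \<in> S" by (simp only: S_def mem_Collect_eq)
    qed
    ultimately obtain z where z: "z \<in> S" "\<phi> z = z"
      using brouwer[of S \<phi>] \<open>S \<noteq> {}\<close> by blast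
    then have "z \<in> lfm_fixed_points_closed A B C d"
      using D_nonzero[of z] by (auto simp: S_def lfm_fixed_points_closed_def D_def)
    then have "z = z0" using fixed_points by simp
    then show False using z(1) l0 by (simp add: S_def)
  qed
  define z where "z n = (\<phi> ^^ n) w" for n
  have z_cball: "z n \<in> cball 0 1" for n
    unfolding z_def by (induction n) (use w \<phi>_cball in \<open>simp_all del: mem_cball\<close>)
  define Y where "Y n = (1 / (1 + l (z n - z0))) *s (z n - z0)" for n
  have lz: "1 + l (z n - z0) \<noteq> 0" for n
    using S_empty z_cball[of n] by (auto simp: S_def)
  have Y_Suc: "Y (Suc n) = P (Y n)" for n
  proof -
    have "z (Suc n) = \<phi> (z n)" by (simp add: z_def)
    moreover have "\<phi> (z n) - z0 = (1 / (1 + c (z n - z0))) *s P (z n - z0)"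
      "1 + l (\<phi> (z n) - z0) = (1 + l (z n - z0)) / (1 + c (z n - z0))"
      using step[OF z_cball[of n]] by blast+
    ultimately have "Y (Suc n) = ((1 + c (z n - z0)) / (1 + l (z n - z0)) * (1 / (1 + c (z n - z0)))) *s P (z n - z0)"
      unfolding Y_def by (simp only: vec.scale_scale divide_divide_eq_right mult_1)
    also have "(1 + c (z n - z0)) / (1 + l (z n - z0)) * (1 / (1 + c (z n - z0))) = 1 / (1 + l (z n - z0))"
      using step[OF z_cball[of n]] by simp
    finally show ?thesis by (simp add: Y_def P_linear)
  qed
  have Y_pow: "(P ^^ n) (Y 0) = Y n" for n
    by (induction n) (simp_all add: Y_Suc)
  have Y_lim: "Y \<longlonglongrightarrow> 0"
    using P_pow_tendsto_0[of "Y 0"] by (simp only: Y_pow)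
  \<comment> \<open>This is the inverse coordinate change; its denominator tends to 1 as
    \<open>Y n\<close> tends to 0.\<close>
  have z_Y: "z n - z0 = (1 / (1 - l (Y n))) *s Y n" for n
  proof -
    have "1 - l (Y n) = 1 / (1 + l (z n - z0))"
      unfolding Y_def l(2) using lz[of n] by (simp add: field_simps)
    then show ?thesis using lz[of n] by (simp add: Y_def)
  qed
  have "(\<lambda>n. l (Y n)) \<longlonglongrightarrow> 0"
    using bounded_linear.tendsto[OF l(1) Y_lim] by (simp add: l0)
  then have "(\<lambda>n. 1 / (1 - l (Y n))) \<longlonglongrightarrow> 1 / (1 - 0)"
    by (intro tendsto_divide tendsto_diff tendsto_const) auto
  from bounded_bilinear.tendsto[OF bounded_bilinear_smult this Y_lim]
  have "(\<lambda>n. z n - z0) \<longlonglongrightarrow> 0" by (simp add: z_Y)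
  moreover have "1 - norm z0 > 0" using z0_ball by simp
  ultimately obtain n where "norm (z n - z0 - 0) < 1 - norm z0"
    using LIMSEQ_D by blast
  then have "norm (z n) < 1" using norm_triangle_sub[of "z n" z0] by simp
  then show ?thesis by (auto simp: z_def)
qed

text \<open>Follow the orbit of a point \<open>w\<close> with \<open>w\<close> and
  \<open>\<phi> w\<close> on the sphere up to its first entry into the open ball. The entry time is
  at least 2, and \<zeta> is the point two steps earlier.\<close>

lemma \<phi>_leaves_sphere:
  obtains \<zeta> where "norm \<zeta> = 1" "norm (\<phi> \<zeta>) = 1" "norm (\<phi> (\<phi> \<zeta>)) < 1"
proof -
  obtain w where w: "norm w = 1" "norm (\<phi> w) = 1" by (rule \<phi>_reaches_sphere)
  then have "\<exists>n. norm ((\<phi> ^^ n) w) < 1" by (intro \<phi>_iterates_enter_ball) simp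
  define n where "n = (LEAST n. norm ((\<phi> ^^ n) w) < 1)"
  have n: "norm ((\<phi> ^^ n) w) < 1"
    unfolding n_def by (rule LeastI_ex) fact
  have cb: "norm ((\<phi> ^^ k) w) \<le> 1" for k
    by (induction k) (use w \<phi>_cball in auto)
  have min: "norm ((\<phi> ^^ k) w) = 1" if "k < n" for k
    using not_less_Least[of k "\<lambda>n. norm ((\<phi> ^^ n) w) < 1"] that cb[of k] by (simp add: n_def)
  obtain k where k: "n = Suc (Suc k)"
  proof (cases n)
    case 0
    then show ?thesis using n w by simp
  next
    case (Suc m)
    then show ?thesis using n w that by (cases m) auto
  qed
  show ?thesis
    using that[of "(\<phi> ^^ k) w"] min[of k] min[of "Suc k"] n by (simp add: k)
qed

text \<open>A Julia type inequality. The function \<open>1 - Re \<langle>\<phi> z, \<eta>\<rangle>\<close> is nonnegative on the ball and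
  vanishes at \<open>\<zeta>\<close>, so its differential there vanishes on the real tangent space of the sphere.\<close>
lemma boundary_contact:
  assumes \<zeta>: "norm \<zeta> = 1" and \<eta>: "norm \<eta> = 1" and \<phi>\<zeta>: "\<phi> \<zeta> = \<eta>"
  obtains M where "M \<ge> 1" "\<And>z. z \<in> cball 0 1 \<Longrightarrow> 1 - inner (\<phi> z) \<eta> \<le> M * (1 - inner z \<zeta>)"
proof -
  \<comment> \<open>\<open>L (z - \<zeta>)\<close> is exactly the numerator of
    \<open>1 - cinner (\<phi> z) \<eta>\<close> over the denominator \<open>D z\<close>, as
    \<open>L_eq\<close> shows.\<close>
  define L where "L x = cinner x C - cinner (A *v x) \<eta>" for x
  have L: "bounded_linear L"
    unfolding L_def
    by (intro bounded_linear_sub bounded_linear_cinner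
        bounded_linear_compose[OF bounded_linear_cinner bounded_linear_matrix_vector])
  obtain KL where KL: "\<And>x. cmod (L x) \<le> norm x * KL" "KL > 0"
    using bounded_linear.pos_bounded[OF L] by blast
  have "\<exists>z\<in>cball 0 1. \<forall>y\<in>cball 0 1. cmod (D z) \<le> cmod (D y)"
    by (rule continuous_attains_inf) (auto intro!: continuous_on_norm continuous_on_D)
  then obtain y where y: "y \<in> cball 0 1" "\<And>z. z \<in> cball 0 1 \<Longrightarrow> cmod (D y) \<le> cmod (D z)"
    by blast
  define m where "m = cmod (D y)"
  have m: "m > 0" using D_nonzero[OF y(1)] by (simp add: m_def)
  have \<zeta>1: "\<zeta> \<in> cball 0 1" using \<zeta> by simp
  define K where "K = KL * norm C / m\<^sup>2"
  have K: "K \<ge> 0" using KL(2) by (simp add: K_def)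
  define r where "r x = Re (L x / D \<zeta>)" for x
  have ND: "cinner (N z) \<eta> = D z * cinner (\<phi> z) \<eta>" if "z \<in> cball 0 1" for z
    using D_nonzero[OF that] by (simp add: \<phi>_eq cinner_simps)
  have L_eq: "L (z - \<zeta>) = D z * (1 - cinner (\<phi> z) \<eta>)" if "z \<in> cball 0 1" for z
  proof -
    have "L (z - \<zeta>) = (D z - D \<zeta>) - cinner (N z - N \<zeta>) \<eta>"
      by (simp only: L_def D_diff N_diff)
    also have "\<dots> = D z * (1 - cinner (\<phi> z) \<eta>) - D \<zeta> * (1 - cinner (\<phi> \<zeta>) \<eta>)"
      unfolding cinner_simps ND[OF that] ND[OF \<zeta>1] by (simp add: algebra_simps)
    also have "cinner (\<phi> \<zeta>) \<eta> = 1" using \<eta> by (simp add: \<phi>\<zeta> cinner_self)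
    finally show ?thesis by simp
  qed
  \<comment> \<open>Freezing the denominator at \<open>D \<zeta>\<close> gives the real linear
    approximation \<open>r\<close>; since the numerator already vanishes at \<zeta>, the error is
    quadratic.\<close>
  have h: "\<bar>(1 - inner (\<phi> z) \<eta>) - r (z - \<zeta>)\<bar> \<le> K * (norm (z - \<zeta>))\<^sup>2" if z: "z \<in> cball 0 1" for z
  proof -
    have Dz: "D z \<noteq> 0" "D \<zeta> \<noteq> 0" "cmod (D z) \<ge> m" "cmod (D \<zeta>) \<ge> m"
      using D_nonzero[OF z] D_nonzero[OF \<zeta>1] y(2)[OF z] y(2)[OF \<zeta>1] by (auto simp: m_def)
    have "1 - inner (\<phi> z) \<eta> = Re (L (z - \<zeta>) / D z)"
      using Dz by (simp add: L_eq[OF z] Re_cinner)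
    then have "(1 - inner (\<phi> z) \<eta>) - r (z - \<zeta>) = Re (L (z - \<zeta>) / D z - L (z - \<zeta>) / D \<zeta>)"
      by (simp add: r_def)
    also have "L (z - \<zeta>) / D z - L (z - \<zeta>) / D \<zeta> = - (L (z - \<zeta>) * cinner (z - \<zeta>) C / (D z * D \<zeta>))"
      using Dz D_diff[of z \<zeta>] by (simp add: field_simps)
    finally have "\<bar>(1 - inner (\<phi> z) \<eta>) - r (z - \<zeta>)\<bar> \<le> cmod (L (z - \<zeta>) * cinner (z - \<zeta>) C / (D z * D \<zeta>))"
      by (simp only: abs_Re_le_cmod norm_minus_cancel uminus_complex.sel abs_minus_cancel)
    also have "\<dots> = cmod (L (z - \<zeta>)) * cmod (cinner (z - \<zeta>) C) / (cmod (D z) * cmod (D \<zeta>))"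
      by (simp only: norm_mult norm_divide)
    also have "\<dots> \<le> (norm (z - \<zeta>) * KL) * (norm (z - \<zeta>) * norm C) / (m * m)"
      using KL m Dz by (intro frac_le mult_mono cinner_bound) auto
    also have "\<dots> = K * (norm (z - \<zeta>))\<^sup>2"
      by (simp add: K_def power2_eq_square)
    finally show ?thesis .
  qed
  have h0: "1 - inner (\<phi> z) \<eta> \<ge> 0" if "z \<in> cball 0 1" for z
    using norm_cauchy_schwarz[of "\<phi> z" \<eta>] \<phi>_cball[OF that] \<eta> by simp
  have r_lin: "r (x + y) = r x + r y" "r (a *\<^sub>R x) = a * r x" for x y a
    unfolding r_def linear_add[OF bounded_linear.linear[OF L]] linear_cmul[OF bounded_linear.linear[OF L]]
    by (simp_all add: add_divide_distrib scaleR_conv_of_real[where 'a = complex] flip: times_divide_eq_right)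
  have tangent: "r u = 0" if u: "inner u \<zeta> = 0" "norm u \<le> 1" for u
  proof -
    have "\<bar>r u\<bar> = 0"
    proof (rule eq_zero_if_quadratically_small[where K = "\<bar>r \<zeta>\<bar> + 4 * K"])
      fix \<theta> :: real assume \<theta>: "0 < \<theta>" "\<theta> \<le> 1"
      have *: "0 \<le> t * r u + (\<bar>r \<zeta>\<bar> + 4 * K) * \<theta>\<^sup>2" if t: "\<bar>t\<bar> = \<theta>" for t
      proof -
        define z where "z = (1 - t\<^sup>2) *\<^sub>R \<zeta> + t *\<^sub>R u"
        have z: "z \<in> cball 0 1"
          unfolding z_def mem_cball_0 using \<zeta> u t \<theta> by (intro tangential_disc_in_cball) auto
        have t2: "t\<^sup>2 = \<theta>\<^sup>2" using t power2_abs[of t] by simp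
        have x: "z - \<zeta> = t *\<^sub>R u + (- \<theta>\<^sup>2) *\<^sub>R \<zeta>"
          unfolding z_def t2 by (simp add: algebra_simps)
        have "norm (z - \<zeta>) \<le> norm (t *\<^sub>R u) + norm ((- \<theta>\<^sup>2) *\<^sub>R \<zeta>)"
          unfolding x by (rule norm_triangle_ineq)
        also have "\<dots> = \<theta> * norm u + \<theta> * \<theta>" using \<zeta> t by (simp add: power2_eq_square)
        also have "\<dots> \<le> \<theta> * 1 + \<theta> * 1"
          using u \<theta> by (intro add_mono mult_left_mono) auto
        finally have "(norm (z - \<zeta>))\<^sup>2 \<le> (2 * \<theta>)\<^sup>2" by (intro power_mono) auto
        then have "K * (norm (z - \<zeta>))\<^sup>2 \<le> K * (4 * \<theta>\<^sup>2)"
          using K by (intro mult_left_mono) (simp_all add: power_mult_distrib)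
        moreover have "r (z - \<zeta>) = t * r u - \<theta>\<^sup>2 * r \<zeta>" unfolding x r_lin by simp
        moreover have "- \<theta>\<^sup>2 * r \<zeta> \<le> \<theta>\<^sup>2 * \<bar>r \<zeta>\<bar>"
          using mult_left_mono[of "- r \<zeta>" "\<bar>r \<zeta>\<bar>" "\<theta>\<^sup>2"] by simp
        ultimately show ?thesis using h[OF z] h0[OF z] by (simp add: algebra_simps)
      qed
      show "\<theta> * \<bar>r u\<bar> \<le> (\<bar>r \<zeta>\<bar> + 4 * K) * \<theta>\<^sup>2"
        using *[of \<theta>] *[of "- \<theta>"] \<theta> by (cases "r u \<ge> 0") simp_all
    qed simp
    then show ?thesis by simp
  qed
  have r_eq: "r x = inner x \<zeta> * r \<zeta>" for x
  proof -
    define u where "u = x - inner x \<zeta> *\<^sub>R \<zeta>"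
    have u: "inner u \<zeta> = 0" using \<zeta> by (simp add: u_def inner_diff_left dot_square_norm)
    \<comment> \<open>Dividing by \<open>1 + norm u\<close> brings \<open>u\<close> into the unit
      ball without a separate case \<open>u = 0\<close>.\<close>
    have pos: "1 + norm u > 0" by (simp add: add_pos_nonneg)
    have "r ((1 / (1 + norm u)) *\<^sub>R u) = 0"
      by (rule tangent) (use u pos in \<open>simp_all add: divide_le_eq_1\<close>)
    moreover have "1 + norm u \<noteq> 0" using pos by simp
    ultimately have "r u = 0" unfolding r_lin by simp
    moreover have "x = u + inner x \<zeta> *\<^sub>R \<zeta>" by (simp add: u_def)
    ultimately show ?thesis using r_lin(1)[of u "inner x \<zeta> *\<^sub>R \<zeta>"] r_lin(2)[of "inner x \<zeta>" \<zeta>] by simp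
  qed
  show ?thesis
  \<comment> \<open>The term \<open>2 * K\<close> comes from
    \<open>(norm (z - \<zeta>))\<^sup>2 \<le> 2 * (1 - inner z \<zeta>)\<close> on the closed ball,
    and \<open>\<bar>r \<zeta>\<bar>\<close> from the linear part, which only sees the normal
    direction.\<close>
  proof (rule that[of "1 + \<bar>r \<zeta>\<bar> + 2 * K"])
    show "1 + \<bar>r \<zeta>\<bar> + 2 * K \<ge> 1" using K by simp
    fix z :: "complex ^ 'n" assume z: "z \<in> cball 0 1"
    define t where "t = 1 - inner z \<zeta>"
    have t: "t \<ge> 0" using norm_cauchy_schwarz[of z \<zeta>] z \<zeta> by (simp add: t_def)
    have "(norm (z - \<zeta>))\<^sup>2 = (norm z)\<^sup>2 + 1 - 2 * inner z \<zeta>"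
      using \<zeta> unfolding norm_eq_1 power2_norm_eq_inner
      by (simp add: inner_diff_left inner_diff_right inner_commute[of \<zeta> z])
    also have "\<dots> \<le> 2 * t" using z by (simp add: t_def power_le_one)
    finally have "K * (norm (z - \<zeta>))\<^sup>2 \<le> K * (2 * t)" using K by (rule mult_left_mono)
    moreover have "r (z - \<zeta>) = - t * r \<zeta>"
      using \<zeta> r_eq[of "z - \<zeta>"] by (simp add: t_def inner_diff_left dot_square_norm)
    moreover have "- t * r \<zeta> \<le> t * \<bar>r \<zeta>\<bar>"
      using mult_left_mono[of "- r \<zeta>" "\<bar>r \<zeta>\<bar>" t] t by simp
    moreover have "(1 - inner (\<phi> z) \<eta>) - r (z - \<zeta>) \<le> K * (norm (z - \<zeta>))\<^sup>2"
      using h[OF z] by (rule abs_le_D1)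
    moreover have "(1 + \<bar>r \<zeta>\<bar> + 2 * K) * t = t + t * \<bar>r \<zeta>\<bar> + K * (2 * t)"
      by (simp add: algebra_simps)
    ultimately show "1 - inner (\<phi> z) \<eta> \<le> (1 + \<bar>r \<zeta>\<bar> + 2 * K) * (1 - inner z \<zeta>)"
      using t unfolding t_def[symmetric] by linarith
  qed
qed

end

section \<open>Spaces normed by a limit of integrals\<close>

text \<open>An exponential is used rather than a reproducing kernel: it is bounded by 1 on the ball
  whatever the space, its modulus depends on \<open>inner z \<eta>\<close> alone, and positive
  powers of the modulus are again moduli of peaks. Comparisons of peaks become comparisons of
  parameters.\<close>

definition peak :: "complex ^ 'n \<Rightarrow> real \<Rightarrow> complex ^ 'n \<Rightarrow> complex" where
  "peak \<eta> t z = exp (of_real t * (cinner z \<eta> - 1))"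

lemma cmod_peak: "cmod (peak \<eta> t z) = exp (- t * (1 - inner z \<eta>))"
  by (simp add: peak_def Re_cinner algebra_simps)

lemma cmod_peak_power2: "(cmod (peak \<eta> t z))\<^sup>2 = exp (- (2 * t) * (1 - inner z \<eta>))"
  by (simp add: cmod_peak power2_eq_square exp_add[symmetric])

lemma one_minus_inner_nonneg:
  assumes "norm z \<le> 1" "norm \<eta> = 1"
  shows "0 \<le> 1 - inner z \<eta>"
  using norm_cauchy_schwarz[of z \<eta>] assms by simp

lemma cmod_peak_le_1:
  assumes "norm z \<le> 1" "norm \<eta> = 1" "t \<ge> 0"
  shows "cmod (peak \<eta> t z) \<le> 1"
  using one_minus_inner_nonneg[OF assms(1,2)] assms(3) by (simp add: cmod_peak)

lemma holo_ballI:
  assumes "\<And>z. z \<in> ball 0 1 \<Longrightarrow> (f has_derivative D z) (at z)"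
    and "\<And>z c w. z \<in> ball 0 1 \<Longrightarrow> D z (c *s w) = c * D z w"
  shows "holo_ball f"
  using assms unfolding holo_ball_def by blast

lemma holo_ball_lincomb:
  assumes "holo_ball f" "holo_ball g"
  shows "holo_ball (\<lambda>z. a * f z + b * g z)"
proof -
  have "\<exists>D. ((\<lambda>z. a * f z + b * g z) has_derivative D) (at z) \<and> (\<forall>c w. D (c *s w) = c * D w)"
    if z: "z \<in> ball 0 1" for z
  proof -
    obtain D1 D2 where D: "(f has_derivative D1) (at z)" "\<And>c w. D1 (c *s w) = c * D1 w"
      "(g has_derivative D2) (at z)" "\<And>c w. D2 (c *s w) = c * D2 w"
      using assms z unfolding holo_ball_def by metis
    have "((\<lambda>z. a * f z + b * g z) has_derivative (\<lambda>w. a * D1 w + b * D2 w)) (at z)"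
      by (intro has_derivative_add has_derivative_mult_right D)
    then show ?thesis using D(2,4) by (intro exI[of _ "\<lambda>w. a * D1 w + b * D2 w"]) (simp add: algebra_simps)
  qed
  then show ?thesis by (simp add: holo_ball_def)
qed

lemma holo_ball_peak: "holo_ball (peak \<eta> t)"
proof (rule holo_ballI)
  fix z :: "complex ^ 'a"
  have "((\<lambda>z. of_real t * (cinner z \<eta> - 1)) has_derivative (\<lambda>w. of_real t * (cinner w \<eta> - 0))) (at z)"
    by (intro has_derivative_mult_right has_derivative_diff has_derivative_const
        bounded_linear_imp_has_derivative bounded_linear_cinner)
  from has_derivative_compose[OF this DERIV_exp[unfolded has_field_derivative_def]]
  show "(peak \<eta> t has_derivative (\<lambda>w. peak \<eta> t z * (of_real t * cinner w \<eta>))) (at z)"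
    by (simp add: peak_def[abs_def])
qed (simp add: cinner_simps)

lemma continuous_on_holo_ball: "holo_ball f \<Longrightarrow> continuous_on (ball 0 1) f"
  unfolding holo_ball_def
  by (meson continuous_at_imp_continuous_on has_derivative_continuous)

text \<open>\<open>holo_ball\<close> says nothing about values outside the ball; cutting them off
  yields Borel functions on the whole space.\<close>

definition ball_part :: "(complex ^ 'n \<Rightarrow> complex) \<Rightarrow> complex ^ 'n \<Rightarrow> complex" where
  "ball_part f z = (if z \<in> ball 0 1 then f z else 0)"

lemma measurable_ball_part [measurable]:
  assumes "holo_ball f"
  shows "ball_part f \<in> borel_measurable borel"
  unfolding ball_part_def[abs_def]
  by (intro borel_measurable_continuous_on_if continuous_on_holo_ball assms) auto

lemma polarization:
  "(1/4) * (\<Sum>k\<in>{0..3::nat}. \<i> ^ k * complex_of_real ((cmod (a + \<i> ^ k * b))\<^sup>2)) = a * cnj b"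
proof -
  have "{0..3::nat} = {0,1,2,3}" by auto
  then show ?thesis
    by (simp add: complex_eq_iff cmod_power2 power3_eq_cube) (simp add: power2_eq_square algebra_simps)
qed

text \<open>Common ground of both kinds of spaces: for the Hardy space \<open>\<mu> n\<close> lives
  on spheres of radius increasing to 1, for a Bergman space it is one weighted volume measure for
  all \<open>n\<close>. Besides bounded mass, the argument rests on point evaluations growing at
  most polynomially at the sphere and on rotation invariance of the norms of peaks.\<close>

locale function_space =
  fixes \<mu> :: "nat \<Rightarrow> (complex ^ 'n) measure" and Q :: "(complex ^ 'n \<Rightarrow> complex) \<Rightarrow> ennreal"
    and m0 c0 :: real and q :: nat
  assumes Q_eq: "holo_ball f \<Longrightarrow> Q f = (SUP n. \<integral>\<^sup>+ z. ennreal ((cmod (f z))\<^sup>2) \<partial>\<mu> n)"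
    and incseq_integral: "holo_ball f \<Longrightarrow> incseq (\<lambda>n. \<integral>\<^sup>+ z. ennreal ((cmod (f z))\<^sup>2) \<partial>\<mu> n)"
    and sets_\<mu> [measurable_cong]: "sets (\<mu> n) = sets borel"
    and AE_ball: "AE z in \<mu> n. z \<in> ball 0 1"
    and mass: "emeasure (\<mu> n) UNIV \<le> ennreal m0" "m0 > 0"
    and point_evaluation: "holo_ball f \<Longrightarrow> w \<in> ball 0 1 \<Longrightarrow>
      ennreal ((cmod (f w))\<^sup>2) * ennreal ((1 - norm w) ^ q) \<le> ennreal c0 * Q f" "c0 > 0"
    and Q_peak: "norm \<eta> = 1 \<Longrightarrow> norm \<zeta> = 1 \<Longrightarrow> Q (peak \<eta> t) = Q (peak \<zeta> t)"
begin

abbreviation "F \<equiv> fspace Q"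

lemma F_holo: "f \<in> F \<Longrightarrow> holo_ball f"
  by (simp add: fspace_def)

lemma space_\<mu>: "space (\<mu> n) = UNIV"
  using sets_eq_imp_space_eq[OF sets_\<mu>] by simp

lemma finite_measure_\<mu>: "finite_measure (\<mu> n)"
  using mass(1)[of n] by (intro finite_measureI) (auto simp: space_\<mu> top_unique)

lemma nn_integral_ball_part:
  "(\<integral>\<^sup>+ z. ennreal ((cmod (f z))\<^sup>2) \<partial>\<mu> n) = (\<integral>\<^sup>+ z. ennreal ((cmod (ball_part f z))\<^sup>2) \<partial>\<mu> n)"
  by (rule nn_integral_cong_AE) (use AE_ball in eventually_elim, simp add: ball_part_def)

lemma Q_mono:
  assumes "holo_ball f" "holo_ball g" "\<And>z. z \<in> ball 0 1 \<Longrightarrow> cmod (f z) \<le> cmod (g z)"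
  shows "Q f \<le> Q g"
  unfolding Q_eq[OF assms(1)] Q_eq[OF assms(2)]
proof (intro SUP_mono' nn_integral_mono_AE)
  show "AE z in \<mu> n. ennreal ((cmod (f z))\<^sup>2) \<le> ennreal ((cmod (g z))\<^sup>2)" for n
    using AE_ball by eventually_elim (intro ennreal_leI power_mono assms(3), auto)
qed

lemma Q_le:
  assumes "holo_ball f" "\<And>n. (\<integral>\<^sup>+ z. ennreal ((cmod (f z))\<^sup>2) \<partial>\<mu> n) \<le> K"
  shows "Q f \<le> K"
  unfolding Q_eq[OF assms(1)] by (rule SUP_least) (rule assms(2))

lemma bounded_in_F:
  assumes "holo_ball f" "\<And>z. z \<in> ball 0 1 \<Longrightarrow> cmod (f z) \<le> K"
  shows "Q f \<le> ennreal (K\<^sup>2 * m0)"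
proof (rule Q_le[OF assms(1)])
  fix n
  have "(\<integral>\<^sup>+ z. ennreal ((cmod (f z))\<^sup>2) \<partial>\<mu> n) \<le> (\<integral>\<^sup>+ z. ennreal (K\<^sup>2) \<partial>\<mu> n)"
  proof (rule nn_integral_mono_AE)
    show "AE z in \<mu> n. ennreal ((cmod (f z))\<^sup>2) \<le> ennreal (K\<^sup>2)"
      using AE_ball by eventually_elim (intro ennreal_leI power_mono assms(2), auto)
  qed
  also have "\<dots> = ennreal (K\<^sup>2) * emeasure (\<mu> n) UNIV" by (simp add: space_\<mu>)
  also have "\<dots> \<le> ennreal (K\<^sup>2) * ennreal m0" by (intro mult_left_mono mass) simp
  also have "\<dots> = ennreal (K\<^sup>2 * m0)" using mass(2) by (simp add: ennreal_mult)
  finally show "(\<integral>\<^sup>+ z. ennreal ((cmod (f z))\<^sup>2) \<partial>\<mu> n) \<le> ennreal (K\<^sup>2 * m0)" .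
qed

section \<open>Norm and inner product as limits of integrals\<close>

definition "energy n f = (\<integral> z. (cmod (ball_part f z))\<^sup>2 \<partial>\<mu> n)"

definition "ip n f g = (\<integral> z. ball_part f z * cnj (ball_part g z) \<partial>\<mu> n)"

lemma nn_integral_le_Q:
  "holo_ball f \<Longrightarrow> (\<integral>\<^sup>+ z. ennreal ((cmod (ball_part f z))\<^sup>2) \<partial>\<mu> n) \<le> Q f"
  by (simp only: nn_integral_ball_part[where f = f, symmetric] Q_eq) (rule SUP_upper, simp)

lemma integrable_power2:
  assumes "f \<in> F"
  shows "integrable (\<mu> n) (\<lambda>z. (cmod (ball_part f z))\<^sup>2)"
proof (rule integrableI_bounded)
  have [measurable]: "holo_ball f" using assms by (rule F_holo)
  show "(\<lambda>z. (cmod (ball_part f z))\<^sup>2) \<in> borel_measurable (\<mu> n)" by measurable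
  have "Q f < \<infinity>" using assms by (simp add: fspace_def)
  then show "(\<integral>\<^sup>+ z. ennreal (norm ((cmod (ball_part f z))\<^sup>2)) \<partial>\<mu> n) < \<infinity>"
    using nn_integral_le_Q[of f n] \<open>holo_ball f\<close> by (simp add: order.strict_trans1)
qed

lemma energy_eq:
  assumes "f \<in> F"
  shows "energy n f = enn2real (\<integral>\<^sup>+ z. ennreal ((cmod (f z))\<^sup>2) \<partial>\<mu> n)"
  unfolding nn_integral_ball_part[where f = f] energy_def
  using F_holo[OF assms] by (intro integral_eq_nn_integral) auto

lemma fnorm_power2: "(fnorm Q f)\<^sup>2 = enn2real (Q f)"
  by (simp add: fnorm_def)

lemma energy_tendsto:
  assumes "f \<in> F"
  shows "(\<lambda>n. energy n f) \<longlonglongrightarrow> (fnorm Q f)\<^sup>2"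
proof -
  have "(\<lambda>n. \<integral>\<^sup>+ z. ennreal ((cmod (f z))\<^sup>2) \<partial>\<mu> n) \<longlonglongrightarrow> Q f"
    unfolding Q_eq[OF F_holo[OF assms]]
    by (intro LIMSEQ_SUP incseq_integral F_holo assms)
  moreover have "Q f \<noteq> top" using assms by (auto simp: fspace_def)
  ultimately show ?thesis
    unfolding energy_eq[OF assms] fnorm_power2 by (intro tendsto_enn2real) (simp_all add: less_top)
qed

lemma energy_le:
  assumes "f \<in> F"
  shows "energy n f \<le> (fnorm Q f)\<^sup>2"
  unfolding energy_eq[OF assms] fnorm_power2 Q_eq[OF F_holo[OF assms]]
proof (intro enn2real_mono SUP_upper UNIV_I)
  show "(SUP n. \<integral>\<^sup>+ z. ennreal ((cmod (f z))\<^sup>2) \<partial>\<mu> n) < top"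
    using assms Q_eq[OF F_holo[OF assms]] by (simp add: fspace_def less_top)
qed

lemma F_lincomb:
  assumes "f \<in> F" "g \<in> F"
  shows "(\<lambda>z. a * f z + b * g z) \<in> F"
proof -
  let ?h = "\<lambda>z. a * f z + b * g z"
  have holo: "holo_ball f" "holo_ball g" "holo_ball ?h"
    using assms F_holo holo_ball_lincomb by blast+
  have "Q ?h \<le> ennreal (2 * (cmod a)\<^sup>2) * Q f + ennreal (2 * (cmod b)\<^sup>2) * Q g"
  proof (rule Q_le[OF holo(3)])
    fix n
    have "(\<integral>\<^sup>+ z. ennreal ((cmod (?h z))\<^sup>2) \<partial>\<mu> n) \<le>
      (\<integral>\<^sup>+ z. ennreal (2 * (cmod a)\<^sup>2) * ennreal ((cmod (ball_part f z))\<^sup>2) +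
              ennreal (2 * (cmod b)\<^sup>2) * ennreal ((cmod (ball_part g z))\<^sup>2) \<partial>\<mu> n)"
      unfolding nn_integral_ball_part[where f = ?h]
    proof (rule nn_integral_mono)
      fix z
      have "(cmod (ball_part ?h z))\<^sup>2 \<le> (cmod a * cmod (ball_part f z) + cmod b * cmod (ball_part g z))\<^sup>2"
      proof (rule power_mono)
        have "ball_part ?h z = a * ball_part f z + b * ball_part g z" by (simp add: ball_part_def)
        then show "cmod (ball_part ?h z) \<le> cmod a * cmod (ball_part f z) + cmod b * cmod (ball_part g z)"
          using norm_triangle_ineq[of "a * ball_part f z" "b * ball_part g z"] by (simp add: norm_mult)
      qed simp
      also have "\<dots> \<le> 2 * (cmod a)\<^sup>2 * (cmod (ball_part f z))\<^sup>2 + 2 * (cmod b)\<^sup>2 * (cmod (ball_part g z))\<^sup>2"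
        using sum_squares_bound[of "cmod a * cmod (ball_part f z)" "cmod b * cmod (ball_part g z)"]
        by (simp add: power2_sum power_mult_distrib)
      finally show "ennreal ((cmod (ball_part ?h z))\<^sup>2) \<le> ennreal (2 * (cmod a)\<^sup>2) * ennreal ((cmod (ball_part f z))\<^sup>2) +
              ennreal (2 * (cmod b)\<^sup>2) * ennreal ((cmod (ball_part g z))\<^sup>2)"
        by (simp add: ennreal_mult'[symmetric] ennreal_plus[symmetric] ennreal_leI del: ennreal_plus)
    qed
    also have "\<dots> = ennreal (2 * (cmod a)\<^sup>2) * (\<integral>\<^sup>+ z. ennreal ((cmod (ball_part f z))\<^sup>2) \<partial>\<mu> n) +
              ennreal (2 * (cmod b)\<^sup>2) * (\<integral>\<^sup>+ z. ennreal ((cmod (ball_part g z))\<^sup>2) \<partial>\<mu> n)"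
      using holo by (subst nn_integral_add) (auto simp: nn_integral_cmult)
    also have "\<dots> \<le> ennreal (2 * (cmod a)\<^sup>2) * Q f + ennreal (2 * (cmod b)\<^sup>2) * Q g"
      using holo by (intro add_mono mult_left_mono nn_integral_le_Q) auto
    finally show "(\<integral>\<^sup>+ z. ennreal ((cmod (?h z))\<^sup>2) \<partial>\<mu> n) \<le>
      ennreal (2 * (cmod a)\<^sup>2) * Q f + ennreal (2 * (cmod b)\<^sup>2) * Q g" .
  qed
  also have "\<dots> < \<infinity>"
    using assms by (auto simp: fspace_def ennreal_mult_less_top)
  finally show ?thesis using holo by (simp add: fspace_def)
qed

lemma F_smult: "f \<in> F \<Longrightarrow> (\<lambda>z. a * f z) \<in> F"
  using F_lincomb[of f f a 0] by simp

lemma F_diff: "f \<in> F \<Longrightarrow> g \<in> F \<Longrightarrow> (\<lambda>z. f z - g z) \<in> F"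
  using F_lincomb[of f g 1 "-1"] by simp

text \<open>\<open>finner\<close> is a polarized norm, whose sesquilinearity is not visible. At each
  stage the same polarization is a genuine integral, and the algebraic laws are inherited in the
  limit.\<close>

lemma ip_eq:
  assumes "f \<in> F" "g \<in> F"
  shows "ip n f g = (1/4) * (\<Sum>k\<in>{0..3::nat}. \<i> ^ k * complex_of_real (energy n (\<lambda>z. f z + \<i> ^ k * g z)))"
proof -
  have F: "(\<lambda>z. f z + \<i> ^ k * g z) \<in> F" for k
    using F_lincomb[OF assms, of 1 "\<i> ^ k"] by simp
  have int: "integrable (\<mu> n) (\<lambda>z. \<i> ^ k * complex_of_real ((cmod (ball_part (\<lambda>z. f z + \<i> ^ k * g z) z))\<^sup>2))" for k
    using integrable_power2[OF F] by (intro integrable_mult_right integrable_of_real)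
  have "ball_part (\<lambda>z. f z + \<i> ^ k * g z) z = ball_part f z + \<i> ^ k * ball_part g z" for k z
    by (simp add: ball_part_def)
  then have "ball_part f z * cnj (ball_part g z) =
      (1/4) * (\<Sum>k\<in>{0..3::nat}. \<i> ^ k * complex_of_real ((cmod (ball_part (\<lambda>z. f z + \<i> ^ k * g z) z))\<^sup>2))" for z
    by (simp only: polarization)
  then have "ip n f g = (\<integral> z. (1/4) * (\<Sum>k\<in>{0..3::nat}. \<i> ^ k * complex_of_real ((cmod (ball_part (\<lambda>z. f z + \<i> ^ k * g z) z))\<^sup>2)) \<partial>\<mu> n)"
    by (simp only: ip_def)
  also have "\<dots> = (1/4) * (\<Sum>k\<in>{0..3::nat}. (\<integral> z. \<i> ^ k * complex_of_real ((cmod (ball_part (\<lambda>z. f z + \<i> ^ k * g z) z))\<^sup>2) \<partial>\<mu> n))"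
    by (simp only: integral_mult_right_zero Bochner_Integration.integral_sum[OF int])
  also have "\<dots> = (1/4) * (\<Sum>k\<in>{0..3::nat}. \<i> ^ k * complex_of_real (energy n (\<lambda>z. f z + \<i> ^ k * g z)))"
    by (simp only: integral_mult_right_zero integral_complex_of_real energy_def)
  finally show ?thesis .
qed

lemma ip_tendsto:
  assumes "f \<in> F" "g \<in> F"
  shows "(\<lambda>n. ip n f g) \<longlonglongrightarrow> finner Q f g"
proof -
  have F: "(\<lambda>z. f z + \<i> ^ k * g z) \<in> F" for k
    using F_lincomb[OF assms, of 1 "\<i> ^ k"] by simp
  show ?thesis
    unfolding ip_eq[OF assms] finner_def
    by (intro tendsto_mult tendsto_const tendsto_sum tendsto_of_real energy_tendsto F)
qed

lemma integrable_ip: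
  assumes "f \<in> F" "g \<in> F"
  shows "integrable (\<mu> n) (\<lambda>z. ball_part f z * cnj (ball_part g z))"
proof (rule Bochner_Integration.integrable_bound)
  show "integrable (\<mu> n) (\<lambda>z. (cmod (ball_part f z))\<^sup>2 + (cmod (ball_part g z))\<^sup>2)"
    by (intro Bochner_Integration.integrable_add integrable_power2 assms)
  have [measurable]: "holo_ball f" "holo_ball g" using assms F_holo by blast+
  have [measurable]: "cnj \<in> borel_measurable borel"
    by (intro borel_measurable_continuous_onI continuous_intros)
  show "(\<lambda>z. ball_part f z * cnj (ball_part g z)) \<in> borel_measurable (\<mu> n)" by measurable
  have "cmod (ball_part f z * cnj (ball_part g z)) \<le> norm ((cmod (ball_part f z))\<^sup>2 + (cmod (ball_part g z))\<^sup>2)" for z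
  proof -
    have "0 \<le> cmod (ball_part f z) * cmod (ball_part g z)" by simp
    then have "cmod (ball_part f z) * cmod (ball_part g z) \<le> (cmod (ball_part f z))\<^sup>2 + (cmod (ball_part g z))\<^sup>2"
      using sum_squares_bound[of "cmod (ball_part f z)" "cmod (ball_part g z)"] by linarith
    then show ?thesis by (simp add: norm_mult)
  qed
  then show "AE z in \<mu> n. cmod (ball_part f z * cnj (ball_part g z)) \<le> norm ((cmod (ball_part f z))\<^sup>2 + (cmod (ball_part g z))\<^sup>2)"
    by simp
qed

lemma finner_add_left:
  assumes "f \<in> F" "g \<in> F" "h \<in> F"
  shows "finner Q (\<lambda>z. a * f z + b * g z) h = a * finner Q f h + b * finner Q g h"
proof -
  have "ip n (\<lambda>z. a * f z + b * g z) h = a * ip n f h + b * ip n g h" for n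
  proof -
    have "ball_part (\<lambda>z. a * f z + b * g z) z * cnj (ball_part h z) =
      a * (ball_part f z * cnj (ball_part h z)) + b * (ball_part g z * cnj (ball_part h z))" for z
      by (simp add: ball_part_def algebra_simps)
    then show ?thesis unfolding ip_def
      by (simp add: Bochner_Integration.integral_add integrable_mult_right integrable_ip assms)
  qed
  then have "(\<lambda>n. ip n (\<lambda>z. a * f z + b * g z) h) \<longlonglongrightarrow> a * finner Q f h + b * finner Q g h"
    using ip_tendsto assms by (simp only:) (intro tendsto_intros ip_tendsto assms)
  then show ?thesis
    using ip_tendsto[OF F_lincomb[OF assms(1,2), of a b] assms(3)] LIMSEQ_unique by blast
qed

lemma finner_smult_left: "f \<in> F \<Longrightarrow> h \<in> F \<Longrightarrow> finner Q (\<lambda>z. a * f z) h = a * finner Q f h"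
  using finner_add_left[of f f h a 0] by simp

lemma finner_diff_left:
  "f \<in> F \<Longrightarrow> g \<in> F \<Longrightarrow> h \<in> F \<Longrightarrow> finner Q (\<lambda>z. f z - g z) h = finner Q f h - finner Q g h"
  using finner_add_left[of f g h 1 "-1"] by simp

lemma finner_commute:
  assumes "f \<in> F" "g \<in> F"
  shows "finner Q g f = cnj (finner Q f g)"
proof -
  have "ip n g f = cnj (ip n f g)" for n
    using Bochner_Integration.integral_cnj[of "\<mu> n" "\<lambda>z. ball_part f z * cnj (ball_part g z)"]
    by (simp add: ip_def mult.commute)
  then have "(\<lambda>n. ip n g f) \<longlonglongrightarrow> cnj (finner Q f g)"
    by (simp only:) (intro tendsto_cnj ip_tendsto assms)
  then show ?thesis
    using ip_tendsto[OF assms(2,1)] LIMSEQ_unique by blast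
qed

lemma finner_smult_right:
  assumes "f \<in> F" "h \<in> F"
  shows "finner Q f (\<lambda>z. a * h z) = cnj a * finner Q f h"
  unfolding finner_commute[OF F_smult[OF assms(2)] assms(1)] finner_smult_left[OF assms(2,1)]
    finner_commute[OF assms(1,2)] by simp

lemma finner_self:
  assumes "f \<in> F"
  shows "finner Q f f = of_real ((fnorm Q f)\<^sup>2)"
proof -
  have "ip n f f = of_real (energy n f)" for n
    unfolding ip_def energy_def integral_complex_of_real[symmetric] by (simp only: complex_norm_square)
  then have "(\<lambda>n. ip n f f) \<longlonglongrightarrow> of_real ((fnorm Q f)\<^sup>2)"
    by (simp only:) (intro tendsto_of_real energy_tendsto assms)
  then show ?thesis using ip_tendsto[OF assms assms] LIMSEQ_unique by blast
qed

lemma fnorm_nonneg: "0 \<le> fnorm Q f"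
  by (simp add: fnorm_def)

lemma fnorm_diff_smult_power2:
  assumes "f \<in> F" "g \<in> F"
  shows "(fnorm Q (\<lambda>z. f z - a * g z))\<^sup>2 =
    (fnorm Q f)\<^sup>2 - 2 * Re (cnj a * finner Q f g) + (cmod a)\<^sup>2 * (fnorm Q g)\<^sup>2"
proof -
  let ?h = "\<lambda>z. f z - a * g z"
  have h: "?h \<in> F" by (intro F_diff F_smult assms)
  have "finner Q ?h ?h = finner Q f ?h - a * finner Q g ?h"
    by (simp add: finner_diff_left finner_smult_left assms h F_smult)
  also have "finner Q f ?h = cnj (finner Q f f - a * finner Q g f)"
    by (subst finner_commute[OF h assms(1)]) (simp add: finner_diff_left finner_smult_left assms F_smult)
  also have "finner Q g ?h = cnj (finner Q f g - a * finner Q g g)"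
    by (subst finner_commute[OF h assms(2)]) (simp add: finner_diff_left finner_smult_left assms F_smult)
  finally have "finner Q ?h ?h = finner Q f f - cnj a * finner Q f g - cnj (cnj a * finner Q f g) + a * cnj a * finner Q g g"
    by (simp add: finner_self assms finner_commute[OF assms] algebra_simps)
  then have "Re (finner Q ?h ?h) = Re (finner Q f f) - 2 * Re (cnj a * finner Q f g) + (cmod a)\<^sup>2 * Re (finner Q g g)"
    by (simp only: complex_norm_square[symmetric] minus_complex.sel plus_complex.sel cnj.sel)
      (simp add: finner_self assms)
  then show ?thesis by (simp add: finner_self assms h)
qed

lemma finner_Cauchy_Schwarz:
  assumes "f \<in> F" "g \<in> F"
  shows "cmod (finner Q f g) \<le> fnorm Q f * fnorm Q g"
proof -
  have key: "0 \<le> (fnorm Q f)\<^sup>2 - 2 * s * (cmod (finner Q f g))\<^sup>2 + s\<^sup>2 * (cmod (finner Q f g))\<^sup>2 * (fnorm Q g)\<^sup>2" for s :: real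
  proof -
    have "cnj (of_real s * finner Q f g) * finner Q f g = of_real (s * (cmod (finner Q f g))\<^sup>2)"
      using complex_norm_square[of "finner Q f g"] by (simp add: mult.commute)
    then have "Re (cnj (of_real s * finner Q f g) * finner Q f g) = s * (cmod (finner Q f g))\<^sup>2"
      by (simp only: Re_complex_of_real)
    moreover have "(cmod (of_real s * finner Q f g))\<^sup>2 = s\<^sup>2 * (cmod (finner Q f g))\<^sup>2"
      by (simp add: norm_mult power_mult_distrib)
    ultimately show ?thesis
      using fnorm_diff_smult_power2[OF assms, of "of_real s * finner Q f g"]
        zero_le_power2[of "fnorm Q (\<lambda>z. f z - of_real s * finner Q f g * g z)"]
      by (simp only: mult.assoc)
  qed
  show ?thesis
  proof (cases "fnorm Q g = 0")
    case True
    have "cmod (finner Q f g) = 0"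
    proof (rule ccontr)
      assume n: "cmod (finner Q f g) \<noteq> 0"
      \<comment> \<open>For \<open>fnorm Q g = 0\<close> the expression in \<open>key\<close> is
        affine in \<open>s\<close> with negative slope, and this \<open>s\<close> makes it
        negative.\<close>
      define s where "s = ((fnorm Q f)\<^sup>2 + 1) / (cmod (finner Q f g))\<^sup>2"
      have "s * (cmod (finner Q f g))\<^sup>2 = (fnorm Q f)\<^sup>2 + 1" using n by (simp add: s_def)
      then show False using key[of s] True zero_le_power2[of "fnorm Q f"] by simp
    qed
    then show ?thesis by (simp add: fnorm_nonneg)
  next
    case False
    \<comment> \<open>This is the minimizer of the quadratic in \<open>key\<close>.\<close>
    define s where "s = 1 / (fnorm Q g)\<^sup>2"
    have "s * (fnorm Q g)\<^sup>2 = 1" using False by (simp add: s_def)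
    moreover have "s\<^sup>2 * (cmod (finner Q f g))\<^sup>2 * (fnorm Q g)\<^sup>2 = s * (cmod (finner Q f g))\<^sup>2 * (s * (fnorm Q g)\<^sup>2)"
      by (simp add: power2_eq_square[of s] mult_ac)
    ultimately have "s\<^sup>2 * (cmod (finner Q f g))\<^sup>2 * (fnorm Q g)\<^sup>2 = s * (cmod (finner Q f g))\<^sup>2"
      by (simp only: mult_1_right)
    then have "0 \<le> (fnorm Q f)\<^sup>2 - s * (cmod (finner Q f g))\<^sup>2"
      using key[of s] by linarith
    then have "(cmod (finner Q f g))\<^sup>2 \<le> (fnorm Q f)\<^sup>2 * (fnorm Q g)\<^sup>2"
      using False by (simp add: s_def field_simps)
    then have "(cmod (finner Q f g))\<^sup>2 \<le> (fnorm Q f * fnorm Q g)\<^sup>2" by (simp add: power_mult_distrib)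
    then show ?thesis by (rule power2_le_imp_le) (simp add: fnorm_nonneg)
  qed
qed

lemma fnorm_power2_diff_le:
  assumes "f \<in> F" "g \<in> F"
  shows "(fnorm Q (\<lambda>z. f z - g z))\<^sup>2 \<le> 2 * (fnorm Q f)\<^sup>2 + 2 * (fnorm Q g)\<^sup>2"
proof -
  have "\<bar>Re (finner Q f g)\<bar> \<le> fnorm Q f * fnorm Q g"
    using finner_Cauchy_Schwarz[OF assms] abs_Re_le_cmod[of "finner Q f g"] by linarith
  then show ?thesis
    using fnorm_diff_smult_power2[OF assms, of 1] sum_squares_bound[of "fnorm Q f" "fnorm Q g"]
    by simp
qed

lemma fnorm_smult:
  assumes "f \<in> F"
  shows "fnorm Q (\<lambda>z. a * f z) = cmod a * fnorm Q f"
proof -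
  have "of_real ((fnorm Q (\<lambda>z. a * f z))\<^sup>2) = finner Q (\<lambda>z. a * f z) (\<lambda>z. a * f z)"
    using finner_self[OF F_smult[OF assms]] by simp
  also have "\<dots> = a * cnj a * finner Q f f"
    by (simp add: finner_smult_left finner_smult_right F_smult assms)
  also have "\<dots> = of_real ((cmod a)\<^sup>2 * (fnorm Q f)\<^sup>2)"
    unfolding complex_norm_square[symmetric] finner_self[OF assms] by simp
  finally have "(fnorm Q (\<lambda>z. a * f z))\<^sup>2 = (cmod a * fnorm Q f)\<^sup>2"
    by (simp only: of_real_eq_iff power_mult_distrib)
  then show ?thesis by (simp add: power2_eq_iff_nonneg fnorm_nonneg)
qed

section \<open>Norms of the peak functions\<close>

lemma peak_in_F:
  assumes "norm \<eta> = 1" "t \<ge> 0"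
  shows "peak \<eta> t \<in> F" "(fnorm Q (peak \<eta> t))\<^sup>2 \<le> m0"
proof -
  have "Q (peak \<eta> t) \<le> ennreal (1\<^sup>2 * m0)"
    by (rule bounded_in_F[OF holo_ball_peak]) (use assms in \<open>simp add: cmod_peak_le_1\<close>)
  then have *: "Q (peak \<eta> t) \<le> ennreal m0" by simp
  then show "peak \<eta> t \<in> F" by (auto simp: fspace_def holo_ball_peak less_top[symmetric] top_unique)
  show "(fnorm Q (peak \<eta> t))\<^sup>2 \<le> m0"
    using enn2real_mono[OF *] mass(2) by (simp add: fnorm_power2)
qed

definition "pe = (SOME \<eta> :: complex ^ 'n. norm \<eta> = 1)"

lemma norm_pe: "norm pe = 1"
  unfolding pe_def by (rule someI_ex) (rule exI[of _ "axis undefined 1"], simp)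

text \<open>The reference point \<open>pe\<close> is immaterial by rotation invariance
  (\<open>a_eq\<close>), so this one function of \<open>t\<close> measures all peaks.\<close>

definition "a t = (fnorm Q (peak pe t))\<^sup>2"

lemma a_eq: "norm \<eta> = 1 \<Longrightarrow> (fnorm Q (peak \<eta> t))\<^sup>2 = a t"
  unfolding a_def fnorm_power2 using Q_peak[OF _ norm_pe] by simp

lemma a_nonneg: "0 \<le> a t"
  by (simp add: a_def)

lemma fnorm_power2_mono:
  assumes "holo_ball f" "g \<in> F" "\<And>z. z \<in> ball 0 1 \<Longrightarrow> cmod (f z) \<le> cmod (g z)"
  shows "(fnorm Q f)\<^sup>2 \<le> (fnorm Q g)\<^sup>2"
  unfolding fnorm_power2
  by (intro enn2real_mono Q_mono assms F_holo) (use assms(2) in \<open>auto simp: fspace_def\<close>)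

lemma a_antimono:
  assumes "0 \<le> s" "s \<le> t"
  shows "a t \<le> a s"
  unfolding a_def
proof (rule fnorm_power2_mono[OF holo_ball_peak peak_in_F(1)[OF norm_pe assms(1)]])
  fix z :: "complex ^ 'n" assume "z \<in> ball 0 1"
  then have "0 \<le> 1 - inner z pe" by (intro one_minus_inner_nonneg norm_pe) simp
  then show "cmod (peak pe t z) \<le> cmod (peak pe s z)"
    using assms by (simp add: cmod_peak mult_right_mono)
qed

lemma point_evaluation_F:
  assumes "f \<in> F" "norm w \<le> r" "r < 1"
  shows "(cmod (f w))\<^sup>2 \<le> c0 / (1 - r) ^ q * (fnorm Q f)\<^sup>2"
proof -
  have w: "w \<in> ball 0 1" using assms by simp
  have "ennreal ((cmod (f w))\<^sup>2 * (1 - norm w) ^ q) = ennreal ((cmod (f w))\<^sup>2) * ennreal ((1 - norm w) ^ q)"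
    by (rule ennreal_mult') simp
  also have "\<dots> \<le> ennreal c0 * Q f" by (rule point_evaluation(1)[OF F_holo[OF assms(1)] w])
  also have "Q f = ennreal ((fnorm Q f)\<^sup>2)"
    using assms(1) by (simp add: fnorm_power2 fspace_def less_top)
  also have "ennreal c0 * ennreal ((fnorm Q f)\<^sup>2) = ennreal (c0 * (fnorm Q f)\<^sup>2)"
    using point_evaluation(2) by (simp add: ennreal_mult)
  finally have "(cmod (f w))\<^sup>2 * (1 - norm w) ^ q \<le> c0 * (fnorm Q f)\<^sup>2"
    using point_evaluation(2) by (simp add: ennreal_le_iff)
  moreover have "(cmod (f w))\<^sup>2 * (1 - r) ^ q \<le> (cmod (f w))\<^sup>2 * (1 - norm w) ^ q"
    using assms by (intro mult_left_mono power_mono) auto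
  ultimately have "(cmod (f w))\<^sup>2 * (1 - r) ^ q \<le> c0 * (fnorm Q f)\<^sup>2" by linarith
  moreover have "0 < (1 - r) ^ q" using assms by simp
  ultimately show ?thesis by (simp add: field_simps)
qed

text \<open>At distance \<open>1 / t\<close> from the sphere on the ray through \<open>pe\<close>
  the squared modulus of the peak is still \<open>exp (- 2)\<close>, while point evaluation there
  costs a factor \<open>t ^ q\<close>.\<close>

lemma a_lower:
  assumes t: "t \<ge> 1"
  shows "exp (- 2) / c0 \<le> a t * t ^ q"
proof -
  define r where "r = 1 - 1 / t"
  have r: "0 \<le> r" "r < 1" "1 - r = 1 / t" using t by (simp_all add: r_def)
  have "inner (r *\<^sub>R pe) pe = r" using norm_pe by (simp add: dot_square_norm)
  then have "(cmod (peak pe t (r *\<^sub>R pe)))\<^sup>2 = exp (- (2 * t) * (1 / t))"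
    by (simp only: cmod_peak_power2 r(3))
  then have "(cmod (peak pe t (r *\<^sub>R pe)))\<^sup>2 = exp (- 2)" using t by simp
  moreover have "(cmod (peak pe t (r *\<^sub>R pe)))\<^sup>2 \<le> c0 / (1 - r) ^ q * (fnorm Q (peak pe t))\<^sup>2"
    using r norm_pe t by (intro point_evaluation_F peak_in_F) auto
  ultimately have "exp (- 2) \<le> c0 / (1 / t) ^ q * a t" by (simp add: r(3) a_def)
  then show ?thesis using point_evaluation(2) t by (simp add: field_simps power_divide)
qed

lemma a_pos: "t \<ge> 1 \<Longrightarrow> 0 < a t"
proof (rule ccontr)
  assume t: "t \<ge> 1" and "\<not> 0 < a t"
  then have "a t = 0" using a_nonneg[of t] by simp
  then show False using a_lower[OF t] point_evaluation(2) by (simp add: divide_le_0_iff)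
qed

text \<open>At most one of \<open>k\<close> peaks at distinct points of the sphere is not small at a given \<open>z\<close>; by
  rotation invariance they all have the same norm.\<close>
lemma a_tendsto_0: "(a \<longlongrightarrow> 0) at_top"
proof (rule order_tendstoI)
  fix e :: real assume "e < 0"
  then show "eventually (\<lambda>t. e < a t) at_top" using a_nonneg by (simp add: less_le_trans)
next
  fix e :: real assume e: "0 < e"
  obtain k :: nat where k: "real k > 2 * m0 / e" using reals_Archimedean2 by blast
  have k0: "k > 0" using k e mass(2) by (cases k) (auto simp: divide_less_0_iff)
  \<comment> \<open>Multiplying \<open>pe\<close> by the roots of unity of order \<open>k\<close>
    gives \<open>k\<close> distinct points of the sphere in every dimension.\<close>
  define \<eta> where "\<eta> j = cis (2 * pi * real j / real k) *s (pe :: complex ^ 'n)" for j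
  have \<eta>1: "norm (\<eta> j) = 1" for j using norm_pe by (simp add: \<eta>_def norm_smult)
  have inj: "inj_on \<eta> {..<k}"
  proof (rule inj_onI)
    fix i j assume ij: "i \<in> {..<k}" "j \<in> {..<k}" "\<eta> i = \<eta> j"
    have "pe \<noteq> (0 :: complex ^ 'n)" using norm_pe by auto
    then have "cis (2 * pi * real i / real k) = cis (2 * pi * real j / real k)"
      using ij(3) by (simp add: \<eta>_def)
    then show "i = j"
      using ij(1,2) inj_onD[OF bij_betw_imp_inj_on[OF Complex.bij_betw_roots_unity[OF k0]], of i j] by simp
  qed
  have fin: "finite (\<eta> ` {..<k})" by simp
  obtain \<delta> where \<delta>: "\<delta> > 0" "\<And>i j. i < k \<Longrightarrow> j < k \<Longrightarrow> i \<noteq> j \<Longrightarrow> \<delta> \<le> dist (\<eta> i) (\<eta> j)"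
  proof -
    \<comment> \<open>The extra element 1 keeps the set nonempty when \<open>k = 1\<close>.\<close>
    define S where "S = insert 1 ((\<lambda>(i, j). dist (\<eta> i) (\<eta> j)) ` {(i, j). i < k \<and> j < k \<and> i \<noteq> j})"
    have sub: "{(i, j). i < k \<and> j < k \<and> i \<noteq> j} \<subseteq> {..<k} \<times> {..<k}" by auto
    have S: "finite S" "S \<noteq> {}"
      unfolding S_def using finite_subset[OF sub] by auto
    have pos: "\<forall>s\<in>S. s > 0"
      using inj by (auto simp: S_def inj_on_def)
    show ?thesis
    proof (rule that[of "Min S"])
      show "Min S > 0" using S pos by simp
      show "Min S \<le> dist (\<eta> i) (\<eta> j)" if "i < k" "j < k" "i \<noteq> j" for i j
        using that S by (intro Min_le) (auto simp: S_def)
    qed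
  qed
  \<comment> \<open>As \<open>(dist z (\<eta> l))\<^sup>2 \<le> 2 * (1 - inner z (\<eta>
    l))\<close>, a cap of height \<open>\<delta>\<^sup>2 / 8\<close> lies within
    \<open>\<delta> / 2\<close> of its centre, so no \<open>z\<close> belongs to two caps.\<close>
  define \<epsilon> where "\<epsilon> = \<delta>\<^sup>2 / 8"
  have \<epsilon>: "\<epsilon> > 0" using \<delta>(1) by (simp add: \<epsilon>_def)
  have far: "inner z (\<eta> j) \<le> 1 - \<epsilon>" if z: "norm z \<le> 1" "i < k" "j < k" "i \<noteq> j" "inner z (\<eta> i) > 1 - \<epsilon>" for z i j
  proof (rule ccontr)
    assume "\<not> inner z (\<eta> j) \<le> 1 - \<epsilon>"
    then have j: "inner z (\<eta> j) > 1 - \<epsilon>" by simp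
    have near: "dist z (\<eta> l) < \<delta> / 2" if "inner z (\<eta> l) > 1 - \<epsilon>" for l
    proof -
      have "(dist z (\<eta> l))\<^sup>2 = (norm z)\<^sup>2 + (norm (\<eta> l))\<^sup>2 - 2 * inner z (\<eta> l)"
        unfolding dist_norm power2_norm_eq_inner
        by (simp add: inner_diff_left inner_diff_right inner_commute[of "\<eta> l" z])
      also have "\<dots> \<le> 1 + 1 - 2 * inner z (\<eta> l)"
        using z(1) \<eta>1 by (intro diff_right_mono add_mono) (simp_all add: power_le_one)
      also have "\<dots> < (\<delta> / 2)\<^sup>2" using that by (simp add: \<epsilon>_def power_divide)
      finally show ?thesis using \<delta>(1) by (intro power2_less_imp_less[of "dist z (\<eta> l)" "\<delta> / 2"]) auto
    qed
    have "dist (\<eta> i) (\<eta> j) < \<delta>"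
      using dist_triangle_half_r[OF near[OF z(5)] near[OF j]] .
    then show False using \<delta>(2)[OF z(2-4)] by simp
  qed
  have sum_le: "(\<Sum>j<k. (cmod (peak (\<eta> j) t z))\<^sup>2) \<le> 1 + real k * exp (- (2 * t) * \<epsilon>)"
    if t: "t \<ge> 0" and z: "norm z \<le> 1" for t z
  proof -
    have small: "(cmod (peak (\<eta> j) t z))\<^sup>2 \<le> exp (- (2 * t) * \<epsilon>)" if "inner z (\<eta> j) \<le> 1 - \<epsilon>" for j
      using that t by (simp add: cmod_peak_power2 mult_left_mono)
    have le1: "(cmod (peak (\<eta> j) t z))\<^sup>2 \<le> 1" for j
      using cmod_peak_le_1[OF z \<eta>1 t] by (simp add: power_le_one)
    show ?thesis
    proof (cases "\<exists>i<k. inner z (\<eta> i) > 1 - \<epsilon>")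
      case True
      then obtain i where i: "i < k" "inner z (\<eta> i) > 1 - \<epsilon>" by blast
      have "(\<Sum>j<k. (cmod (peak (\<eta> j) t z))\<^sup>2) =
         (cmod (peak (\<eta> i) t z))\<^sup>2 + (\<Sum>j\<in>{..<k} - {i}. (cmod (peak (\<eta> j) t z))\<^sup>2)"
        by (rule sum.remove) (use i in auto)
      also have "\<dots> \<le> 1 + (\<Sum>j\<in>{..<k} - {i}. exp (- (2 * t) * \<epsilon>))"
        by (intro add_mono le1 sum_mono small far[OF z i(1) _ _ i(2)]) auto
      also have "\<dots> \<le> 1 + (\<Sum>j\<in>{..<k}. exp (- (2 * t) * \<epsilon>))"
        by (intro add_left_mono sum_mono2) auto
      finally show ?thesis by simp
    next
      case False
      have "(\<Sum>j<k. (cmod (peak (\<eta> j) t z))\<^sup>2) \<le> (\<Sum>j<k. exp (- (2 * t) * \<epsilon>))"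
        by (intro sum_mono small) (meson False lessThan_iff not_le)
      then show ?thesis by simp
    qed
  qed
  have bound: "real k * a t \<le> m0 * (1 + real k * exp (- (2 * t) * \<epsilon>))" if t: "t \<ge> 0" for t
  proof -
    have en: "(\<Sum>j<k. energy n (peak (\<eta> j) t)) \<le> m0 * (1 + real k * exp (- (2 * t) * \<epsilon>))" for n
    proof -
      interpret finite_measure "\<mu> n" by (rule finite_measure_\<mu>)
      have "(\<Sum>j<k. energy n (peak (\<eta> j) t)) = (\<integral> z. (\<Sum>j<k. (cmod (ball_part (peak (\<eta> j) t) z))\<^sup>2) \<partial>\<mu> n)"
        unfolding energy_def
        by (rule Bochner_Integration.integral_sum[symmetric]) (intro integrable_power2 peak_in_F \<eta>1 t)
      also have "\<dots> \<le> (\<integral> z. 1 + real k * exp (- (2 * t) * \<epsilon>) \<partial>\<mu> n)"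
      proof (rule integral_mono)
        show "integrable (\<mu> n) (\<lambda>z. \<Sum>j<k. (cmod (ball_part (peak (\<eta> j) t) z))\<^sup>2)"
          by (intro Bochner_Integration.integrable_sum integrable_power2 peak_in_F \<eta>1 t)
        show "(\<Sum>j<k. (cmod (ball_part (peak (\<eta> j) t) z))\<^sup>2) \<le> 1 + real k * exp (- (2 * t) * \<epsilon>)" for z
          using sum_le[OF t, of z] by (cases "z \<in> ball 0 1") (simp_all add: ball_part_def add_nonneg_nonneg)
      qed simp
      also have "\<dots> = measure (\<mu> n) UNIV * (1 + real k * exp (- (2 * t) * \<epsilon>))"
        by (simp add: space_\<mu>)
      also have "\<dots> \<le> m0 * (1 + real k * exp (- (2 * t) * \<epsilon>))"
        using enn2real_mono[OF mass(1)[of n]] mass(2)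
        by (intro mult_right_mono) (auto simp: measure_def add_nonneg_nonneg)
      finally show ?thesis .
    qed
    have "(\<lambda>n. \<Sum>j<k. energy n (peak (\<eta> j) t)) \<longlonglongrightarrow> (\<Sum>j<k. (fnorm Q (peak (\<eta> j) t))\<^sup>2)"
      by (intro tendsto_sum energy_tendsto peak_in_F \<eta>1 t)
    then have "(\<Sum>j<k. (fnorm Q (peak (\<eta> j) t))\<^sup>2) \<le> m0 * (1 + real k * exp (- (2 * t) * \<epsilon>))"
      by (rule LIMSEQ_le_const2) (use en in blast)
    then show ?thesis by (simp add: a_eq[OF \<eta>1])
  qed
  have "((\<lambda>t. m0 * (1 / real k + exp (- (2 * t) * \<epsilon>))) \<longlongrightarrow> m0 * (1 / real k + 0)) at_top"
    using \<epsilon> by real_asymp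
  moreover have "m0 * (1 / real k + 0) < e"
    using k k0 e mass(2) by (simp add: field_simps)
  ultimately have "eventually (\<lambda>t. m0 * (1 / real k + exp (- (2 * t) * \<epsilon>)) < e) at_top"
    by (rule order_tendstoD(2))
  then show "eventually (\<lambda>t. a t < e) at_top"
    using eventually_ge_at_top[of 0]
  proof eventually_elim
    case (elim t)
    have "a t \<le> m0 * (1 / real k + exp (- (2 * t) * \<epsilon>))"
      using bound[OF elim(2)] k0 by (simp add: field_simps)
    then show ?case using elim(1) by simp
  qed
qed

text \<open>If \<open>a\<close> lost the factor \<open>c\<close> on every passage from
  \<open>t / M\<close> to \<open>M * t\<close>, iteration along the powers of
  \<open>M\<^sup>2\<close> would make it decay like the power \<open>q + 1\<close> of
  \<open>1 / t\<close>, against \<open>a_lower\<close>. The window reaches to both sides of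
  \<open>t\<close> because below \<open>t\<close> it controls inner products of peaks, and above
  \<open>t\<close> the loss in the contact inequality.\<close>

lemma a_doubling:
  assumes M: "M \<ge> 2"
  obtains c where "c > 0" "\<And>T. \<exists>t\<ge>T. c * a (t / M) \<le> a (M * t)"
proof -
  define c where "c = 1 / M ^ (2 * (q + 1))"
  have c: "c > 0" using M by (simp add: c_def)
  have "\<exists>t\<ge>T. c * a (t / M) \<le> a (M * t)" for T
  proof (rule ccontr)
    assume "\<not> ?thesis"
    then have less: "a (M * t) < c * a (t / M)" if "t \<ge> T" for t using that by force
    define s where "s = max 1 T"
    have s: "s \<ge> 1" "s \<ge> T" by (simp_all add: s_def)
    have pow: "M ^ j \<ge> 1" for j using M by (simp add: one_le_power)
    have it: "a (M ^ (2 * k) * s) \<le> c ^ k * a s" for k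
    proof (induction k)
      case (Suc k)
      have "T \<le> M ^ (2 * k + 1) * s"
        using mult_mono[OF pow[of "2 * k + 1"] s(2)] s M by (smt (verit) mult_le_cancel_right1 pow)
      then have "a (M * (M ^ (2 * k + 1) * s)) \<le> c * a (M ^ (2 * k + 1) * s / M)"
        by (rule less_imp_le[OF less])
      also have "M ^ (2 * k + 1) * s / M = M ^ (2 * k) * s" using M by simp
      also have "c * a (M ^ (2 * k) * s) \<le> c * (c ^ k * a s)"
        using c Suc by (intro mult_left_mono) auto
      finally show ?case by (simp add: mult_ac)
    qed simp
    have "exp (- 2) / c0 \<le> a s * s ^ q * (1 / M\<^sup>2) ^ k" for k
    proof -
      have "M ^ (2 * k) * s \<ge> 1" using mult_mono[OF pow[of "2 * k"] s(1)] pow[of "2 * k"] by simp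
      then have "exp (- 2) / c0 \<le> a (M ^ (2 * k) * s) * (M ^ (2 * k) * s) ^ q" by (rule a_lower)
      also have "\<dots> \<le> c ^ k * a s * (M ^ (2 * k) * s) ^ q"
        using it[of k] M s by (intro mult_right_mono) auto
      also have "\<dots> = a s * s ^ q * ((c * (M\<^sup>2) ^ q) ^ k)"
        by (simp add: power_mult_distrib power_mult[symmetric] mult_ac)
      also have "c * (M\<^sup>2) ^ q = 1 / M\<^sup>2"
      proof -
        have "M ^ (2 * (q + 1)) = (M\<^sup>2) ^ q * M\<^sup>2" by (simp only: power_mult power_add power_one_right)
        then show ?thesis using M by (simp add: c_def)
      qed
      finally show ?thesis .
    qed
    moreover have "(\<lambda>k. a s * s ^ q * (1 / M\<^sup>2) ^ k) \<longlonglongrightarrow> a s * s ^ q * 0"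
    proof (intro tendsto_intros LIMSEQ_power_zero)
      have "1 < M\<^sup>2" using M by (simp add: one_less_power)
      then show "norm (1 / M\<^sup>2) < 1" by (simp add: divide_less_eq_1)
    qed
    ultimately have "exp (- 2) / c0 \<le> a s * s ^ q * 0"
      by (intro LIMSEQ_le_const[where X = "\<lambda>k. a s * s ^ q * (1 / M\<^sup>2) ^ k"]) auto
    then show False using point_evaluation(2) by (simp add: divide_le_0_iff)
  qed
  then show ?thesis using that c by blast
qed

text \<open>If all late \<open>g j\<close> had inner product at least \<epsilon> in modulus with
  \<open>f\<close>, components along suitable late \<open>g j\<close> could be subtracted one after
  another. Each subtraction lowers the squared norm by at least
  \<open>\<epsilon>\<^sup>2 / 4\<close>, yet changes inner products with still later members by a
  null sequence only, so the procedure never stops, which is impossible.\<close>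

lemma weakly_null:
  assumes g: "\<And>j. g j \<in> F" "\<And>j. fnorm Q (g j) \<le> 1"
    and orth: "\<And>i. (\<lambda>j. finner Q (g i) (g j)) \<longlonglongrightarrow> 0"
    and f: "f \<in> F" and \<epsilon>: "\<epsilon> > 0"
  shows "\<exists>j\<ge>J. cmod (finner Q f (g j)) < \<epsilon>"
proof (rule ccontr)
  assume "\<not> ?thesis"
  then have large: "\<epsilon> \<le> cmod (finner Q f (g j))" if "j \<ge> J" for j using that by force
  have "\<exists>h\<in>F. (\<lambda>j. finner Q h (g j) - finner Q f (g j)) \<longlonglongrightarrow> 0 \<and>
      (fnorm Q h)\<^sup>2 \<le> (fnorm Q f)\<^sup>2 - real k * (\<epsilon>\<^sup>2 / 4)" for k
  proof (induction k)
    case 0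
    show ?case by (rule bexI[OF _ f]) simp
  next
    case (Suc k)
    then obtain h where h: "h \<in> F" "(\<lambda>j. finner Q h (g j) - finner Q f (g j)) \<longlonglongrightarrow> 0"
      "(fnorm Q h)\<^sup>2 \<le> (fnorm Q f)\<^sup>2 - real k * (\<epsilon>\<^sup>2 / 4)" by blast
    obtain J' where J': "\<And>j. j \<ge> J' \<Longrightarrow> cmod (finner Q h (g j) - finner Q f (g j)) < \<epsilon> / 2"
      using LIMSEQ_D[OF h(2), of "\<epsilon> / 2"] \<epsilon> by auto
    define j where "j = max J J'"
    define \<alpha> where "\<alpha> = finner Q h (g j)"
    have "cmod (finner Q f (g j)) \<le> cmod \<alpha> + cmod (\<alpha> - finner Q f (g j))"
      using norm_triangle_ineq4[of \<alpha> "\<alpha> - finner Q f (g j)"] by simp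
    then have \<alpha>: "cmod \<alpha> \<ge> \<epsilon> / 2"
      using large[of j] J'[of j] by (simp add: j_def \<alpha>_def)
    define h' where "h' z = h z - \<alpha> * g j z" for z
    have h'F: "h' \<in> F" unfolding h'_def[abs_def] by (intro F_diff F_smult h g)
    have "Re (cnj \<alpha> * finner Q h (g j)) = (cmod \<alpha>)\<^sup>2"
      unfolding \<alpha>_def[symmetric] using complex_norm_square[of \<alpha>]
      by (metis Re_complex_of_real mult.commute)
    then have "(fnorm Q h')\<^sup>2 = (fnorm Q h)\<^sup>2 - 2 * (cmod \<alpha>)\<^sup>2 + (cmod \<alpha>)\<^sup>2 * (fnorm Q (g j))\<^sup>2"
      using fnorm_diff_smult_power2[OF h(1) g(1), of \<alpha> j] unfolding h'_def[abs_def] by (simp only:)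
    moreover have "(cmod \<alpha>)\<^sup>2 * (fnorm Q (g j))\<^sup>2 \<le> (cmod \<alpha>)\<^sup>2 * 1"
      using g(2)[of j] fnorm_nonneg[of "g j"] by (intro mult_left_mono) (simp_all add: power_le_one)
    moreover have "\<epsilon>\<^sup>2 / 4 \<le> (cmod \<alpha>)\<^sup>2"
      using power_mono[OF \<alpha>, of 2] \<epsilon> by (simp add: power_divide)
    moreover have "real (Suc k) * (\<epsilon>\<^sup>2 / 4) = real k * (\<epsilon>\<^sup>2 / 4) + \<epsilon>\<^sup>2 / 4"
      by (simp add: distrib_right)
    ultimately have "(fnorm Q h')\<^sup>2 \<le> (fnorm Q f)\<^sup>2 - real (Suc k) * (\<epsilon>\<^sup>2 / 4)"
      using h(3) by linarith
    moreover have "finner Q h' (g i) - finner Q f (g i) =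
        (finner Q h (g i) - finner Q f (g i)) - \<alpha> * finner Q (g j) (g i)" for i
      unfolding h'_def[abs_def] finner_diff_left[OF h(1) F_smult[OF g(1)] g(1)] finner_smult_left[OF g(1) g(1)]
      by simp
    then have "(\<lambda>i. finner Q h' (g i) - finner Q f (g i)) \<longlonglongrightarrow> 0"
      using tendsto_diff[OF h(2) tendsto_mult_right_zero[OF orth[of j], of \<alpha>]]
      by (simp only: diff_0_right)
    ultimately show ?case using h'F by blast
  qed
  moreover obtain k :: nat where k: "(fnorm Q f)\<^sup>2 / (\<epsilon>\<^sup>2 / 4) < real k"
    using reals_Archimedean2 by blast
  ultimately obtain h where "(fnorm Q h)\<^sup>2 \<le> (fnorm Q f)\<^sup>2 - real k * (\<epsilon>\<^sup>2 / 4)" by blast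
  moreover have "(fnorm Q f)\<^sup>2 < real k * (\<epsilon>\<^sup>2 / 4)"
    using k \<epsilon> by (simp add: pos_divide_less_eq)
  ultimately show False using zero_le_power2[of "fnorm Q h"] by linarith
qed

text \<open>\<open>compact_op\<close> concerns arbitrary maps, so boundedness is derived along one
  bounded sequence: if the images were unbounded, some subsequence would have images growing without
  bound along each of its own subsequences, whereas a Cauchy one stays bounded.\<close>

lemma compact_op_bounded:
  assumes K: "compact_op Q K" and f: "\<And>n. f n \<in> F" "bounded (range (\<lambda>n. fnorm Q (f n)))"
  shows "\<exists>B. \<forall>n. (fnorm Q (K (f n)))\<^sup>2 \<le> B"
proof (rule ccontr)
  assume "\<not> ?thesis"
  then have "\<forall>i::nat. \<exists>n. (fnorm Q (K (f n)))\<^sup>2 > real i" by (auto simp: not_le)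
  then obtain \<sigma> where \<sigma>: "\<And>i::nat. (fnorm Q (K (f (\<sigma> i))))\<^sup>2 > real i" by metis
  have KF: "K h \<in> F" if "h \<in> F" for h using K that by (auto simp: compact_op_def)
  have "bounded (range (\<lambda>n. fnorm Q (f (\<sigma> n))))"
    by (rule bounded_subset[OF f(2)]) auto
  then obtain r :: "nat \<Rightarrow> nat" where r: "strict_mono r"
    "\<And>e. e > 0 \<Longrightarrow> \<exists>M. \<forall>m\<ge>M. \<forall>n\<ge>M. fnorm Q (\<lambda>z. K (f (\<sigma> (r m))) z - K (f (\<sigma> (r n))) z) < e"
    using K f(1) unfolding compact_op_def by (elim conjE allE[of _ "\<lambda>n. f (\<sigma> n)"]) blast
  obtain M where M: "\<And>m n. m \<ge> M \<Longrightarrow> n \<ge> M \<Longrightarrow> fnorm Q (\<lambda>z. K (f (\<sigma> (r m))) z - K (f (\<sigma> (r n))) z) < 1"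
    using r(2)[of 1] by auto
  define B where "B = 2 * 1 + 2 * (fnorm Q (K (f (\<sigma> (r M)))))\<^sup>2"
  have le: "(fnorm Q (K (f (\<sigma> (r m)))))\<^sup>2 \<le> B" if "m \<ge> M" for m
  proof -
    let ?u = "K (f (\<sigma> (r m)))" and ?v = "K (f (\<sigma> (r M)))"
    have F: "?u \<in> F" "?v \<in> F" "(\<lambda>z. ?u z - ?v z) \<in> F" "(\<lambda>z. - ?v z) \<in> F"
      using KF f(1) F_diff F_smult[of ?v "-1"] by auto
    have "?u = (\<lambda>z. (?u z - ?v z) - (- ?v z))" by simp
    then have "(fnorm Q ?u)\<^sup>2 \<le> 2 * (fnorm Q (\<lambda>z. ?u z - ?v z))\<^sup>2 + 2 * (fnorm Q (\<lambda>z. - ?v z))\<^sup>2"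
      using fnorm_power2_diff_le[OF F(3,4)] by simp
    also have "fnorm Q (\<lambda>z. - ?v z) = fnorm Q ?v" using fnorm_smult[OF F(2), of "-1"] by simp
    also have "2 * (fnorm Q (\<lambda>z. ?u z - ?v z))\<^sup>2 \<le> 2 * 1"
      by (intro mult_left_mono power_le_one fnorm_nonneg less_imp_le[OF M[OF that order_refl]]) simp
    finally show ?thesis by (simp add: B_def)
  qed
  obtain i :: nat where i: "B < real i" using reals_Archimedean2 by blast
  define m where "m = max M i"
  have "real i \<le> real (r m)" using seq_suble[OF r(1), of m] by (simp add: m_def)
  then show False using \<sigma>[of "r m"] le[of m] i by (simp add: m_def)
qed

section \<open>Inner products with peaks\<close>

lemma fnorm_power2_le_mass:
  assumes "f \<in> F" "\<And>z. z \<in> ball 0 1 \<Longrightarrow> cmod (f z) \<le> 1"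
  shows "(fnorm Q f)\<^sup>2 \<le> m0"
proof -
  have "Q f \<le> ennreal (1\<^sup>2 * m0)" by (rule bounded_in_F[OF F_holo[OF assms(1)] assms(2)])
  from enn2real_mono[OF this] show ?thesis using mass(2) by (simp add: fnorm_power2)
qed

lemma ip_bound:
  assumes "f \<in> F" "g \<in> F" "integrable (\<mu> n) w"
    and "\<And>z. z \<in> ball 0 1 \<Longrightarrow> cmod (f z) * cmod (g z) \<le> w z"
  shows "cmod (ip n f g) \<le> (\<integral> z. w z \<partial>\<mu> n)"
proof -
  have "cmod (ip n f g) \<le> (\<integral> z. cmod (ball_part f z * cnj (ball_part g z)) \<partial>\<mu> n)"
    unfolding ip_def by (rule integral_norm_bound)
  also have "\<dots> \<le> (\<integral> z. w z \<partial>\<mu> n)"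
  proof (rule integral_mono_AE)
    show "integrable (\<mu> n) (\<lambda>z. cmod (ball_part f z * cnj (ball_part g z)))"
      by (intro integrable_norm integrable_ip assms)
    show "AE z in \<mu> n. cmod (ball_part f z * cnj (ball_part g z)) \<le> w z"
      using AE_ball by eventually_elim (simp add: ball_part_def norm_mult assms(4))
  qed (rule assms)
  finally show ?thesis .
qed

lemma cmod_finner_le:
  assumes "f \<in> F" "g \<in> F" "\<And>n. cmod (ip n f g) \<le> B"
  shows "cmod (finner Q f g) \<le> B"
  by (rule LIMSEQ_le_const2[OF tendsto_norm[OF ip_tendsto[OF assms(1,2)]]]) (use assms(3) in blast)

text \<open>One peak is bounded by 1, and the modulus of the other is the square of the modulus of
  the peak with parameter \<open>t / 2\<close>.\<close>

lemma finner_peaks_le: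
  assumes "norm \<eta> = 1" "s \<ge> 0" "t \<ge> 0"
  shows "cmod (finner Q (peak \<eta> s) (peak \<eta> t)) \<le> a (t / 2)"
proof (rule cmod_finner_le)
  have t2: "t / 2 \<ge> 0" using assms by simp
  note F = peak_in_F(1)[OF assms(1)]
  fix n
  have "cmod (ip n (peak \<eta> s) (peak \<eta> t)) \<le> energy n (peak \<eta> (t / 2))"
    unfolding energy_def
  proof (rule ip_bound)
    fix z :: "complex ^ 'n" assume z: "z \<in> ball 0 1"
    have "cmod (peak \<eta> s z) * cmod (peak \<eta> t z) \<le> 1 * cmod (peak \<eta> t z)"
      using z assms by (intro mult_right_mono cmod_peak_le_1) auto
    also have "\<dots> = (cmod (ball_part (peak \<eta> (t / 2)) z))\<^sup>2"
    proof -
      have "cmod (peak \<eta> t z) = (cmod (peak \<eta> (t / 2) z))\<^sup>2"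
        using cmod_peak_power2[of \<eta> "t / 2" z] by (simp add: cmod_peak)
      then show ?thesis using z by (simp add: ball_part_def)
    qed
    finally show "cmod (peak \<eta> s z) * cmod (peak \<eta> t z) \<le> (cmod (ball_part (peak \<eta> (t / 2)) z))\<^sup>2" .
  qed (intro F assms integrable_power2 t2)+
  also have "\<dots> \<le> (fnorm Q (peak \<eta> (t / 2)))\<^sup>2" by (intro energy_le F t2)
  finally show "cmod (ip n (peak \<eta> s) (peak \<eta> t)) \<le> a (t / 2)" by (simp only: a_eq[OF assms(1)])
qed (intro peak_in_F assms)+

text \<open>The peak functions \<open>p\<close> at \<open>\<eta>\<close> are almost annihilated by \<open>S\<close>, the adjoint of \<open>C\<close>:
  \<open>\<parallel>S p\<parallel>\<^sup>2 = \<langle>C S p, p\<rangle>\<close>, and near \<open>\<eta>\<close>, where \<open>p\<close> lives, \<open>C S p = S p \<circ> \<phi>\<close> takes only values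
  of \<open>S p\<close> on a compact subset of the ball.\<close>
lemma finner_comp_peak_le:
  assumes \<eta>: "norm \<eta> = 1" and t: "t \<ge> 0" and v: "v \<in> F" and u: "u \<in> F" "\<And>z. u z = v (\<phi> z)"
    and r: "r < 1" and \<tau>: "\<tau> > 0" and away: "\<And>z. z \<in> ball 0 1 \<Longrightarrow> 1 - inner z \<eta> < \<tau> \<Longrightarrow> norm (\<phi> z) \<le> r"
    and \<epsilon>: "\<epsilon> > 0"
  shows "cmod (finner Q u (peak \<eta> t)) \<le>
    c0 / (1 - r) ^ q * (fnorm Q v)\<^sup>2 * exp 1 / (2 * \<epsilon>) * a (1 / (2 * \<tau>)) + \<epsilon> / 2 * a t
      + exp (- t * \<tau>) * ((fnorm Q u)\<^sup>2 + m0)"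
proof (rule cmod_finner_le[OF u(1) peak_in_F(1)[OF \<eta> t]])
  fix n
  interpret finite_measure "\<mu> n" by (rule finite_measure_\<mu>)
  define k where "k = c0 / (1 - r) ^ q * (fnorm Q v)\<^sup>2"
  have k: "k \<ge> 0" using point_evaluation(2) r by (simp add: k_def)
  let ?p = "peak \<eta> t" and ?h = "peak \<eta> (1 / (2 * \<tau>))"
  have hF: "?h \<in> F" and pF: "?p \<in> F" using \<eta> \<tau> t by (auto intro!: peak_in_F(1))
  \<comment> \<open>On the cap the product is split by the inequality between the means with weight
    \<epsilon>. The constant bound \<open>k\<close> for \<open>(cmod (u z))\<^sup>2\<close> is
    traded for \<open>k * exp 1\<close> times the squared modulus of \<open>?h\<close>, a peak that
    is at least \<open>exp (- 1)\<close> there; so the cap costs \<open>a (1 / (2 * \<tau>))\<close>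
    and not the whole mass. Off the cap the peak is at most
    \<open>exp (- t * \<tau>)\<close>.\<close>
  define w where "w z = k * exp 1 / (2 * \<epsilon>) * (cmod (ball_part ?h z))\<^sup>2 + \<epsilon> / 2 * (cmod (ball_part ?p z))\<^sup>2
      + exp (- t * \<tau>) * ((cmod (ball_part u z))\<^sup>2 + 1)" for z
  have "cmod (ip n u ?p) \<le> (\<integral> z. w z \<partial>\<mu> n)"
  proof (rule ip_bound[OF u(1) pF])
    show "integrable (\<mu> n) w"
      unfolding w_def[abs_def]
      by (intro Bochner_Integration.integrable_add integrable_mult_right integrable_power2 hF pF u integrable_const)
    fix z :: "complex ^ 'n" assume z: "z \<in> ball 0 1"
    have nonneg: "0 \<le> k * exp 1 / (2 * \<epsilon>) * (cmod (ball_part ?h z))\<^sup>2" "0 \<le> \<epsilon> / 2 * (cmod (ball_part ?p z))\<^sup>2"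
      "0 \<le> exp (- t * \<tau>) * ((cmod (ball_part u z))\<^sup>2 + 1)"
      using k \<epsilon> by (simp_all add: add_nonneg_nonneg)
    show "cmod (u z) * cmod (?p z) \<le> w z"
    proof (cases "1 - inner z \<eta> < \<tau>")
      case True
      have "(cmod (u z))\<^sup>2 \<le> k"
        unfolding k_def u(2) by (rule point_evaluation_F[OF v away[OF z True] r])
      also have "k = k * exp 1 * exp (- 1)" by (simp add: exp_minus)
      also have "\<dots> \<le> k * exp 1 * (cmod (ball_part ?h z))\<^sup>2"
      proof (rule mult_left_mono)
        have "(1 - inner z \<eta>) / \<tau> \<le> 1" using True \<tau> by simp
        then show "exp (- 1) \<le> (cmod (ball_part ?h z))\<^sup>2"
          using z \<tau> by (simp add: ball_part_def cmod_peak_power2)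
      qed (use k in simp)
      finally have uz: "(cmod (u z))\<^sup>2 \<le> k * exp 1 * (cmod (ball_part ?h z))\<^sup>2" .
      have "2 * cmod (u z) * (\<epsilon> * cmod (?p z)) \<le> (cmod (u z))\<^sup>2 + (\<epsilon> * cmod (?p z))\<^sup>2"
        by (rule sum_squares_bound)
      then have "cmod (u z) * cmod (?p z) * (2 * \<epsilon>) \<le> (cmod (u z))\<^sup>2 + \<epsilon>\<^sup>2 * (cmod (?p z))\<^sup>2"
        by (simp add: power_mult_distrib mult_ac)
      then have "cmod (u z) * cmod (?p z) \<le> ((cmod (u z))\<^sup>2 + \<epsilon>\<^sup>2 * (cmod (?p z))\<^sup>2) / (2 * \<epsilon>)"
        using \<epsilon> by (subst pos_le_divide_eq) auto
      also have "\<dots> = (cmod (u z))\<^sup>2 / (2 * \<epsilon>) + \<epsilon> / 2 * (cmod (?p z))\<^sup>2"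
        using \<epsilon> by (simp add: add_divide_distrib power2_eq_square)
      also have "(cmod (u z))\<^sup>2 / (2 * \<epsilon>) \<le> k * exp 1 * (cmod (ball_part ?h z))\<^sup>2 / (2 * \<epsilon>)"
        using \<epsilon> uz by (intro divide_right_mono) auto
      finally have "cmod (u z) * cmod (?p z) \<le> k * exp 1 / (2 * \<epsilon>) * (cmod (ball_part ?h z))\<^sup>2
          + \<epsilon> / 2 * (cmod (ball_part ?p z))\<^sup>2"
        using z by (simp add: ball_part_def)
      then show ?thesis using nonneg(3) unfolding w_def by linarith
    next
      case False
      have "cmod (?p z) \<le> exp (- t * \<tau>)"
        using False t by (simp add: cmod_peak mult_left_mono)
      moreover have "cmod (u z) \<le> (cmod (ball_part u z))\<^sup>2 + 1"
      proof -
        have "cmod (u z) \<le> (cmod (u z))\<^sup>2 + 1"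
          using sum_squares_bound[of "cmod (u z)" 1] norm_ge_zero[of "u z"] by (simp only: power_one mult_1_right)
        then show ?thesis using z by (simp add: ball_part_def)
      qed
      ultimately have "cmod (u z) * cmod (?p z) \<le> ((cmod (ball_part u z))\<^sup>2 + 1) * exp (- t * \<tau>)"
        by (intro mult_mono) auto
      then show ?thesis using nonneg(1,2) unfolding w_def by (simp only: mult.commute)
    qed
  qed
  also have "\<dots> = k * exp 1 / (2 * \<epsilon>) * energy n ?h + \<epsilon> / 2 * energy n ?p
      + exp (- t * \<tau>) * (energy n u + measure (\<mu> n) UNIV)"
    unfolding w_def energy_def using integrable_power2[OF hF, of n] integrable_power2[OF pF, of n] integrable_power2[OF u(1), of n]
    by (simp add: space_\<mu>)
  also have "\<dots> \<le> k * exp 1 / (2 * \<epsilon>) * a (1 / (2 * \<tau>)) + \<epsilon> / 2 * a t + exp (- t * \<tau>) * ((fnorm Q u)\<^sup>2 + m0)"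
  proof (intro add_mono mult_left_mono)
    show "energy n ?h \<le> a (1 / (2 * \<tau>))" "energy n ?p \<le> a t"
      using energy_le[OF hF, of n] energy_le[OF pF, of n] by (simp_all only: a_eq[OF \<eta>])
    show "energy n u \<le> (fnorm Q u)\<^sup>2" by (rule energy_le[OF u(1)])
    show "measure (\<mu> n) UNIV \<le> m0"
      using enn2real_mono[OF mass(1)[of n]] mass(2) by (simp add: measure_def)
  qed (use k \<epsilon> in auto)
  finally show "cmod (ip n u ?p) \<le> c0 / (1 - r) ^ q * (fnorm Q v)\<^sup>2 * exp 1 / (2 * \<epsilon>) * a (1 / (2 * \<tau>)) + \<epsilon> / 2 * a t
      + exp (- t * \<tau>) * ((fnorm Q u)\<^sup>2 + m0)" by (simp only: k_def)
qed

text \<open>By \<open>a_lower\<close>, \<open>a\<close> decays at most polynomially.\<close>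

lemma exp_small_a:
  assumes "\<tau> > 0" "\<epsilon> > 0"
  shows "eventually (\<lambda>t. B * exp (- t * \<tau>) \<le> \<epsilon> * a t) at_top"
proof -
  have "filterlim (\<lambda>t. t * \<tau>) at_top at_top"
    using assms by (intro filterlim_at_top_mult_tendsto_pos[OF tendsto_const]) (auto simp: filterlim_ident)
  from filterlim_compose[OF tendsto_power_div_exp_0 this]
  have "((\<lambda>t. (t * \<tau>) ^ q / exp (t * \<tau>)) \<longlongrightarrow> 0) at_top" .
  then have "((\<lambda>t. B / \<tau> ^ q * ((t * \<tau>) ^ q / exp (t * \<tau>))) \<longlongrightarrow> B / \<tau> ^ q * 0) at_top"
    by (intro tendsto_mult tendsto_const)
  moreover have "B / \<tau> ^ q * 0 < \<epsilon> * (exp (- 2) / c0)" using assms point_evaluation(2) by simp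
  ultimately have "eventually (\<lambda>t. B / \<tau> ^ q * ((t * \<tau>) ^ q / exp (t * \<tau>)) < \<epsilon> * (exp (- 2) / c0)) at_top"
    by (rule order_tendstoD(2))
  then show ?thesis using eventually_ge_at_top[of 1]
  proof eventually_elim
    case (elim t)
    have "B * exp (- t * \<tau>) * t ^ q = B / \<tau> ^ q * ((t * \<tau>) ^ q / exp (t * \<tau>))"
      using assms by (simp add: exp_minus power_mult_distrib field_simps)
    also have "\<dots> \<le> \<epsilon> * (exp (- 2) / c0)" using elim(1) by (rule less_imp_le)
    also have "\<dots> \<le> \<epsilon> * (a t * t ^ q)" using a_lower[OF elim(2)] assms by (intro mult_left_mono) auto
    finally have "B * exp (- t * \<tau>) * t ^ q \<le> \<epsilon> * a t * t ^ q" by (simp only: mult.assoc)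
    moreover have "0 < t ^ q" using elim(2) by simp
    ultimately show ?case by (rule mult_right_le_imp_le)
  qed
qed

text \<open>\<open>S\<close> is accessible only through the adjoint relation. Hence the argument is
  run on the form \<open>finner Q (K f) f\<close>, which equals the squared norm of
  \<open>T f\<close> minus that of \<open>S f\<close>.\<close>

theorem not_ess_normal:
  fixes \<phi> :: "complex ^ 'n \<Rightarrow> complex ^ 'n"
  assumes self: "\<And>z. z \<in> ball 0 1 \<Longrightarrow> \<phi> z \<in> ball 0 1"
    and \<zeta>: "norm \<zeta> = 1" and \<eta>: "norm \<eta> = 1"
    and contact: "\<And>z. z \<in> ball 0 1 \<Longrightarrow> 1 - inner (\<phi> z) \<eta> \<le> M * (1 - inner z \<zeta>)"
    and r: "r < 1" and \<delta>: "\<delta> > 0"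
    and away: "\<And>z. z \<in> ball 0 1 \<Longrightarrow> 1 - inner z \<eta> < \<delta> \<Longrightarrow> norm (\<phi> z) \<le> r"
  shows "\<not> ess_normal Q (comp_op \<phi>)"
proof
  define T where "T = (comp_op \<phi> :: (complex ^ 'n \<Rightarrow> complex) \<Rightarrow> _)"
  assume "ess_normal Q (comp_op \<phi>)"
  then obtain S where TF: "\<And>f. f \<in> F \<Longrightarrow> T f \<in> F" and SF: "\<And>f. f \<in> F \<Longrightarrow> S f \<in> F"
    and adj: "\<And>f g. f \<in> F \<Longrightarrow> g \<in> F \<Longrightarrow> finner Q (T f) g = finner Q f (S g)"
    and comp: "compact_op Q (\<lambda>f z. S (T f) z - T (S f) z)"
    unfolding ess_normal_def T_def by blast
  define K where "K f = (\<lambda>z. S (T f) z - T (S f) z)" for f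
  have K: "compact_op Q K" using comp by (simp only: K_def[abs_def])
  have T: "T f z = f (\<phi> z)" for f z by (simp add: T_def comp_op_def)
  have KF: "K f \<in> F" if "f \<in> F" for f using K that by (simp add: compact_op_def)
  have K_inner: "finner Q (K f) h = finner Q (T f) (T h) - finner Q (S f) (S h)" if f: "f \<in> F" and h: "h \<in> F" for f h
  proof -
    have "finner Q (K f) h = finner Q (S (T f)) h - finner Q (T (S f)) h"
      unfolding K_def by (intro finner_diff_left SF TF f h)
    also have "finner Q (S (T f)) h = cnj (finner Q h (S (T f)))"
      by (intro finner_commute SF TF f h)
    also have "finner Q h (S (T f)) = finner Q (T h) (T f)"
      by (rule adj[symmetric]) (intro TF f h)+
    also have "cnj (finner Q (T h) (T f)) = finner Q (T f) (T h)"
      by (rule finner_commute[symmetric]) (intro TF f h)+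
    also have "finner Q (T (S f)) h = finner Q (S f) (S h)"
      by (intro adj SF f h)
    finally show ?thesis .
  qed
  \<comment> \<open>The lower bound 2 gives \<open>t / M' \<le> t / 2\<close>, so that the window of
    \<open>a_doubling\<close> also reaches \<open>t / 2\<close> in \<open>a_half\<close>.\<close>
  define M' where "M' = max M 2"
  have M': "M' \<ge> 2" by (simp add: M'_def)
  have T_le1: "cmod (T f z) \<le> 1" if "\<And>z. z \<in> ball 0 1 \<Longrightarrow> cmod (f z) \<le> 1" "z \<in> ball 0 1" for f z
    using that self by (simp only: T)
  have p_le1: "cmod (peak \<eta> t z) \<le> 1" if "t \<ge> 0" "z \<in> ball 0 1" for t z
    using that by (intro cmod_peak_le_1 \<eta>) auto
  \<comment> \<open>The contact inequality makes the composed peak dominate pointwise the narrower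
    peak at \<zeta> with parameter \<open>M' * t\<close>.\<close>
  have Tp_lower: "a (M' * t) \<le> (fnorm Q (T (peak \<eta> t)))\<^sup>2" if t: "t \<ge> 0" for t
    unfolding a_eq[OF \<zeta>, symmetric]
  proof (rule fnorm_power2_mono[OF holo_ball_peak TF[OF peak_in_F(1)[OF \<eta> t]]])
    fix z :: "complex ^ 'n" assume z: "z \<in> ball 0 1"
    have "1 - inner (\<phi> z) \<eta> \<le> M * (1 - inner z \<zeta>)" by (rule contact[OF z])
    also have "\<dots> \<le> M' * (1 - inner z \<zeta>)"
      using one_minus_inner_nonneg[of z \<zeta>] \<zeta> z by (intro mult_right_mono) (auto simp: M'_def)
    finally have "t * (1 - inner (\<phi> z) \<eta>) \<le> t * (M' * (1 - inner z \<zeta>))"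
      using t by (rule mult_left_mono)
    then show "cmod (peak \<zeta> (M' * t) z) \<le> cmod (T (peak \<eta> t) z)"
      by (simp add: T cmod_peak mult_ac)
  qed
  obtain c where c: "c > 0" "\<And>T. \<exists>t\<ge>T. c * a (t / M') \<le> a (M' * t)"
    using a_doubling[OF M'] by blast
  from c(2) have "\<forall>j::nat. \<exists>t\<ge>real j + M'. c * a (t / M') \<le> a (M' * t)" by blast
  then obtain t where t: "\<And>j::nat. t j \<ge> real j + M'" "\<And>j. c * a (t j / M') \<le> a (M' * t j)"
    by metis
  have t1: "t j \<ge> 1" "t j \<ge> 0" for j using t(1)[of j] M' by simp_all
  have t_lim: "filterlim t at_top sequentially"
  proof (rule filterlim_at_top_mono[OF filterlim_real_sequentially])
    show "eventually (\<lambda>j. real j \<le> t j) sequentially"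
      by (rule always_eventually) (use t(1) M' in \<open>smt (verit)\<close>)
  qed
  have a_half: "c * a (t j / 2) \<le> a (t j)" for j
  proof -
    have "t j / M' \<le> t j / 2" using M' t1(2)[of j] by (intro divide_left_mono) auto
    then have "c * a (t j / 2) \<le> c * a (t j / M')"
      using c(1) M' t1(2)[of j] by (intro mult_left_mono a_antimono) auto
    also have "\<dots> \<le> a (M' * t j)" by (rule t(2))
    also have "\<dots> \<le> a (t j)"
      using M' t1(2)[of j] by (intro a_antimono) (auto simp: mult_le_cancel_right1)
    finally show ?thesis .
  qed
  have a_M: "c * a (t j) \<le> a (M' * t j)" for j
  proof -
    have "t j / M' \<le> t j" using M' t1(2)[of j] by (simp add: divide_le_eq mult_le_cancel_left1)
    then have "c * a (t j) \<le> c * a (t j / M')"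
      using c(1) M' t1(2)[of j] by (intro mult_left_mono a_antimono) auto
    then show ?thesis using t(2)[of j] by linarith
  qed
  define p where "p j = peak \<eta> (t j)" for j
  have pF: "p j \<in> F" and p_norm: "(fnorm Q (p j))\<^sup>2 = a (t j)" for j
    unfolding p_def using \<eta> t1 by (auto intro!: peak_in_F(1) a_eq)
  have p_le: "cmod (p j z) \<le> 1" if "z \<in> ball 0 1" for j z
    using p_le1[OF t1(2) that] by (simp add: p_def)
  have mass_le: "(fnorm Q (p j))\<^sup>2 \<le> m0" "(fnorm Q (T (p j)))\<^sup>2 \<le> m0" "(fnorm Q (T (T (p j))))\<^sup>2 \<le> m0" for j
    by (intro fnorm_power2_le_mass TF pF T_le1 p_le; assumption)+
  have bdd: "bounded (range (\<lambda>j. fnorm Q (h j)))" if "\<And>j. (fnorm Q (h j))\<^sup>2 \<le> m0" for h :: "nat \<Rightarrow> _"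
  proof -
    have "fnorm Q (h j) \<le> sqrt m0" for j using that by (intro real_le_rsqrt)
    then show ?thesis by (intro boundedI[of _ "sqrt m0"]) (auto simp: fnorm_nonneg)
  qed
  obtain B1 where B1: "\<And>j. (fnorm Q (K (p j)))\<^sup>2 \<le> B1"
    using compact_op_bounded[where f = p, OF K pF bdd[OF mass_le(1)]] by blast
  obtain B2 where B2: "\<And>j. (fnorm Q (K (T (p j))))\<^sup>2 \<le> B2"
    using compact_op_bounded[where f = "\<lambda>j. T (p j)", OF K TF[OF pF] bdd[OF mass_le(2)]] by blast
  \<comment> \<open>A bound on \<open>T (S (p j))\<close> uniform in \<open>j\<close>: it equals
    \<open>S h - K (p j)\<close> for \<open>h = T (p j)\<close>, and the squared norm of
    \<open>S h\<close> is that of \<open>T h\<close> minus the real part of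
    \<open>finner Q (K h) h\<close>. Here \<open>h\<close> and \<open>T h\<close> are bounded by 1
    on the ball, and \<open>B1\<close>, \<open>B2\<close> bound the images under
    \<open>K\<close>.\<close>
  define E where "E = 2 * (2 * m0 + B2) + 2 * B1"
  have TSp: "(fnorm Q (T (S (p j))))\<^sup>2 \<le> E" for j
  proof -
    let ?h = "T (p j)"
    have hF: "?h \<in> F" by (intro TF pF)
    have "Re (finner Q (K ?h) ?h) = (fnorm Q (T ?h))\<^sup>2 - (fnorm Q (S ?h))\<^sup>2"
      unfolding K_inner[OF hF hF] finner_self[OF TF[OF hF]] finner_self[OF SF[OF hF]] by simp
    moreover have "\<bar>Re (finner Q (K ?h) ?h)\<bar> \<le> fnorm Q (K ?h) * fnorm Q ?h"
      using finner_Cauchy_Schwarz[OF KF[OF hF] hF] abs_Re_le_cmod[of "finner Q (K ?h) ?h"] by linarith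
    moreover have "fnorm Q (K ?h) * fnorm Q ?h \<le> (fnorm Q (K ?h))\<^sup>2 + (fnorm Q ?h)\<^sup>2"
    proof -
      have "0 \<le> fnorm Q (K ?h) * fnorm Q ?h" by (simp add: fnorm_nonneg)
      then show ?thesis using sum_squares_bound[of "fnorm Q (K ?h)" "fnorm Q ?h"] by linarith
    qed
    ultimately have Sh: "(fnorm Q (S ?h))\<^sup>2 \<le> 2 * m0 + B2"
      using mass_le(2,3)[of j] B2[of j] by linarith
    have "T (S (p j)) = (\<lambda>z. S ?h z - K (p j) z)" by (simp add: K_def)
    then have "(fnorm Q (T (S (p j))))\<^sup>2 \<le> 2 * (fnorm Q (S ?h))\<^sup>2 + 2 * (fnorm Q (K (p j)))\<^sup>2"
      using fnorm_power2_diff_le[OF SF[OF hF] KF[OF pF[of j]]] by (simp only:)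
    also have "\<dots> \<le> E" unfolding E_def by (intro add_mono mult_left_mono Sh B1) auto
    finally show ?thesis .
  qed
  have Sp_small: "eventually (\<lambda>j. (fnorm Q (S (p j)))\<^sup>2 \<le> 2 * \<epsilon> * a (t j)) sequentially" if \<epsilon>: "\<epsilon> > 0" for \<epsilon>
  proof -
    define b where "b = c0 / (1 - r) ^ q * exp 1 / (2 * \<epsilon>)"
    have b: "b > 0" using r \<epsilon> point_evaluation(2) by (simp add: b_def)
    \<comment> \<open>The first condition gives \<open>b * a s \<le> 1 / 2\<close>, so the cap term
      is at most half of the quantity being estimated and can be absorbed. The second makes the cap
      of height \<open>\<tau> = 1 / (2 * s)\<close> lie in the region where \<open>away\<close>
      applies.\<close>
    have "eventually (\<lambda>s. a s < 1 / (2 * b) \<and> s > 1 / \<delta> \<and> s > 0) at_top"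
      using order_tendstoD(2)[OF a_tendsto_0, of "1 / (2 * b)"] b
      by (intro eventually_conj eventually_gt_at_top) simp
    then obtain s where s: "a s < 1 / (2 * b)" "s > 1 / \<delta>" "s > 0"
      using eventually_happens'[OF trivial_limit_at_top_linorder] by blast
    define \<tau> where "\<tau> = 1 / (2 * s)"
    have \<tau>: "\<tau> > 0" "1 / (2 * \<tau>) = s" using s(3) by (simp_all add: \<tau>_def)
    have "1 / s < \<delta>" using s \<delta> by (simp add: field_simps)
    moreover have "\<tau> \<le> 1 / s" using s(3) by (simp add: \<tau>_def field_simps)
    ultimately have \<tau>\<delta>: "\<tau> \<le> \<delta>" by simp
    have "b * a s \<le> 1 / 2" using s(1) b by (simp add: field_simps)
    have "eventually (\<lambda>j. 2 * (E + m0) * exp (- t j * \<tau>) \<le> \<epsilon> * a (t j)) sequentially"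
      using filterlim_iff[THEN iffD1, OF t_lim, rule_format, OF exp_small_a[OF \<tau>(1) \<epsilon>, of "2 * (E + m0)"]] .
    then show ?thesis
    proof eventually_elim
      case (elim j)
      define X where "X = (fnorm Q (S (p j)))\<^sup>2"
      have "of_real X = finner Q (T (S (p j))) (p j)"
        unfolding X_def finner_self[OF SF[OF pF], symmetric] by (rule adj[symmetric]) (intro SF pF)+
      then have "X = cmod (finner Q (T (S (p j))) (p j))"
        by (metis X_def norm_of_real abs_of_nonneg zero_le_power2)
      also have "\<dots> \<le> c0 / (1 - r) ^ q * X * exp 1 / (2 * \<epsilon>) * a (1 / (2 * \<tau>)) + \<epsilon> / 2 * a (t j)
          + exp (- t j * \<tau>) * ((fnorm Q (T (S (p j))))\<^sup>2 + m0)"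
        unfolding p_def X_def
      proof (rule finner_comp_peak_le[OF \<eta> t1(2) _ _ _ r \<tau>(1) _ \<epsilon>])
        show "S (peak \<eta> (t j)) \<in> F" "T (S (peak \<eta> (t j))) \<in> F"
          using SF[OF pF[of j]] TF[OF SF[OF pF[of j]]] by (simp_all add: p_def)
        show "T (S (peak \<eta> (t j))) z = S (peak \<eta> (t j)) (\<phi> z)" for z by (rule T)
        show "norm (\<phi> z) \<le> r" if "z \<in> ball 0 1" "1 - inner z \<eta> < \<tau>" for z
          using away[OF that(1)] that(2) \<tau>\<delta> by simp
      qed
      also have "c0 / (1 - r) ^ q * X * exp 1 / (2 * \<epsilon>) * a (1 / (2 * \<tau>)) = X * (b * a s)"
        unfolding \<tau>(2) b_def by simp
      also have "\<dots> \<le> X * (1 / 2)" using \<open>b * a s \<le> 1 / 2\<close> by (intro mult_left_mono) (simp_all add: X_def)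
      also have "exp (- t j * \<tau>) * ((fnorm Q (T (S (p j))))\<^sup>2 + m0) \<le> exp (- t j * \<tau>) * (E + m0)"
        using TSp[of j] by (intro mult_left_mono) auto
      finally have "X \<le> X * (1 / 2) + \<epsilon> / 2 * a (t j) + exp (- t j * \<tau>) * (E + m0)" by simp
      moreover have "2 * (E + m0) * exp (- t j * \<tau>) = 2 * (exp (- t j * \<tau>) * (E + m0))" by simp
      ultimately have "X \<le> 2 * (\<epsilon> * a (t j))" using elim by linarith
      then show ?case by (simp add: X_def)
    qed
  qed
  define \<sigma> where "\<sigma> j = 1 / sqrt (a (t j))" for j
  have at: "a (t j) > 0" for j by (rule a_pos[OF t1(1)])
  have \<sigma>: "\<sigma> j > 0" "(\<sigma> j)\<^sup>2 * a (t j) = 1" for j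
    using at[of j] by (simp_all add: \<sigma>_def power_divide)
  define g where "g j = (\<lambda>z. complex_of_real (\<sigma> j) * p j z)" for j
  have gF: "g j \<in> F" for j unfolding g_def by (intro F_smult pF)
  have g_norm: "fnorm Q (g j) = 1" for j
  proof -
    have "(fnorm Q (g j))\<^sup>2 = (\<sigma> j)\<^sup>2 * (fnorm Q (p j))\<^sup>2"
      unfolding g_def fnorm_smult[OF pF] by (simp add: power_mult_distrib)
    then have "(fnorm Q (g j))\<^sup>2 = 1" by (simp only: p_norm \<sigma>)
    then show ?thesis using fnorm_nonneg[of "g j"] by (simp add: power2_eq_1_iff)
  qed
  \<comment> \<open>\<open>S\<close> and \<open>K\<close> need not be homogeneous as functions; the
    scalar is pulled out through the pairing only.\<close>
  have Kg: "finner Q (K (g j)) (g j) = of_real ((\<sigma> j)\<^sup>2) * finner Q (K (p j)) (p j)" for j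
  proof -
    define \<alpha> where "\<alpha> = complex_of_real (\<sigma> j)"
    have g: "g j = (\<lambda>z. \<alpha> * p j z)" by (simp add: g_def \<alpha>_def)
    have cnj\<alpha>: "cnj \<alpha> = \<alpha>" by (simp add: \<alpha>_def)
    have "T (g j) = (\<lambda>z. \<alpha> * T (p j) z)" by (simp add: fun_eq_iff T g)
    then have 1: "finner Q (T (g j)) (T (g j)) = \<alpha> * \<alpha> * finner Q (T (p j)) (T (p j))"
      using finner_smult_left[OF TF[OF pF] F_smult[OF TF[OF pF]]] finner_smult_right[OF TF[OF pF] TF[OF pF]]
      by (simp add: cnj\<alpha>)
    have S1: "finner Q h (S (g j)) = \<alpha> * finner Q h (S (p j))" if h: "h \<in> F" for h
    proof -
      have "finner Q h (S (g j)) = finner Q (T h) (g j)" by (rule adj[symmetric, OF h gF])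
      also have "\<dots> = \<alpha> * finner Q (T h) (p j)"
        unfolding g finner_smult_right[OF TF[OF h] pF] cnj\<alpha> ..
      also have "finner Q (T h) (p j) = finner Q h (S (p j))" by (rule adj[OF h pF])
      finally show ?thesis .
    qed
    have "finner Q (S (g j)) (S (g j)) = \<alpha> * finner Q (S (g j)) (S (p j))" by (rule S1[OF SF[OF gF]])
    also have "finner Q (S (g j)) (S (p j)) = cnj (finner Q (S (p j)) (S (g j)))"
      by (intro finner_commute SF pF gF)
    also have "finner Q (S (p j)) (S (g j)) = \<alpha> * finner Q (S (p j)) (S (p j))"
      by (rule S1[OF SF[OF pF]])
    also have "cnj (\<alpha> * finner Q (S (p j)) (S (p j))) = \<alpha> * finner Q (S (p j)) (S (p j))"
      unfolding finner_self[OF SF[OF pF]] by (simp add: cnj\<alpha>)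
    finally have 2: "finner Q (S (g j)) (S (g j)) = \<alpha> * \<alpha> * finner Q (S (p j)) (S (p j))" by simp
    have "of_real ((\<sigma> j)\<^sup>2) = \<alpha> * \<alpha>" by (simp add: \<alpha>_def power2_eq_square)
    then show ?thesis unfolding K_inner[OF gF gF] K_inner[OF pF pF] 1 2 by (simp only: right_diff_distrib)
  qed
  have Kg_large: "eventually (\<lambda>j. c / 2 \<le> Re (finner Q (K (g j)) (g j))) sequentially"
  proof -
    \<comment> \<open>The choice \<open>c / 4\<close> limits the adjoint part to half of the lower
      bound \<open>c * a (t j)\<close> for the squared norm of \<open>T (p j)\<close>.\<close>
    have "eventually (\<lambda>j. (fnorm Q (S (p j)))\<^sup>2 \<le> 2 * (c / 4) * a (t j)) sequentially"
      using c(1) by (intro Sp_small) simp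
    then show ?thesis
    proof eventually_elim
      case (elim j)
      have "Re (finner Q (K (p j)) (p j)) = (fnorm Q (T (p j)))\<^sup>2 - (fnorm Q (S (p j)))\<^sup>2"
        unfolding K_inner[OF pF pF] finner_self[OF TF[OF pF]] finner_self[OF SF[OF pF]] by simp
      moreover have "c * a (t j) \<le> (fnorm Q (T (p j)))\<^sup>2"
        using a_M[of j] Tp_lower[OF t1(2), of j] unfolding p_def by linarith
      ultimately have "c / 2 * a (t j) \<le> Re (finner Q (K (p j)) (p j))" using elim by simp
      then have "(\<sigma> j)\<^sup>2 * (c / 2 * a (t j)) \<le> (\<sigma> j)\<^sup>2 * Re (finner Q (K (p j)) (p j))"
        by (rule mult_left_mono) simp
      moreover have "(\<sigma> j)\<^sup>2 * (c / 2 * a (t j)) = c / 2 * ((\<sigma> j)\<^sup>2 * a (t j))" by simp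
      moreover have "Re (finner Q (K (g j)) (g j)) = (\<sigma> j)\<^sup>2 * Re (finner Q (K (p j)) (p j))"
        unfolding Kg by (simp only: scaleR_conv_of_real[symmetric] scaleR_complex.sel)
      ultimately show ?case by (simp only: \<sigma>(2) mult_1_right)
    qed
  qed
  then obtain J0 where J0: "\<And>j. j \<ge> J0 \<Longrightarrow> c / 2 \<le> Re (finner Q (K (g j)) (g j))"
    unfolding eventually_sequentially by blast
  \<comment> \<open>Normalization divides by \<open>sqrt (a (t j))\<close>, while
    \<open>finner_peaks_le\<close> yields only \<open>a (t j / 2)\<close>; \<open>a_half\<close>
    converts this into a multiple of \<open>a (t j)\<close>, leaving one factor
    \<open>sqrt (a (t j))\<close> that tends to 0.\<close>
  have orth: "(\<lambda>j. finner Q (g i) (g j)) \<longlonglongrightarrow> 0" for i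
  proof (rule Lim_null_comparison)
    have "(\<lambda>j. a (t j)) \<longlonglongrightarrow> 0" by (rule filterlim_compose[OF a_tendsto_0 t_lim])
    then have "(\<lambda>j. \<sigma> i / c * sqrt (a (t j))) \<longlonglongrightarrow> \<sigma> i / c * sqrt 0"
      by (intro tendsto_mult tendsto_const tendsto_real_sqrt)
    then show "(\<lambda>j. \<sigma> i / c * sqrt (a (t j))) \<longlonglongrightarrow> 0" by simp
    show "eventually (\<lambda>j. cmod (finner Q (g i) (g j)) \<le> \<sigma> i / c * sqrt (a (t j))) sequentially"
    proof (rule always_eventually, rule allI)
      fix j
      have "finner Q (g i) (g j) = of_real (\<sigma> i) * (cnj (of_real (\<sigma> j)) * finner Q (p i) (p j))"
        unfolding g_def finner_smult_left[OF pF F_smult[OF pF]] finner_smult_right[OF pF pF] ..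
      then have "cmod (finner Q (g i) (g j)) = \<sigma> i * \<sigma> j * cmod (finner Q (p i) (p j))"
        using \<sigma>(1)[of i] \<sigma>(1)[of j] by (simp add: norm_mult)
      also have "\<dots> \<le> \<sigma> i * \<sigma> j * (a (t j) / c)"
      proof (rule mult_left_mono)
        have "cmod (finner Q (p i) (p j)) \<le> a (t j / 2)"
          unfolding p_def by (intro finner_peaks_le \<eta> t1)
        also have "\<dots> \<le> a (t j) / c" using a_half[of j] c(1) by (simp add: field_simps)
        finally show "cmod (finner Q (p i) (p j)) \<le> a (t j) / c" .
      qed (use \<sigma>(1)[of i] \<sigma>(1)[of j] in simp)
      also have "\<dots> = \<sigma> i / c * (a (t j) / sqrt (a (t j)))" by (simp add: \<sigma>_def)
      also have "a (t j) / sqrt (a (t j)) = sqrt (a (t j))" using a_nonneg by (rule real_div_sqrt)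
      finally show "cmod (finner Q (g i) (g j)) \<le> \<sigma> i / c * sqrt (a (t j))" .
    qed
  qed
  have "bounded (range (\<lambda>j. fnorm Q (g j)))" by (simp add: g_norm)
  then obtain \<rho> :: "nat \<Rightarrow> nat" where \<rho>: "strict_mono \<rho>"
    "\<And>e. e > 0 \<Longrightarrow> \<exists>M. \<forall>m\<ge>M. \<forall>n\<ge>M. fnorm Q (\<lambda>z. K (g (\<rho> m)) z - K (g (\<rho> n)) z) < e"
    using K gF unfolding compact_op_def by (elim conjE allE[of _ g]) blast
  obtain M0 where M0: "\<And>m n. m \<ge> M0 \<Longrightarrow> n \<ge> M0 \<Longrightarrow> fnorm Q (\<lambda>z. K (g (\<rho> m)) z - K (g (\<rho> n)) z) < c / 8"
    using \<rho>(2)[of "c / 8"] c(1) by auto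
  \<comment> \<open>Past \<open>M0\<close> all images in the subsequence are within
    \<open>c / 8\<close> of the fixed function \<open>f\<close>, and \<open>f\<close> pairs with
    some late member to less than \<open>c / 8\<close>; together this is below
    \<open>c / 2\<close>.\<close>
  define f where "f = K (g (\<rho> M0))"
  have fF: "f \<in> F" unfolding f_def by (intro KF gF)
  have "\<exists>j\<ge>max M0 J0. cmod (finner Q f (g (\<rho> j))) < c / 8"
  proof (rule weakly_null[where g = "\<lambda>j. g (\<rho> j)"])
    show "(\<lambda>j. finner Q (g (\<rho> i)) (g (\<rho> j))) \<longlonglongrightarrow> 0" for i
      using LIMSEQ_subseq_LIMSEQ[OF orth[of "\<rho> i"] \<rho>(1)] by (simp add: comp_def)
  qed (use gF g_norm fF c(1) in auto)
  then obtain j where j: "j \<ge> M0" "j \<ge> J0" "cmod (finner Q f (g (\<rho> j))) < c / 8" by auto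
  let ?u = "\<lambda>z. K (g (\<rho> j)) z - f z"
  have uF: "?u \<in> F" by (intro F_diff KF gF fF)
  have "finner Q ?u (g (\<rho> j)) = finner Q (K (g (\<rho> j))) (g (\<rho> j)) - finner Q f (g (\<rho> j))"
    by (intro finner_diff_left KF gF fF)
  moreover have "cmod (finner Q ?u (g (\<rho> j))) < c / 8"
    using finner_Cauchy_Schwarz[OF uF gF[of "\<rho> j"]] M0[OF j(1) order_refl]
    unfolding g_norm f_def mult_1_right by (rule order.strict_trans1)
  moreover have "c / 2 \<le> Re (finner Q (K (g (\<rho> j))) (g (\<rho> j)))"
    using seq_suble[OF \<rho>(1), of j] j(2) by (intro J0) simp
  ultimately have "c / 2 \<le> Re (finner Q ?u (g (\<rho> j))) + Re (finner Q f (g (\<rho> j)))" by simp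
  also have "\<dots> < c / 8 + c / 8"
    using \<open>cmod (finner Q ?u (g (\<rho> j))) < c / 8\<close> j(3) complex_Re_le_cmod[of "finner Q ?u (g (\<rho> j))"]
      complex_Re_le_cmod[of "finner Q f (g (\<rho> j))"] by linarith
  finally show False using c(1) by simp
qed

end

section \<open>Rotation invariance and integral means\<close>

lemma emeasure_unit_ball:
  "emeasure lborel (ball (0 :: 'a::euclidean_space) 1) \<noteq> 0" "emeasure lborel (ball (0 :: 'a) 1) \<noteq> top"
proof -
  have "unit_ball_vol (real DIM('a)) > 0" by (rule unit_ball_vol_pos) simp
  then show "emeasure lborel (ball (0 :: 'a) 1) \<noteq> 0" "emeasure lborel (ball (0 :: 'a) 1) \<noteq> top"
    unfolding emeasure_ball[OF zero_le_one] by (simp_all only: power_one mult_1_right ennreal_eq_0_iff ennreal_neq_top not_le simp_thms)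
qed

text \<open>Two translation invariant measures \<open>\<lambda>\<close>, \<open>\<nu>\<close> satisfy \<open>\<lambda>(A) \<nu>(B) = \<nu>(-A) \<lambda>(B)\<close>, by Tonelli. Apply this
  to the image \<open>\<nu>\<close> of Lebesgue measure \<open>\<lambda>\<close>, with a ball for \<open>A\<close>.\<close>
lemma lborel_distr_isometry:
  fixes T :: "'a::euclidean_space \<Rightarrow> 'a"
  assumes T: "linear T" "\<And>x. norm (T x) = norm x"
  shows "distr lborel borel T = lborel"
proof -
  define \<nu> where "\<nu> = distr lborel borel T"
  have T_m [measurable]: "T \<in> borel_measurable borel"
    using T(1) by (intro borel_measurable_continuous_onI linear_continuous_on) (simp add: linear_conv_bounded_linear)
  have sets_\<nu> [measurable_cong]: "sets \<nu> = sets borel" by (simp add: \<nu>_def)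
  have "inj T"
    unfolding linear_injective_0[OF T(1)]
  proof (intro allI impI)
    fix x assume "T x = 0"
    then show "x = 0" using T(2)[of x] by simp
  qed
  then obtain T' where "\<And>x. T (T' x) = x"
    using linear_injective_isomorphism[OF T(1)] by blast
  then have "surj T" by (rule surjI)
  have T_dist: "dist (T x) (T y) = dist x y" for x y
    using T(2)[of "x - y"] by (simp add: dist_norm linear_diff[OF T(1)])
  have translate: "(\<integral>\<^sup>+ y. f (y + x) \<partial>\<nu>) = (\<integral>\<^sup>+ y. f y \<partial>\<nu>)"
    if [measurable]: "f \<in> borel_measurable borel" for f :: "'a \<Rightarrow> ennreal" and x
  proof -
    obtain x' where x': "x = T x'" using \<open>surj T\<close> by blast
    have "(\<integral>\<^sup>+ y. f (y + x) \<partial>\<nu>) = (\<integral>\<^sup>+ y. f (T y + x) \<partial>lborel)"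
      unfolding \<nu>_def by (subst nn_integral_distr) auto
    also have "\<dots> = (\<integral>\<^sup>+ y. f (T (x' + y)) \<partial>lborel)"
      by (simp add: x' linear_add[OF T(1)] add.commute)
    also have "\<dots> = (\<integral>\<^sup>+ y. f (T y) \<partial>distr lborel borel ((+) x'))"
      by (subst nn_integral_distr) auto
    also have "\<dots> = (\<integral>\<^sup>+ y. f y \<partial>\<nu>)"
      unfolding \<nu>_def lborel_distr_plus by (subst nn_integral_distr) auto
    finally show ?thesis .
  qed
  have ball_\<nu>: "emeasure \<nu> (ball x r) = emeasure lborel (ball (0::'a) r)" if "r \<ge> 0" for x r
  proof -
    obtain x' where x': "x = T x'" using \<open>surj T\<close> by blast
    have "emeasure \<nu> (ball x r) = emeasure lborel (T -` ball x r)"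
      unfolding \<nu>_def by (subst emeasure_distr) auto
    also have "T -` ball x r = ball x' r" by (auto simp: x' T_dist)
    finally show ?thesis using that by (simp add: emeasure_ball)
  qed
  have "sigma_finite_measure \<nu>"
  proof
    show "\<exists>A. countable A \<and> A \<subseteq> sets \<nu> \<and> \<Union>A = space \<nu> \<and> (\<forall>a\<in>A. emeasure \<nu> a \<noteq> \<infinity>)"
    proof (intro exI conjI)
      show "\<Union>(range (\<lambda>n. ball (0::'a) (real n))) = space \<nu>"
        by (auto simp: \<nu>_def) (use reals_Archimedean2 in blast)
      show "\<forall>a\<in>range (\<lambda>n. ball 0 (real n)). emeasure \<nu> a \<noteq> \<infinity>"
        by (auto simp: ball_\<nu> emeasure_ball)
    qed (auto simp: \<nu>_def)
  qed
  then interpret \<nu>: sigma_finite_measure \<nu> .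
  interpret P: pair_sigma_finite lborel \<nu>
    by (intro pair_sigma_finite.intro lborel.sigma_finite_measure_axioms \<nu>.sigma_finite_measure_axioms)
  define V where "V = emeasure lborel (ball (0::'a) 1)"
  have V: "V \<noteq> 0" "V \<noteq> top"
    unfolding V_def by (rule emeasure_unit_ball)+
  show ?thesis
  proof (rule measure_eqI)
    fix B assume "B \<in> sets (distr lborel borel T)"
    then have B [measurable]: "B \<in> sets borel" by simp
    let ?A = "ball (0::'a) 1"
    have [measurable]: "?A \<in> sets borel" by simp
    have [measurable]: "(\<lambda>x. indicator B (snd x + fst x) :: ennreal) \<in> borel_measurable (lborel \<Otimes>\<^sub>M \<nu>)"
      by (rule measurable_compose[OF _ borel_measurable_indicator[OF B]]) measurable
    have "V * emeasure \<nu> B = (\<integral>\<^sup>+ x. \<integral>\<^sup>+ y. indicator ?A x * indicator B y \<partial>\<nu> \<partial>lborel)"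
    proof -
      have "(\<integral>\<^sup>+ y. indicator ?A x * indicator B y \<partial>\<nu>) = indicator ?A x * emeasure \<nu> B" for x
        by (subst nn_integral_cmult) (simp_all add: sets_\<nu> borel_measurable_indicator)
      moreover have "(\<integral>\<^sup>+ x. indicator ?A x * emeasure \<nu> B \<partial>lborel) = V * emeasure \<nu> B"
        by (subst nn_integral_multc) (simp_all add: V_def borel_measurable_indicator)
      ultimately show ?thesis by simp
    qed
    \<comment> \<open>Invariance of \<nu> introduces the shift in \<open>B\<close>; once the
      integrals are exchanged, invariance of Lebesgue measure moves it over to \<open>?A\<close>,
      and the inner \<nu>-integral then measures a ball.\<close>
    also have "\<dots> = (\<integral>\<^sup>+ x. \<integral>\<^sup>+ y. indicator ?A x * indicator B (y + x) \<partial>\<nu> \<partial>lborel)"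
      by (rule nn_integral_cong, rule translate[symmetric]) simp
    also have "\<dots> = (\<integral>\<^sup>+ y. \<integral>\<^sup>+ x. indicator ?A x * indicator B (y + x) \<partial>lborel \<partial>\<nu>)"
      by (rule P.Fubini'[symmetric]) measurable
    also have "\<dots> = (\<integral>\<^sup>+ y. \<integral>\<^sup>+ x. indicator ?A (x - y) * indicator B x \<partial>lborel \<partial>\<nu>)"
    proof (rule nn_integral_cong)
      fix y
      have "(\<integral>\<^sup>+ x. indicator ?A (x - y) * indicator B x \<partial>lborel)
        = (\<integral>\<^sup>+ x. indicator ?A (x - y) * indicator B x \<partial>distr lborel borel ((+) y))"
        by (simp only: lborel_distr_plus)
      also have "\<dots> = (\<integral>\<^sup>+ x. indicator ?A x * indicator B (y + x) \<partial>lborel)"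
        by (subst nn_integral_distr) auto
      finally show "(\<integral>\<^sup>+ x. indicator ?A x * indicator B (y + x) \<partial>lborel)
        = (\<integral>\<^sup>+ x. indicator ?A (x - y) * indicator B x \<partial>lborel :: ennreal)" ..
    qed
    also have "\<dots> = (\<integral>\<^sup>+ x. \<integral>\<^sup>+ y. indicator ?A (x - y) * indicator B x \<partial>\<nu> \<partial>lborel)"
      by (rule P.Fubini') measurable
    also have "\<dots> = (\<integral>\<^sup>+ x. V * indicator B x \<partial>lborel)"
    proof (rule nn_integral_cong)
      fix x
      have "indicator ?A (x - y) = (indicator (ball x 1) y :: ennreal)" for y
        by (auto simp: dist_norm norm_minus_commute split: split_indicator)
      then have "(\<integral>\<^sup>+ y. indicator ?A (x - y) * indicator B x \<partial>\<nu>) = (\<integral>\<^sup>+ y. indicator (ball x 1) y * indicator B x \<partial>\<nu>)"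
        by (simp only:)
      also have "\<dots> = emeasure \<nu> (ball x 1) * indicator B x"
        by (subst nn_integral_multc) (simp_all add: sets_\<nu> borel_measurable_indicator)
      finally show "(\<integral>\<^sup>+ y. indicator ?A (x - y) * indicator B x \<partial>\<nu>) = V * indicator B x"
        using ball_\<nu>[of 1 x] by (simp add: V_def)
    qed
    also have "\<dots> = V * emeasure lborel B" by (simp add: nn_integral_cmult)
    finally have "V * emeasure \<nu> B = V * emeasure lborel B" .
    then show "emeasure (distr lborel borel T) B = emeasure lborel B"
      using V by (simp add: ennreal_mult_cancel_left \<nu>_def)
  qed simp
qed

text \<open>\<open>T\<close> is the reflection exchanging \<eta> and \<zeta>. It is a real isometry
  and in general not complex linear, which suffices because the modulus of a peak depends only on
  the real inner product.\<close>

lemma exists_reflection: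
  fixes \<eta> \<zeta> :: "'a::real_inner"
  assumes "norm \<eta> = 1" "norm \<zeta> = 1"
  obtains T :: "'a \<Rightarrow> 'a" where "linear T" "\<And>x. norm (T x) = norm x" "\<And>x. inner (T x) \<zeta> = inner x \<eta>"
proof -
  define u where "u = \<eta> - \<zeta>"
  define T where "T x = x - (2 * inner x u / inner u u) *\<^sub>R u" for x
  have uu: "inner u u = 2 * (1 - inner \<eta> \<zeta>)"
    using assms unfolding u_def norm_eq_1 by (simp add: inner_diff_left inner_diff_right inner_commute[of \<zeta> \<eta>])
  have "inner \<zeta> u = - (inner u u) / 2"
    using assms unfolding uu norm_eq_1 by (simp add: u_def inner_diff_right inner_commute[of \<zeta> \<eta>])
  \<comment> \<open>For \<open>\<eta> = \<zeta>\<close> the vector \<open>u\<close> is 0 and the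
    formula degenerates to the identity.\<close>
  then have T\<zeta>: "T \<zeta> = \<eta>" by (cases "u = 0") (simp_all add: T_def u_def)
  show ?thesis
  proof (rule that[of T])
    show "linear T"
      by (rule linearI) (simp_all add: T_def inner_add_left scaleR_add_left scaleR_diff_right
          add_divide_distrib distrib_left)
    show "norm (T x) = norm x" for x
    proof -
      have "inner (T x) (T x) = inner x x"
        by (cases "u = 0") (simp_all add: T_def inner_diff_left inner_diff_right inner_commute[of u x] power2_eq_square)
      then show ?thesis by (simp add: norm_eq_sqrt_inner)
    qed
    have "inner (T x) y = inner x (T y)" for x y
      by (simp add: T_def inner_diff_left inner_diff_right inner_commute[of u y])
    then show "inner (T x) \<zeta> = inner x \<eta>" for x by (simp only: T\<zeta>)
  qed
qed

lemma nn_integral_lborel_isometry: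
  fixes T :: "'a::euclidean_space \<Rightarrow> 'a"
  assumes T: "linear T" "\<And>x. norm (T x) = norm x" and [measurable]: "h \<in> borel_measurable borel"
  shows "(\<integral>\<^sup>+ z. h (T z) \<partial>lborel) = (\<integral>\<^sup>+ z. h z \<partial>lborel)"
proof -
  have [measurable]: "T \<in> borel_measurable borel"
    using T(1) by (intro borel_measurable_continuous_onI linear_continuous_on) (simp add: linear_conv_bounded_linear)
  have "(\<integral>\<^sup>+ z. h z \<partial>distr lborel borel T) = (\<integral>\<^sup>+ z. h (T z) \<partial>lborel)"
    by (subst nn_integral_distr) auto
  then show ?thesis by (simp only: lborel_distr_isometry[OF T])
qed

section \<open>The normalized volume measure\<close>

lemma space_vol_ball [simp]: "space vol_ball = UNIV"
  and sets_vol_ball [simp, measurable_cong]: "sets vol_ball = sets borel"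
  by (simp_all add: vol_ball_def)

lemma emeasure_vol_ball_UNIV: "emeasure (vol_ball :: (complex ^ 'n) measure) UNIV = 1"
  using emeasure_unit_ball[where 'a = "complex ^ 'n"] unfolding vol_ball_def
  by (subst emeasure_uniform_measure) (auto simp: less_top intro!: ennreal_divide_self)

lemma sigma_finite_vol_ball: "sigma_finite_measure (vol_ball :: (complex ^ 'n) measure)"
proof -
  interpret finite_measure "vol_ball :: (complex ^ 'n) measure"
    by (rule finite_measureI) (simp add: emeasure_vol_ball_UNIV)
  show ?thesis by unfold_locales
qed

lemma AE_vol_ball: "AE z in vol_ball. z \<in> ball 0 (1::real)"
  unfolding vol_ball_def by (rule AE_uniform_measureI) auto

lemma nn_integral_vol_ball:
  assumes [measurable]: "h \<in> borel_measurable borel"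
  shows "(\<integral>\<^sup>+ z. h z \<partial>(vol_ball :: (complex ^ 'n) measure)) =
    (\<integral>\<^sup>+ z. h z * indicator (ball 0 1) z \<partial>lborel) / emeasure lborel (ball (0 :: complex ^ 'n) 1)"
  unfolding vol_ball_def by (subst nn_integral_uniform_measure) auto

lemma nn_integral_vol_ball_isometry:
  fixes T :: "complex ^ 'n \<Rightarrow> complex ^ 'n"
  assumes T: "linear T" "\<And>x. norm (T x) = norm x" and [measurable]: "h \<in> borel_measurable borel"
  shows "(\<integral>\<^sup>+ z. h (T z) \<partial>vol_ball) = (\<integral>\<^sup>+ z. h z \<partial>vol_ball)"
proof -
  have [measurable]: "T \<in> borel_measurable borel"
    using T(1) by (intro borel_measurable_continuous_onI linear_continuous_on) (simp add: linear_conv_bounded_linear)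
  have [measurable]: "ball (0 :: complex ^ 'n) 1 \<in> sets borel" by simp
  have "(\<integral>\<^sup>+ z. h (T z) * indicator (ball 0 1) z \<partial>lborel) = (\<integral>\<^sup>+ z. h (T z) * indicator (ball 0 1) (T z) \<partial>lborel)"
    by (simp add: indicator_def T(2))
  also have "\<dots> = (\<integral>\<^sup>+ z. h z * indicator (ball 0 1) z \<partial>lborel)"
    by (rule nn_integral_lborel_isometry[OF T]) measurable
  finally show ?thesis by (simp add: nn_integral_vol_ball)
qed

lemma integral_periodic_shift:
  fixes g :: "real \<Rightarrow> real"
  assumes cont: "continuous_on UNIV g" and per: "\<And>x. g (x + p) = g x" and \<alpha>: "0 \<le> \<alpha>" "\<alpha> \<le> p"
  shows "integral {0..p} (\<lambda>x. g (x + \<alpha>)) = integral {0..p} g"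
proof -
  have c: "continuous_on S g" for S using cont continuous_on_subset by blast
  have i: "g integrable_on {a..b}" for a b by (intro integrable_continuous_interval c)
  have "integral {0..p} (\<lambda>x. g (x + \<alpha>)) = integral {0 + \<alpha>..p + \<alpha>} g"
    using integral_shift_Icc_real[where f = g and a = 0 and b = p and c = \<alpha>] by (simp add: comp_def add.commute)
  also have "\<dots> = integral {\<alpha>..p} g + integral {p..p + \<alpha>} g"
    using \<alpha> by (simp add: Henstock_Kurzweil_Integration.integral_combine i)
  also have "integral {p..p + \<alpha>} g = integral {0..\<alpha>} g"
    using integral_shift_Icc_real[where f = g and a = 0 and b = \<alpha> and c = p]
    by (simp add: comp_def per add.commute[of p])
  also have "integral {\<alpha>..p} g + integral {0..\<alpha>} g = integral {0..p} g"
    using Henstock_Kurzweil_Integration.integral_combine[OF \<alpha> i] by simp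
  finally show ?thesis .
qed

text \<open>Apply the maximum principle to \<open>H \<lambda> = \<integral> F(\<lambda> e\<^sup>i\<^sup>\<theta>) cnj (F(r e\<^sup>i\<^sup>\<theta>)) d\<theta>\<close>, for which \<open>H r\<close> is the
  integral mean at radius \<open>r\<close> and, on the circle of radius \<open>R\<close>, \<open>|H|\<close> is at most the average of both means.\<close>
lemma integral_mean_mono:
  assumes F: "F holomorphic_on ball 0 \<rho>" and r: "0 \<le> r" "r \<le> R" "R < \<rho>"
  shows "integral {0..2 * pi} (\<lambda>\<theta>. (cmod (F (of_real r * cis \<theta>)))\<^sup>2)
    \<le> integral {0..2 * pi} (\<lambda>\<theta>. (cmod (F (of_real R * cis \<theta>)))\<^sup>2)"
proof -
  define I where "I x = integral {0..2 * pi} (\<lambda>\<theta>. (cmod (F (of_real x * cis \<theta>)))\<^sup>2)" for x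
  define H where "H w = integral (cbox 0 (2 * pi)) (\<lambda>\<theta>. F (w * cis \<theta>) * cnj (F (of_real r * cis \<theta>)))" for w
  have in_ball: "w * cis \<theta> \<in> ball 0 \<rho>" if "w \<in> ball 0 \<rho>" for w :: complex and \<theta> using that by (simp add: norm_mult)
  have r_ball: "complex_of_real r \<in> ball 0 \<rho>" and R_ball: "complex_of_real R \<in> ball 0 \<rho>" using r by auto
  have cF: "continuous_on (ball 0 \<rho>) F" by (rule holomorphic_on_imp_continuous_on[OF F])
  have cF': "continuous_on (ball 0 \<rho>) (deriv F)"
    by (intro holomorphic_on_imp_continuous_on holomorphic_deriv F) auto
  have ccirc: "continuous_on S (\<lambda>\<theta>. F (w * cis \<theta>))" if "w \<in> ball 0 \<rho>" for w S
    by (rule continuous_on_compose2[OF cF]) (use in_ball[OF that] in \<open>auto intro!: continuous_intros\<close>)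
  have cI: "continuous_on S (\<lambda>\<theta>. (cmod (F (w * cis \<theta>)))\<^sup>2)" if "w \<in> ball 0 \<rho>" for w S
    by (intro continuous_on_power continuous_on_norm ccirc that)
  have H_holo: "H holomorphic_on ball 0 \<rho>"
    unfolding H_def[abs_def]
  proof (rule leibniz_rule_holomorphic)
    fix w :: complex and \<theta> :: real assume w: "w \<in> ball 0 \<rho>"
    have "(F has_field_derivative deriv F (w * cis \<theta>)) (at (w * cis \<theta>))"
      by (rule holomorphic_derivI[OF F _ in_ball[OF w]]) simp
    from DERIV_chain2[OF this DERIV_cmult_right[OF DERIV_ident, of "cis \<theta>"]]
    have "((\<lambda>w. F (w * cis \<theta>)) has_field_derivative deriv F (w * cis \<theta>) * (1 * cis \<theta>)) (at w within ball 0 \<rho>)" .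
    from DERIV_cmult_right[OF this]
    show "((\<lambda>w. F (w * cis \<theta>) * cnj (F (of_real r * cis \<theta>))) has_field_derivative
        deriv F (w * cis \<theta>) * cis \<theta> * cnj (F (of_real r * cis \<theta>))) (at w within ball 0 \<rho>)" by simp
  next
    fix w :: complex assume w: "w \<in> ball 0 \<rho>"
    show "(\<lambda>\<theta>. F (w * cis \<theta>) * cnj (F (of_real r * cis \<theta>))) integrable_on cbox 0 (2 * pi)"
      by (intro integrable_continuous continuous_on_mult continuous_on_cnj ccirc w r_ball)
  next
    have 1: "continuous_on (ball 0 \<rho> \<times> cbox 0 (2 * pi)) (\<lambda>z. deriv F (fst z * cis (snd z)))"
      by (rule continuous_on_compose2[OF cF']) (auto intro!: continuous_intros simp: norm_mult)
    have 2: "continuous_on (ball 0 \<rho> \<times> cbox 0 (2 * pi)) (\<lambda>z. F (of_real r * cis (snd z)))"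
      by (rule continuous_on_compose2[OF cF]) (use r in \<open>auto intro!: continuous_intros simp: norm_mult\<close>)
    have "continuous_on (ball 0 \<rho> \<times> cbox 0 (2 * pi))
        (\<lambda>z. deriv F (fst z * cis (snd z)) * cis (snd z) * cnj (F (of_real r * cis (snd z))))"
      by (intro continuous_on_mult 1 continuous_on_cnj 2) (auto intro!: continuous_intros)
    then show "continuous_on (ball 0 \<rho> \<times> cbox 0 (2 * pi))
        (\<lambda>(w, \<theta>). deriv F (w * cis \<theta>) * cis \<theta> * cnj (F (of_real r * cis \<theta>)))"
      by (simp add: case_prod_unfold)
  qed simp
  have H_r: "H (of_real r) = of_real (I r)"
  proof -
    have "(\<lambda>\<theta>. (cmod (F (of_real r * cis \<theta>)))\<^sup>2) integrable_on {0..2 * pi}"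
      by (intro integrable_continuous_interval cI r_ball)
    from integral_unique[OF has_integral_of_real[OF integrable_integral[OF this]]]
    have "integral {0..2 * pi} (\<lambda>\<theta>. complex_of_real ((cmod (F (of_real r * cis \<theta>)))\<^sup>2)) = of_real (I r)"
      by (simp only: I_def)
    moreover have "H (of_real r) = integral {0..2 * pi} (\<lambda>\<theta>. of_real ((cmod (F (of_real r * cis \<theta>)))\<^sup>2))"
      unfolding H_def cbox_interval complex_norm_square ..
    ultimately show ?thesis by (simp only:)
  qed
  have H_le: "cmod (H w) \<le> (I R + I r) / 2" if w: "w \<in> frontier (cball 0 R)" for w
  proof -
    have wR: "cmod w = R" using w r by (cases "R = 0") (auto simp: frontier_cball frontier_def)
    define \<alpha> where "\<alpha> = Arg2pi w"
    have \<alpha>: "0 \<le> \<alpha>" "\<alpha> \<le> 2 * pi" using Arg2pi[of w] by (auto simp: \<alpha>_def)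
    have "w = of_real R * cis \<alpha>"
      using Arg2pi_eq[of w] by (simp only: wR \<alpha>_def cis_conv_exp)
    then have w_eq: "w * cis \<theta> = of_real R * cis (\<theta> + \<alpha>)" for \<theta>
      by (simp add: cis_mult add.commute)
    have wb: "w \<in> ball 0 \<rho>" using wR r by simp
    have "cmod (H w) \<le> integral (cbox 0 (2 * pi)) (\<lambda>\<theta>. ((cmod (F (w * cis \<theta>)))\<^sup>2 + (cmod (F (of_real r * cis \<theta>)))\<^sup>2) / 2)"
      unfolding H_def
    proof (rule integral_norm_bound_integral)
      show "cmod (F (w * cis \<theta>) * cnj (F (of_real r * cis \<theta>))) \<le> ((cmod (F (w * cis \<theta>)))\<^sup>2 + (cmod (F (of_real r * cis \<theta>)))\<^sup>2) / 2" for \<theta>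
        using sum_squares_bound[of "cmod (F (w * cis \<theta>))" "cmod (F (of_real r * cis \<theta>))"] by (simp add: norm_mult)
    qed (intro integrable_continuous continuous_on_mult continuous_on_divide continuous_on_add continuous_on_cnj
        continuous_on_const ccirc cI wb r_ball; simp)+
    also have "\<dots> = (integral {0..2 * pi} (\<lambda>\<theta>. (cmod (F (w * cis \<theta>)))\<^sup>2) + I r) / 2"
      unfolding I_def cbox_interval integral_divide
      by (subst Henstock_Kurzweil_Integration.integral_add) (intro integrable_continuous_interval cI wb r_ball refl)+
    also have "integral {0..2 * pi} (\<lambda>\<theta>. (cmod (F (w * cis \<theta>)))\<^sup>2) = I R"
      unfolding I_def w_eq
      by (rule integral_periodic_shift[OF cI[OF R_ball] _ \<alpha>]) (simp add: cis_mult[symmetric])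
    finally show ?thesis .
  qed
  have "cmod (H (of_real r)) \<le> (I R + I r) / 2"
  proof (rule maximum_modulus_frontier[OF _ _ bounded_cball H_le])
    have sub: "cball 0 R \<subseteq> ball (0::complex) \<rho>" using r by auto
    show "H holomorphic_on interior (cball 0 R)"
      by (rule holomorphic_on_subset[OF H_holo]) (use sub interior_subset in blast)
    show "continuous_on (closure (cball 0 R)) H"
      using sub by (auto intro!: continuous_on_subset[OF holomorphic_on_imp_continuous_on[OF H_holo]])
    show "complex_of_real r \<in> cball 0 R" using r by simp
  qed
  then show ?thesis unfolding H_r norm_of_real using abs_ge_self[of "I r"] unfolding I_def by simp
qed

section \<open>Averaging over rotations and complex slices\<close>

lemma linear_smult: "linear (\<lambda>x. c *s x)" for c :: complex
  using bounded_linear_smult_right by (rule bounded_linear.linear)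

lemma borel_measurable_cis_smult [measurable]:
  "(\<lambda>(\<theta>, z). cis \<theta> *s z) \<in> borel_measurable (borel \<Otimes>\<^sub>M (borel :: (complex ^ 'n) measure))"
  unfolding borel_prod
  by (intro borel_measurable_continuous_onI) (auto simp: case_prod_unfold intro!: continuous_intros)

text \<open>Integrating \<open>le\<close> over \<nu> and exchanging the integrals turns either side
  into \<open>2 * pi\<close> times the desired one, by invariance. Inequalities between circle means
  in one variable thus become inequalities between integrals in several.\<close>

lemma nn_integral_mono_rotation:
  fixes \<nu> :: "(complex ^ 'n) measure" and u v :: "complex ^ 'n \<Rightarrow> ennreal"
  assumes \<nu>: "sigma_finite_measure \<nu>" "sets \<nu> = sets borel"
    and inv: "\<And>\<theta> h. h \<in> borel_measurable borel \<Longrightarrow> (\<integral>\<^sup>+ z. h (cis \<theta> *s z) \<partial>\<nu>) = (\<integral>\<^sup>+ z. h z \<partial>\<nu>)"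
    and [measurable]: "u \<in> borel_measurable borel" "v \<in> borel_measurable borel"
    and le: "\<And>z. (\<integral>\<^sup>+ \<theta>. u (cis \<theta> *s z) * indicator {0..2 * pi} \<theta> \<partial>lborel)
      \<le> (\<integral>\<^sup>+ \<theta>. v (cis \<theta> *s z) * indicator {0..2 * pi} \<theta> \<partial>lborel)"
  shows "(\<integral>\<^sup>+ z. u z \<partial>\<nu>) \<le> (\<integral>\<^sup>+ z. v z \<partial>\<nu>)"
proof -
  interpret \<nu>: sigma_finite_measure \<nu> by (rule \<nu>)
  interpret P: pair_sigma_finite lborel \<nu>
    by (intro pair_sigma_finite.intro lborel.sigma_finite_measure_axioms \<nu>.sigma_finite_measure_axioms)
  note [measurable_cong] = \<nu>(2)
  have avg: "(\<integral>\<^sup>+ z. \<integral>\<^sup>+ \<theta>. h (cis \<theta> *s z) * indicator {0..2 * pi} \<theta> \<partial>lborel \<partial>\<nu>) = ennreal (2 * pi) * (\<integral>\<^sup>+ z. h z \<partial>\<nu>)"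
    if [measurable]: "h \<in> borel_measurable borel" for h :: "complex ^ 'n \<Rightarrow> ennreal"
  proof -
    have "(\<integral>\<^sup>+ z. \<integral>\<^sup>+ \<theta>. h (cis \<theta> *s z) * indicator {0..2 * pi} \<theta> \<partial>lborel \<partial>\<nu>)
      = (\<integral>\<^sup>+ \<theta>. \<integral>\<^sup>+ z. h (cis \<theta> *s z) * indicator {0..2 * pi} \<theta> \<partial>\<nu> \<partial>lborel)"
      by (rule P.Fubini') measurable
    also have "\<dots> = (\<integral>\<^sup>+ \<theta>. (\<integral>\<^sup>+ z. h z \<partial>\<nu>) * indicator {0..2 * pi} \<theta> \<partial>lborel)"
    proof (rule nn_integral_cong)
      fix \<theta> :: real
      have "(\<lambda>z. cis \<theta> *s z) \<in> borel_measurable (borel :: (complex ^ 'n) measure)"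
        by (intro borel_measurable_continuous_onI continuous_intros)
      then have "(\<lambda>z. h (cis \<theta> *s z)) \<in> borel_measurable \<nu>"
        by (simp add: measurable_cong_sets[OF \<nu>(2) refl] measurable_compose[OF _ that])
      then show "(\<integral>\<^sup>+ z. h (cis \<theta> *s z) * indicator {0..2 * pi} \<theta> \<partial>\<nu>) = (\<integral>\<^sup>+ z. h z \<partial>\<nu>) * indicator {0..2 * pi} \<theta>"
        by (simp add: nn_integral_multc inv[OF that])
    qed
    also have "\<dots> = (\<integral>\<^sup>+ z. h z \<partial>\<nu>) * ennreal (2 * pi)"
      by (simp add: nn_integral_cmult)
    finally show ?thesis by (simp only: mult.commute)
  qed
  have "ennreal (2 * pi) * (\<integral>\<^sup>+ z. u z \<partial>\<nu>) \<le> ennreal (2 * pi) * (\<integral>\<^sup>+ z. v z \<partial>\<nu>)"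
    unfolding avg[symmetric, OF \<open>u \<in> _\<close>] avg[symmetric, OF \<open>v \<in> _\<close>] by (intro nn_integral_mono le)
  then show ?thesis using pi_gt_zero by (subst (asm) ennreal_mult_le_mult_iff) auto
qed

lemma holo_ball_slice:
  assumes f: "holo_ball f" and w: "w \<in> ball 0 1" and z: "norm w + \<rho> * norm z \<le> 1"
  shows "(\<lambda>\<xi>. f (w + \<xi> *s z)) holomorphic_on ball 0 \<rho>"
    and "\<And>\<xi>. \<xi> \<in> ball 0 \<rho> \<Longrightarrow> w + \<xi> *s z \<in> ball 0 1"
proof -
  show in_ball: "w + \<xi> *s z \<in> ball 0 1" if "\<xi> \<in> ball 0 \<rho>" for \<xi>
  proof (cases "z = 0")
    case False
    have "norm (w + \<xi> *s z) \<le> norm w + cmod \<xi> * norm z"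
      using norm_triangle_ineq[of w "\<xi> *s z"] by (simp add: norm_smult)
    also have "\<dots> < norm w + \<rho> * norm z" using that False by simp
    finally show ?thesis using z by simp
  qed (use w in simp)
  have "((\<lambda>\<xi>. f (w + \<xi> *s z)) has_field_derivative frechet_derivative f (at (w + \<xi> *s z)) z) (at \<xi>)"
    if \<xi>: "\<xi> \<in> ball 0 \<rho>" for \<xi>
  proof -
    obtain D where D: "(f has_derivative D) (at (w + \<xi> *s z))" "\<And>c v. D (c *s v) = c * D v"
      using f in_ball[OF \<xi>] unfolding holo_ball_def by blast
    have "((\<lambda>\<xi>. \<xi> *s z) has_derivative (\<lambda>\<xi>. \<xi> *s z)) (at \<xi>)"
      by (rule bounded_linear_imp_has_derivative[OF bounded_linear_smult_left])
    from has_derivative_add[OF has_derivative_const[of w] this]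
    have "((\<lambda>\<xi>. w + \<xi> *s z) has_derivative (\<lambda>\<xi>. \<xi> *s z)) (at \<xi>)" by simp
    from has_derivative_compose[OF this D(1)]
    have "((\<lambda>\<xi>. f (w + \<xi> *s z)) has_derivative (\<lambda>\<xi>. D z * \<xi>)) (at \<xi>)"
      by (simp add: D(2) mult.commute)
    then have "((\<lambda>\<xi>. f (w + \<xi> *s z)) has_field_derivative D z) (at \<xi>)"
      by (simp add: has_field_derivative_def)
    then show ?thesis using frechet_derivative_at[OF D(1)] by simp
  qed
  then show "(\<lambda>\<xi>. f (w + \<xi> *s z)) holomorphic_on ball 0 \<rho>"
    by (intro holomorphic_onI) (meson field_differentiable_at_within field_differentiable_def)
qed

lemma nn_integral_slice_mono:
  assumes f: "holo_ball f" and w: "w \<in> ball 0 1" and z: "norm w + \<rho> * norm z \<le> 1"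
    and r: "0 \<le> r" "r \<le> R" "R < \<rho>"
  shows "(\<integral>\<^sup>+ \<theta>. ennreal ((cmod (f (w + r *\<^sub>R (cis \<theta> *s z))))\<^sup>2) * indicator {0..2 * pi} \<theta> \<partial>lborel)
    \<le> (\<integral>\<^sup>+ \<theta>. ennreal ((cmod (f (w + R *\<^sub>R (cis \<theta> *s z))))\<^sup>2) * indicator {0..2 * pi} \<theta> \<partial>lborel)"
proof -
  define F where "F \<xi> = f (w + \<xi> *s z)" for \<xi>
  have F: "F holomorphic_on ball 0 \<rho>"
    unfolding F_def[abs_def] by (rule holo_ball_slice(1)[OF f w z])
  have eq: "(\<integral>\<^sup>+ \<theta>. ennreal ((cmod (f (w + x *\<^sub>R (cis \<theta> *s z))))\<^sup>2) * indicator {0..2 * pi} \<theta> \<partial>lborel)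
    = ennreal (integral {0..2 * pi} (\<lambda>\<theta>. (cmod (F (of_real x * cis \<theta>)))\<^sup>2))" if x: "0 \<le> x" "x < \<rho>" for x
  proof -
    have Feq: "f (w + x *\<^sub>R (cis \<theta> *s z)) = F (of_real x * cis \<theta>)" for \<theta>
      by (simp add: F_def scaleR_eq_smult)
    have "continuous_on {0..2 * pi} (\<lambda>\<theta>. F (of_real x * cis \<theta>))"
      by (rule continuous_on_compose2[OF holomorphic_on_imp_continuous_on[OF F]])
         (use x in \<open>auto intro!: continuous_intros simp: norm_mult\<close>)
    then have "((\<lambda>\<theta>. (cmod (F (of_real x * cis \<theta>)))\<^sup>2) has_integral
        integral {0..2 * pi} (\<lambda>\<theta>. (cmod (F (of_real x * cis \<theta>)))\<^sup>2)) {0..2 * pi}"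
      by (intro integrable_integral integrable_continuous_interval continuous_on_power continuous_on_norm)
    then show ?thesis unfolding Feq
      by (intro nn_integral_has_integral_lebesgue') auto
  qed
  show ?thesis
    using r integral_mean_mono[OF F r] by (simp add: eq ennreal_leI)
qed

lemma borel_measurable_ball_part_scaled [measurable]:
  assumes "holo_ball f" "g \<in> borel_measurable borel"
  shows "(\<lambda>z. ennreal ((cmod (ball_part f (g z)))\<^sup>2)) \<in> borel_measurable (borel :: (complex ^ 'n) measure)"
proof -
  have [measurable]: "ball_part f \<in> borel_measurable borel" "g \<in> borel_measurable borel"
    using assms measurable_ball_part by blast+
  show ?thesis by measurable
qed

text \<open>The mean value inequality over the ball of radius \<epsilon> about \<open>w\<close>,
  obtained from circle means on the complex lines through \<open>w\<close>. Taking half the distance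
  to the sphere leaves the slices room up to radius 2 and keeps the small ball inside radius
  \<open>1 - \<epsilon>\<close>, where sphere means and Bergman weights are under control. The power
  of \<epsilon> is a volume ratio.\<close>

lemma point_evaluation_vol_ball:
  fixes f :: "complex ^ 'n \<Rightarrow> complex"
  assumes f: "holo_ball f" and w: "w \<in> ball 0 1"
  defines "\<epsilon> \<equiv> (1 - norm w) / 2"
  shows "ennreal ((cmod (f w))\<^sup>2) * ennreal (\<epsilon> ^ (2 * CARD('n)))
    \<le> (\<integral>\<^sup>+ z. ennreal ((cmod (ball_part f z))\<^sup>2) * indicator (ball 0 (1 - \<epsilon>)) z \<partial>vol_ball)"
proof -
  have \<epsilon>: "\<epsilon> > 0" "norm w + 2 * \<epsilon> = 1" "\<epsilon> \<le> 1 / 2" using w by (auto simp: \<epsilon>_def field_simps)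
  have [measurable]: "ball x (r::real) \<in> sets borel" for x :: "complex ^ 'n" and r by simp
  let ?V = "emeasure lborel (ball (0 :: complex ^ 'n) 1)"
  have "ennreal ((cmod (f w))\<^sup>2) * emeasure lborel (ball (0 :: complex ^ 'n) \<epsilon>) =
      (\<integral>\<^sup>+ z. ennreal ((cmod (f w))\<^sup>2) * indicator (ball 0 \<epsilon>) z \<partial>(lborel :: (complex ^ 'n) measure))"
    by (subst nn_integral_cmult) auto
  also have "\<dots> \<le> (\<integral>\<^sup>+ z. ennreal ((cmod (ball_part f (w + z)))\<^sup>2) * indicator (ball 0 \<epsilon>) z \<partial>lborel)"
  proof (rule nn_integral_mono_rotation)
    show "sigma_finite_measure (lborel :: (complex ^ 'n) measure)" by (rule lborel.sigma_finite_measure_axioms)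
    show "(\<integral>\<^sup>+ z. h (cis \<theta> *s z) \<partial>lborel) = (\<integral>\<^sup>+ z. h z \<partial>lborel)"
      if "h \<in> borel_measurable borel" for \<theta> and h :: "complex ^ 'n \<Rightarrow> ennreal"
      by (rule nn_integral_lborel_isometry[OF linear_smult _ that]) (simp add: norm_smult)
    show "(\<lambda>z. ennreal ((cmod (ball_part f (w + z)))\<^sup>2) * indicator (ball 0 \<epsilon>) z) \<in> borel_measurable borel"
      by (intro borel_measurable_times_ennreal borel_measurable_ball_part_scaled f borel_measurable_indicator) auto
    fix z :: "complex ^ 'n"
    show "(\<integral>\<^sup>+ \<theta>. ennreal ((cmod (f w))\<^sup>2) * indicator (ball 0 \<epsilon>) (cis \<theta> *s z) * indicator {0..2 * pi} \<theta> \<partial>lborel)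
      \<le> (\<integral>\<^sup>+ \<theta>. ennreal ((cmod (ball_part f (w + cis \<theta> *s z)))\<^sup>2) * indicator (ball 0 \<epsilon>) (cis \<theta> *s z) * indicator {0..2 * pi} \<theta> \<partial>lborel)"
    proof (cases "z \<in> ball 0 \<epsilon>")
      case True
      then have z: "norm w + 2 * norm z \<le> 1" using \<epsilon> by simp
      have "w + cis \<theta> *s z \<in> ball 0 1" for \<theta>
        by (rule holo_ball_slice(2)[OF f w z]) simp
      then have "ball_part f (w + cis \<theta> *s z) = f (w + 1 *\<^sub>R (cis \<theta> *s z))" for \<theta>
        by (simp only: ball_part_def if_True scaleR_one)
      moreover have "indicator (ball 0 \<epsilon>) (cis \<theta> *s z) = (1 :: ennreal)" for \<theta>
        using True by (simp add: norm_smult)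
      ultimately show ?thesis
        using nn_integral_slice_mono[OF f w z, of 0 1] by simp
    next
      case False
      then have "indicator (ball 0 \<epsilon>) (cis \<theta> *s z) = (0 :: ennreal)" for \<theta> by (simp add: norm_smult)
      then show ?thesis by simp
    qed
  qed auto
  also have "\<dots> = (\<integral>\<^sup>+ z. ennreal ((cmod (ball_part f z))\<^sup>2) * indicator (ball 0 \<epsilon>) (z - w) \<partial>distr lborel borel ((+) w))"
    using f by (subst nn_integral_distr) auto
  also have "\<dots> = (\<integral>\<^sup>+ z. ennreal ((cmod (ball_part f z))\<^sup>2) * indicator (ball 0 \<epsilon>) (z - w) \<partial>lborel)"
    by (simp only: lborel_distr_plus)
  also have "\<dots> \<le> (\<integral>\<^sup>+ z. ennreal ((cmod (ball_part f z))\<^sup>2) * indicator (ball 0 (1 - \<epsilon>)) z * indicator (ball 0 1) z \<partial>lborel)"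
  proof (rule nn_integral_mono)
    fix z :: "complex ^ 'n"
    have "norm z < 1 - \<epsilon>" if "norm (z - w) < \<epsilon>"
      using norm_triangle_sub[of z w] that \<epsilon> by simp
    then show "ennreal ((cmod (ball_part f z))\<^sup>2) * indicator (ball 0 \<epsilon>) (z - w)
      \<le> ennreal ((cmod (ball_part f z))\<^sup>2) * indicator (ball 0 (1 - \<epsilon>)) z * indicator (ball 0 1) z"
      using \<epsilon>(1) by (auto split: split_indicator)
  qed
  finally have "ennreal ((cmod (f w))\<^sup>2) * emeasure lborel (ball (0 :: complex ^ 'n) \<epsilon>) / ?V
    \<le> (\<integral>\<^sup>+ z. ennreal ((cmod (ball_part f z))\<^sup>2) * indicator (ball 0 (1 - \<epsilon>)) z \<partial>vol_ball)"
    using f by (subst nn_integral_vol_ball) (auto intro!: divide_right_mono_ennreal)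
  moreover have "emeasure lborel (ball (0 :: complex ^ 'n) \<epsilon>) = ennreal (\<epsilon> ^ (2 * CARD('n))) * ?V"
    using \<epsilon>(1) by (simp add: emeasure_ball ennreal_mult'[symmetric] mult.commute)
  moreover have "ennreal (\<epsilon> ^ (2 * CARD('n))) * ?V / ?V = ennreal (\<epsilon> ^ (2 * CARD('n)))"
    using emeasure_unit_ball[where 'a = "complex ^ 'n"]
    by (simp add: ennreal_times_divide[symmetric] ennreal_divide_self less_top)
  ultimately show ?thesis by (simp add: ennreal_times_divide[symmetric])
qed

section \<open>The Hardy space\<close>

lemma sgn_smult_cis: "sgn (cis \<theta> *s z) = cis \<theta> *s sgn z" for z :: "complex ^ 'n"
  by (simp add: sgn_div_norm norm_smult scaleR_eq_smult mult.commute)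

lemma norm_scaled_sgn_less_1: "0 \<le> r \<Longrightarrow> r < 1 \<Longrightarrow> norm (r *\<^sub>R sgn z) < 1" for z :: "'a::real_normed_vector"
  by (simp add: norm_sgn)

lemma borel_measurable_scaled_sgn [measurable]:
  "(\<lambda>z. r *\<^sub>R sgn z) \<in> borel_measurable (borel :: 'a::euclidean_space measure)"
  unfolding sgn_div_norm by measurable

lemma nn_integral_vol_ball_mono_rotation:
  fixes u v :: "complex ^ 'n \<Rightarrow> ennreal"
  assumes "u \<in> borel_measurable borel" "v \<in> borel_measurable borel"
    and "\<And>z. (\<integral>\<^sup>+ \<theta>. u (cis \<theta> *s z) * indicator {0..2 * pi} \<theta> \<partial>lborel)
      \<le> (\<integral>\<^sup>+ \<theta>. v (cis \<theta> *s z) * indicator {0..2 * pi} \<theta> \<partial>lborel)"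
  shows "(\<integral>\<^sup>+ z. u z \<partial>vol_ball) \<le> (\<integral>\<^sup>+ z. v z \<partial>vol_ball)"
proof (rule nn_integral_mono_rotation[OF sigma_finite_vol_ball sets_vol_ball _ assms])
  show "(\<integral>\<^sup>+ z. h (cis \<theta> *s z) \<partial>vol_ball) = (\<integral>\<^sup>+ z. h z \<partial>vol_ball)"
    if "h \<in> borel_measurable borel" for \<theta> and h :: "complex ^ 'n \<Rightarrow> ennreal"
    by (rule nn_integral_vol_ball_isometry[OF linear_smult _ that]) (simp add: norm_smult)
qed

text \<open>The mean over the sphere of radius \<open>r\<close> is written as an integral over the
  ball, so that rotation averaging and isometry invariance of \<open>vol_ball\<close> apply
  directly.\<close>

definition sphere_mean :: "(complex ^ 'n \<Rightarrow> complex) \<Rightarrow> real \<Rightarrow> ennreal" where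
  "sphere_mean f r = (\<integral>\<^sup>+ z. ennreal ((cmod (ball_part f (r *\<^sub>R sgn z)))\<^sup>2) \<partial>vol_ball)"

lemma ball_part_scaled_sgn: "0 \<le> r \<Longrightarrow> r < 1 \<Longrightarrow> ball_part f (r *\<^sub>R sgn z) = f (r *\<^sub>R sgn z)"
  using norm_scaled_sgn_less_1[of r z] by (simp add: ball_part_def)

lemma sphere_mean_mono:
  assumes f: "holo_ball f" and r: "0 \<le> r" "r \<le> R" "R < 1"
  shows "sphere_mean f r \<le> sphere_mean f R"
  unfolding sphere_mean_def
proof (rule nn_integral_vol_ball_mono_rotation)
  fix z :: "complex ^ 'a"
  have "norm (0 :: complex ^ 'a) + 1 * norm (sgn z) \<le> 1" by (simp add: norm_sgn)
  from nn_integral_slice_mono[OF f _ this r]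
  show "(\<integral>\<^sup>+ \<theta>. ennreal ((cmod (ball_part f (r *\<^sub>R sgn (cis \<theta> *s z))))\<^sup>2) * indicator {0..2 * pi} \<theta> \<partial>lborel)
      \<le> (\<integral>\<^sup>+ \<theta>. ennreal ((cmod (ball_part f (R *\<^sub>R sgn (cis \<theta> *s z))))\<^sup>2) * indicator {0..2 * pi} \<theta> \<partial>lborel)"
    using r by (simp add: ball_part_scaled_sgn sgn_smult_cis[symmetric])
qed (intro borel_measurable_ball_part_scaled f borel_measurable_scaled_sgn)+

text \<open>On the complex line through \<open>z\<close>, the circle of radius \<open>norm z\<close>
  is moved out to radius \<rho>, which increases the mean; rotation averaging takes the place of
  polar coordinates.\<close>

lemma vol_ball_integral_le_sphere_mean:
  fixes f :: "complex ^ 'n \<Rightarrow> complex"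
  assumes f: "holo_ball f" and \<rho>: "0 \<le> \<rho>" "\<rho> < 1"
  shows "(\<integral>\<^sup>+ z. ennreal ((cmod (ball_part f z))\<^sup>2) * indicator (ball 0 \<rho>) z \<partial>vol_ball) \<le> sphere_mean f \<rho>"
  unfolding sphere_mean_def
proof (rule nn_integral_vol_ball_mono_rotation)
  show "(\<lambda>z. ennreal ((cmod (ball_part f z))\<^sup>2) * indicator (ball 0 \<rho>) z) \<in> borel_measurable borel"
    by (intro borel_measurable_times_ennreal borel_measurable_ball_part_scaled f borel_measurable_indicator) auto
  show "(\<lambda>z. ennreal ((cmod (ball_part f (\<rho> *\<^sub>R sgn z)))\<^sup>2)) \<in> borel_measurable borel"
    by (intro borel_measurable_ball_part_scaled f borel_measurable_scaled_sgn)
  fix z :: "complex ^ 'n"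
  show "(\<integral>\<^sup>+ \<theta>. ennreal ((cmod (ball_part f (cis \<theta> *s z)))\<^sup>2) * indicator (ball 0 \<rho>) (cis \<theta> *s z) * indicator {0..2 * pi} \<theta> \<partial>lborel)
      \<le> (\<integral>\<^sup>+ \<theta>. ennreal ((cmod (ball_part f (\<rho> *\<^sub>R sgn (cis \<theta> *s z))))\<^sup>2) * indicator {0..2 * pi} \<theta> \<partial>lborel)"
  proof (cases "norm z < \<rho>")
    case True
    have "norm (0 :: complex ^ 'n) + 1 * norm (sgn z) \<le> 1" by (simp add: norm_sgn)
    from nn_integral_slice_mono[OF f _ this norm_ge_zero[of z] less_imp_le[OF True] \<rho>(2)]
    have "(\<integral>\<^sup>+ \<theta>. ennreal ((cmod (f (norm z *\<^sub>R sgn (cis \<theta> *s z))))\<^sup>2) * indicator {0..2 * pi} \<theta> \<partial>lborel)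
      \<le> (\<integral>\<^sup>+ \<theta>. ennreal ((cmod (f (\<rho> *\<^sub>R sgn (cis \<theta> *s z))))\<^sup>2) * indicator {0..2 * pi} \<theta> \<partial>lborel)"
      by (simp add: sgn_smult_cis)
    moreover have "norm z *\<^sub>R sgn (cis \<theta> *s z) = cis \<theta> *s z" for \<theta>
      by (cases "z = 0") (simp_all add: sgn_div_norm norm_smult)
    moreover have "ball_part f (cis \<theta> *s z) = f (cis \<theta> *s z)" "indicator (ball 0 \<rho>) (cis \<theta> *s z) = (1 :: ennreal)" for \<theta>
      using True \<rho> by (simp_all add: ball_part_def norm_smult)
    ultimately show ?thesis using \<rho> by (simp add: ball_part_scaled_sgn)
  next
    case False
    then have "indicator (ball 0 \<rho>) (cis \<theta> *s z) = (0 :: ennreal)" for \<theta> by (simp add: norm_smult)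
    then show ?thesis by simp
  qed
qed

lemma hardy_norm2_eq:
  assumes f: "holo_ball f"
  shows "hardy_norm2 f = (SUP r\<in>{0<..<1}. sphere_mean f r)"
  unfolding hardy_norm2_def
proof (rule SUP_cong[OF refl])
  fix r :: real assume "r \<in> {0<..<1}"
  then have r: "0 \<le> r" "r < 1" by auto
  have [measurable]: "sgn \<in> borel_measurable (borel :: (complex ^ 'a) measure)"
    using borel_measurable_scaled_sgn[of 1] by simp
  have m: "(\<lambda>\<zeta>. ennreal ((cmod (ball_part f (r *\<^sub>R \<zeta>)))\<^sup>2)) \<in> borel_measurable borel"
    by (intro borel_measurable_ball_part_scaled f) simp
  have "AE \<zeta> in sigma_sphere. norm (\<zeta> :: complex ^ 'a) \<le> 1"
    unfolding sigma_sphere_def by (subst AE_distr_iff) (auto simp: norm_sgn)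
  then have "(\<integral>\<^sup>+ \<zeta>. ennreal ((cmod (f (r *\<^sub>R \<zeta>)))\<^sup>2) \<partial>sigma_sphere)
    = (\<integral>\<^sup>+ \<zeta>. ennreal ((cmod (ball_part f (r *\<^sub>R \<zeta>)))\<^sup>2) \<partial>sigma_sphere)"
  proof (intro nn_integral_cong_AE, elim AE_mp, intro AE_I2 impI)
    fix \<zeta> :: "complex ^ 'a" assume "norm \<zeta> \<le> 1"
    then have "r * norm \<zeta> < 1" using r mult_left_mono[of "norm \<zeta>" 1 r] by simp
    then show "ennreal ((cmod (f (r *\<^sub>R \<zeta>)))\<^sup>2) = ennreal ((cmod (ball_part f (r *\<^sub>R \<zeta>)))\<^sup>2)"
      using r by (simp add: ball_part_def)
  qed
  also have "\<dots> = sphere_mean f r"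
    unfolding sigma_sphere_def sphere_mean_def using m by (subst nn_integral_distr) auto
  finally show "(\<integral>\<^sup>+ \<zeta>. ennreal ((cmod (f (r *\<^sub>R \<zeta>)))\<^sup>2) \<partial>sigma_sphere) = sphere_mean f r" .
qed

text \<open>A sequence increasing to 1; by monotonicity of the means the supremum over all radii can
  be taken along it.\<close>

definition hardy_radius :: "nat \<Rightarrow> real" where
  "hardy_radius n = (real n + 1) / (real n + 2)"

definition hardy_measure :: "nat \<Rightarrow> (complex ^ 'n) measure" where
  "hardy_measure n = distr vol_ball borel (\<lambda>z. hardy_radius n *\<^sub>R sgn z)"

lemma hardy_radius: "0 < hardy_radius n" "hardy_radius n < 1" "m \<le> n \<Longrightarrow> hardy_radius m \<le> hardy_radius n"
  by (simp_all add: hardy_radius_def divide_simps algebra_simps)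

lemma AE_hardy_measure: "AE z in hardy_measure n. z \<in> ball 0 1"
  unfolding hardy_measure_def
  using norm_scaled_sgn_less_1[OF less_imp_le[OF hardy_radius(1)] hardy_radius(2)]
  by (subst AE_distr_iff) auto

lemma nn_integral_hardy_measure:
  assumes f: "holo_ball f"
  shows "(\<integral>\<^sup>+ z. ennreal ((cmod (f z))\<^sup>2) \<partial>hardy_measure n) = sphere_mean f (hardy_radius n)"
proof -
  have "(\<integral>\<^sup>+ z. ennreal ((cmod (f z))\<^sup>2) \<partial>hardy_measure n) = (\<integral>\<^sup>+ z. ennreal ((cmod (ball_part f z))\<^sup>2) \<partial>hardy_measure n)"
    by (rule nn_integral_cong_AE) (use AE_hardy_measure in eventually_elim, simp add: ball_part_def)
  also have "\<dots> = sphere_mean f (hardy_radius n)"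
    unfolding hardy_measure_def sphere_mean_def
    using borel_measurable_ball_part_scaled[OF f, of "\<lambda>z. z"] by (subst nn_integral_distr) simp_all
  finally show ?thesis .
qed

lemma exists_peak_rotation:
  fixes \<eta> \<zeta> :: "complex ^ 'n"
  assumes "norm \<eta> = 1" "norm \<zeta> = 1"
  obtains T :: "complex ^ 'n \<Rightarrow> complex ^ 'n" where "linear T" "\<And>x. norm (T x) = norm x"
    "\<And>t x. cmod (ball_part (peak \<zeta> t) (T x)) = cmod (ball_part (peak \<eta> t) x)"
proof -
  obtain T :: "complex ^ 'n \<Rightarrow> complex ^ 'n" where T: "linear T" "\<And>x. norm (T x) = norm x" "\<And>x. inner (T x) \<zeta> = inner x \<eta>"
    using exists_reflection[OF assms] by blast
  show ?thesis by (rule that[OF T(1,2)]) (simp add: ball_part_def T cmod_peak)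
qed

lemma sphere_mean_peak:
  fixes \<eta> \<zeta> :: "complex ^ 'n"
  assumes "norm \<eta> = 1" "norm \<zeta> = 1"
  shows "sphere_mean (peak \<eta> t) r = sphere_mean (peak \<zeta> t) r"
proof -
  obtain T where T: "linear T" "\<And>x. norm (T x) = norm x"
    "\<And>t x. cmod (ball_part (peak \<zeta> t) (T x)) = cmod (ball_part (peak \<eta> t) x)"
    using exists_peak_rotation[OF assms] by blast
  have T_sgn: "r *\<^sub>R sgn (T z) = T (r *\<^sub>R sgn z)" for z
    by (simp add: sgn_div_norm T(2) linear_cmul[OF T(1)])
  have "sphere_mean (peak \<zeta> t) r = (\<integral>\<^sup>+ z. ennreal ((cmod (ball_part (peak \<zeta> t) (r *\<^sub>R sgn (T z))))\<^sup>2) \<partial>vol_ball)"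
    unfolding sphere_mean_def
    by (rule nn_integral_vol_ball_isometry[OF T(1,2), symmetric])
       (intro borel_measurable_ball_part_scaled holo_ball_peak borel_measurable_scaled_sgn)
  then show ?thesis by (simp only: T_sgn T(3) sphere_mean_def)
qed

text \<open>The exponent is that of \<open>point_evaluation_vol_ball\<close>, and
  \<open>2 ^ (2 * CARD('n))\<close> undoes the halving of the distance to the sphere made
  there.\<close>

lemma function_space_hardy:
  "function_space hardy_measure (hardy_norm2 :: (complex ^ 'n \<Rightarrow> complex) \<Rightarrow> ennreal) 1 (2 ^ (2 * CARD('n))) (2 * CARD('n))"
proof
  fix f :: "complex ^ 'n \<Rightarrow> complex" assume f: "holo_ball f"
  have "(SUP r\<in>{0<..<1}. sphere_mean f r) = (SUP n. sphere_mean f (hardy_radius n))"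
  proof (rule antisym)
    show "(SUP n. sphere_mean f (hardy_radius n)) \<le> (SUP r\<in>{0<..<1}. sphere_mean f r)"
      using hardy_radius by (intro SUP_least SUP_upper) auto
    show "(SUP r\<in>{0<..<1}. sphere_mean f r) \<le> (SUP n. sphere_mean f (hardy_radius n))"
    proof (rule SUP_least)
      fix r :: real assume r: "r \<in> {0<..<1}"
      obtain n :: nat where "1 / (1 - r) < real n" using reals_Archimedean2 by blast
      then have "r \<le> hardy_radius n" using r by (simp add: hardy_radius_def field_simps)
      then have "sphere_mean f r \<le> sphere_mean f (hardy_radius n)"
        using r hardy_radius by (intro sphere_mean_mono f) auto
      also have "\<dots> \<le> (SUP n. sphere_mean f (hardy_radius n))" by (rule SUP_upper) simp
      finally show "sphere_mean f r \<le> (SUP n. sphere_mean f (hardy_radius n))" .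
    qed
  qed
  then show "hardy_norm2 f = (SUP n. \<integral>\<^sup>+ z. ennreal ((cmod (f z))\<^sup>2) \<partial>hardy_measure n)"
    by (simp only: hardy_norm2_eq[OF f] nn_integral_hardy_measure[OF f])
  show "incseq (\<lambda>n. \<integral>\<^sup>+ z. ennreal ((cmod (f z))\<^sup>2) \<partial>hardy_measure n)"
    unfolding nn_integral_hardy_measure[OF f]
    using hardy_radius by (intro monoI sphere_mean_mono f) (auto intro: less_imp_le)
  fix w :: "complex ^ 'n" assume w: "w \<in> ball 0 1"
  define \<epsilon> where "\<epsilon> = (1 - norm w) / 2"
  have \<epsilon>: "0 < \<epsilon>" "\<epsilon> \<le> 1 / 2" using w by (auto simp: \<epsilon>_def field_simps)
  have pow: "(1 - norm w) ^ (2 * CARD('n)) = 2 ^ (2 * CARD('n)) * \<epsilon> ^ (2 * CARD('n))"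
    by (simp add: \<epsilon>_def power_divide)
  have "ennreal ((cmod (f w))\<^sup>2) * ennreal (\<epsilon> ^ (2 * CARD('n)))
    \<le> (\<integral>\<^sup>+ z. ennreal ((cmod (ball_part f z))\<^sup>2) * indicator (ball 0 (1 - \<epsilon>)) z \<partial>vol_ball)"
    unfolding \<epsilon>_def by (rule point_evaluation_vol_ball[OF f w])
  also have "\<dots> \<le> sphere_mean f (1 - \<epsilon>)"
    using \<epsilon> by (intro vol_ball_integral_le_sphere_mean f) auto
  also have "\<dots> \<le> hardy_norm2 f"
    unfolding hardy_norm2_eq[OF f] using \<epsilon> by (intro SUP_upper) auto
  finally have *: "ennreal ((cmod (f w))\<^sup>2) * ennreal (\<epsilon> ^ (2 * CARD('n))) \<le> hardy_norm2 f" .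
  have "ennreal ((cmod (f w))\<^sup>2) * ennreal ((1 - norm w) ^ (2 * CARD('n)))
      = ennreal (2 ^ (2 * CARD('n))) * (ennreal ((cmod (f w))\<^sup>2) * ennreal (\<epsilon> ^ (2 * CARD('n))))"
    unfolding pow using \<epsilon>(1) by (subst ennreal_mult) (simp_all add: mult.left_commute)
  also have "\<dots> \<le> ennreal (2 ^ (2 * CARD('n))) * hardy_norm2 f"
    using * by (rule mult_left_mono) simp
  finally show "ennreal ((cmod (f w))\<^sup>2) * ennreal ((1 - norm w) ^ (2 * CARD('n))) \<le> ennreal (2 ^ (2 * CARD('n))) * hardy_norm2 f" .
next
  fix \<eta> \<zeta> :: "complex ^ 'n" and t assume "norm \<eta> = 1" "norm \<zeta> = 1"
  then show "hardy_norm2 (peak \<eta> t) = hardy_norm2 (peak \<zeta> t)"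
    by (simp only: hardy_norm2_eq[OF holo_ball_peak] sphere_mean_peak[of \<eta> \<zeta>])
next
  fix n
  show "sets (hardy_measure n :: (complex ^ 'n) measure) = sets borel" by (simp add: hardy_measure_def)
  show "AE z in (hardy_measure n :: (complex ^ 'n) measure). z \<in> ball 0 1" by (rule AE_hardy_measure)
  have "(\<lambda>z. hardy_radius n *\<^sub>R sgn z) \<in> measurable (vol_ball :: (complex ^ 'n) measure) borel"
    by simp
  then show "emeasure (hardy_measure n :: (complex ^ 'n) measure) UNIV \<le> ennreal 1"
    unfolding hardy_measure_def by (subst emeasure_distr) (simp_all add: emeasure_vol_ball_UNIV)
qed simp_all

section \<open>Weighted Bergman spaces\<close>

lemma emeasure_vol_ball_shell:
  assumes x: "0 \<le> x" "x \<le> 1"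
  shows "emeasure (vol_ball :: (complex ^ 'n) measure) (ball 0 1 - ball 0 (1 - x)) \<le> ennreal (2 * real CARD('n) * x)"
proof -
  let ?N = "2 * CARD('n)"
  let ?V = "emeasure lborel (ball (0 :: complex ^ 'n) 1)"
  have sub: "ball (0 :: complex ^ 'n) (1 - x) \<subseteq> ball 0 1" using x by auto
  have small: "emeasure lborel (ball (0 :: complex ^ 'n) (1 - x)) = ennreal ((1 - x) ^ ?N) * ?V"
    using x by (simp add: emeasure_ball ennreal_mult'[symmetric] mult.commute)
  have "1 - real ?N * x \<le> (1 - x) ^ ?N"
    using Bernoulli_inequality[of "- x" ?N] x by simp
  then have "1 - (1 - x) ^ ?N \<le> 2 * real CARD('n) * x" by simp
  have "emeasure (vol_ball :: (complex ^ 'n) measure) (ball 0 1 - ball 0 (1 - x)) =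
      emeasure lborel (ball (0 :: complex ^ 'n) 1 - ball 0 (1 - x)) / ?V"
    unfolding vol_ball_def by (subst emeasure_uniform_measure) (auto intro!: arg_cong2[where f = "(/)"] arg_cong2[where f = emeasure])
  also have "emeasure lborel (ball (0 :: complex ^ 'n) 1 - ball 0 (1 - x)) = ?V - ennreal ((1 - x) ^ ?N) * ?V"
    unfolding small[symmetric]
    by (rule emeasure_Diff) (use sub in \<open>auto simp: emeasure_ball x\<close>)
  also have "?V - ennreal ((1 - x) ^ ?N) * ?V = ennreal (1 - (1 - x) ^ ?N) * ?V"
  proof -
    obtain v where v: "?V = ennreal v" "v \<ge> 0"
      using emeasure_unit_ball(2)[where 'a = "complex ^ 'n"] by (cases ?V) auto
    have p: "0 \<le> (1 - x) ^ ?N" "(1 - x) ^ ?N \<le> 1" using x by (auto simp: power_le_one)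
    have "?V - ennreal ((1 - x) ^ ?N) * ?V = ennreal v - ennreal ((1 - x) ^ ?N * v)"
      unfolding v(1) using v(2) by (simp only: ennreal_mult'')
    also have "\<dots> = ennreal (v - (1 - x) ^ ?N * v)"
      using v(2) p by (intro ennreal_minus) simp
    also have "v - (1 - x) ^ ?N * v = (1 - (1 - x) ^ ?N) * v" by (simp only: left_diff_distrib mult_1_left)
    also have "ennreal \<dots> = ennreal (1 - (1 - x) ^ ?N) * ?V"
      unfolding v(1) using v(2) by (rule ennreal_mult'')
    finally show ?thesis .
  qed
  also have "ennreal (1 - (1 - x) ^ ?N) * ?V / ?V = ennreal (1 - (1 - x) ^ ?N)"
    using emeasure_unit_ball[where 'a = "complex ^ 'n"]
    by (simp add: ennreal_times_divide[symmetric] ennreal_divide_self less_top)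
  also have "\<dots> \<le> ennreal (2 * real CARD('n) * x)"
    by (rule ennreal_leI) fact
  finally show ?thesis .
qed

text \<open>Decompose the ball into the shells \<open>2\<^sup>-\<^sup>k\<^sup>-\<^sup>1 < 1 - |z| \<le> 2\<^sup>-\<^sup>k\<close>.\<close>
lemma bergman_weight_integrable:
  assumes s: "s > -1"
  obtains K where "(\<integral>\<^sup>+ z. ennreal ((1 - (norm z)\<^sup>2) powr s) \<partial>(vol_ball :: (complex ^ 'n) measure)) \<le> ennreal K" "K > 0"
proof -
  \<comment> \<open>Passing to a nonpositive exponent makes the power decreasing in its base, so the
    inner radius of a shell decides. The condition \<open>\<sigma> > -1\<close> gives
    \<open>b < 2\<close>, and \<open>b / 2\<close> is the ratio of the final geometric
    series.\<close>
  define \<sigma> where "\<sigma> = min s 0"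
  have \<sigma>: "\<sigma> > -1" "\<sigma> \<le> 0" "\<sigma> \<le> s" using s by (auto simp: \<sigma>_def)
  define b where "b = 2 powr (- \<sigma>)"
  have b: "0 < b" "b < 2" using powr_less_mono[of "- \<sigma>" 1 2] \<sigma> by (auto simp: b_def)
  \<comment> \<open>\<open>A k\<close> is the full collar up to the sphere, containing the shell of
    index \<open>k\<close>; its volume is of the same order, and overlaps do no harm in an upper
    bound.\<close>
  define A where "A k = ball (0 :: complex ^ 'n) 1 - ball 0 (1 - (1 / 2) ^ k)" for k :: nat
  have A [measurable]: "A k \<in> sets borel" for k by (simp add: A_def)
  have pointwise: "ennreal ((1 - (norm z)\<^sup>2) powr s) \<le> (\<Sum>k. ennreal (b ^ Suc k) * indicator (A k) z)"
    if z: "z \<in> ball 0 1" for z :: "complex ^ 'n"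
  proof -
    have z1: "0 < 1 - norm z" using z by simp
    have "\<exists>k. (1 / 2) ^ Suc k < 1 - norm z"
    proof -
      obtain n where "(1 / 2) ^ n < 1 - norm z" using real_arch_pow_inv[OF z1, of "1 / 2"] by auto
      moreover have "(1 / 2 :: real) ^ Suc n \<le> (1 / 2) ^ n" by simp
      ultimately show ?thesis by (meson order.strict_trans1)
    qed
    define k where "k = (LEAST k. (1 / 2) ^ Suc k < 1 - norm z)"
    have k: "(1 / 2) ^ Suc k < 1 - norm z"
      unfolding k_def by (rule LeastI_ex) fact
    have "1 - norm z \<le> (1 / 2) ^ k"
    proof (cases k)
      case (Suc m)
      then have "m < (LEAST k. (1 / 2) ^ Suc k < 1 - norm z)"
        by (simp only: k_def[symmetric] lessI)
      from not_less_Least[OF this] show ?thesis by (simp only: Suc not_less)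
    qed simp
    then have zA: "z \<in> A k" using z by (auto simp: A_def)
    have sq: "(norm z)\<^sup>2 \<le> norm z"
      using z mult_left_le[of "norm z" "norm z"] by (simp add: power2_eq_square)
    have "(1 - (norm z)\<^sup>2) powr s \<le> (1 - (norm z)\<^sup>2) powr \<sigma>"
      using \<sigma>(3) sq z1 by (intro powr_mono') auto
    also have "\<dots> \<le> ((1 / 2) ^ Suc k) powr \<sigma>"
      using \<sigma>(2) sq k by (intro powr_mono2') auto
    also have "\<dots> = b ^ Suc k"
    proof -
      have "(1 / 2 :: real) ^ Suc k = 2 powr (- real (Suc k))"
        by (simp add: powr_minus_divide powr_realpow power_one_over del: power_Suc of_nat_Suc)
      moreover have "b ^ Suc k = b powr real (Suc k)" by (rule powr_realpow[OF b(1), symmetric])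
      moreover have "- real (Suc k) * \<sigma> = - \<sigma> * real (Suc k)" by (simp only: mult_minus_left mult.commute)
      ultimately show ?thesis by (simp only: b_def powr_powr)
    qed
    finally have "ennreal ((1 - (norm z)\<^sup>2) powr s) \<le> ennreal (b ^ Suc k) * indicator (A k) z"
      using zA by (simp add: ennreal_leI)
    also have "\<dots> \<le> (\<Sum>k. ennreal (b ^ Suc k) * indicator (A k) z)"
    proof -
      define g where "g j = ennreal (b ^ Suc j) * indicator (A j) z" for j
      have "sum g {k} \<le> suminf g" by (rule sum_le_suminf) auto
      then have "g k \<le> suminf g" by simp
      then show ?thesis by (simp only: g_def[abs_def])
    qed
    finally show ?thesis .
  qed
  let ?M = "vol_ball :: (complex ^ 'n) measure"
  have "(\<integral>\<^sup>+ z. ennreal ((1 - (norm z)\<^sup>2) powr s) \<partial>?M) \<le> (\<integral>\<^sup>+ z. (\<Sum>k. ennreal (b ^ Suc k) * indicator (A k) z) \<partial>?M)"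
    by (rule nn_integral_mono_AE) (use AE_vol_ball in eventually_elim, rule pointwise)
  also have "\<dots> = (\<Sum>k. \<integral>\<^sup>+ z. ennreal (b ^ Suc k) * indicator (A k) z \<partial>?M)"
    by (rule nn_integral_suminf) measurable
  also have "\<dots> = (\<Sum>k. ennreal (b ^ Suc k) * emeasure ?M (A k))"
    by (simp add: nn_integral_cmult_indicator)
  also have "\<dots> \<le> (\<Sum>k. ennreal (b ^ Suc k) * ennreal (2 * real CARD('n) * (1 / 2) ^ k))"
  proof (intro suminf_le allI mult_left_mono)
    show "emeasure ?M (A k) \<le> ennreal (2 * real CARD('n) * (1 / 2) ^ k)" for k
      unfolding A_def by (rule emeasure_vol_ball_shell) (simp_all add: power_le_one)
  qed auto
  also have "\<dots> = (\<Sum>k. ennreal (2 * real CARD('n) * b * (b / 2) ^ k))"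
    using b(1) by (intro suminf_cong) (simp add: ennreal_mult'[symmetric] power_divide mult_ac)
  also have "\<dots> = ennreal (\<Sum>k. 2 * real CARD('n) * b * (b / 2) ^ k)"
    using b by (intro suminf_ennreal2) (auto intro!: summable_mult summable_geometric)
  also have "\<dots> \<le> ennreal (max 1 (\<Sum>k. 2 * real CARD('n) * b * (b / 2) ^ k))"
    by (rule ennreal_leI) simp
  finally show ?thesis using that by (meson less_max_iff_disj zero_less_one)
qed

definition bergman_weight :: "real \<Rightarrow> complex ^ 'n \<Rightarrow> real" where
  "bergman_weight s z = Gamma (real CARD('n) + s + 1) / (fact CARD('n) * Gamma (s + 1)) * (1 - (norm z)\<^sup>2) powr s"

definition bergman_measure :: "real \<Rightarrow> (complex ^ 'n) measure" where
  "bergman_measure s = density vol_ball (\<lambda>z. ennreal (bergman_weight s z))"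

lemma borel_measurable_bergman_weight [measurable]: "bergman_weight s \<in> borel_measurable borel"
  unfolding bergman_weight_def[abs_def] by measurable

lemma bergman_norm2_eq:
  fixes f :: "complex ^ 'n \<Rightarrow> complex"
  assumes f: "holo_ball f" and s: "s > -1"
  shows "bergman_norm2 s f = (\<integral>\<^sup>+ z. ennreal (bergman_weight s z) * ennreal ((cmod (ball_part f z))\<^sup>2) \<partial>vol_ball)"
  unfolding bergman_norm2_def
proof (rule nn_integral_cong_AE)
  have nonneg: "0 \<le> bergman_weight s z" for z :: "complex ^ 'n"
    unfolding bergman_weight_def using s by (intro mult_nonneg_nonneg divide_nonneg_nonneg) (auto intro!: Gamma_real_nonneg)
  show "AE z in vol_ball. ennreal ((cmod (f z))\<^sup>2 * (Gamma (real CARD('n) + s + 1) / (fact CARD('n) * Gamma (s + 1))) * (1 - (norm z)\<^sup>2) powr s)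
    = ennreal (bergman_weight s z) * ennreal ((cmod (ball_part f z))\<^sup>2)"
    using AE_vol_ball
  proof eventually_elim
    case (elim z)
    have "(cmod (f z))\<^sup>2 * (Gamma (real CARD('n) + s + 1) / (fact CARD('n) * Gamma (s + 1))) * (1 - (norm z)\<^sup>2) powr s
      = bergman_weight s z * (cmod (ball_part f z))\<^sup>2"
      using elim by (simp add: ball_part_def bergman_weight_def)
    then show ?case using nonneg[of z] by (simp only: ennreal_mult')
  qed
qed

lemma AE_bergman_measure: "AE z in bergman_measure s. z \<in> ball 0 1"
  unfolding bergman_measure_def using AE_vol_ball by (subst AE_density) auto

lemma nn_integral_bergman_measure:
  assumes f: "holo_ball f"
  shows "(\<integral>\<^sup>+ z. ennreal ((cmod (f z))\<^sup>2) \<partial>bergman_measure s)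
    = (\<integral>\<^sup>+ z. ennreal (bergman_weight s z) * ennreal ((cmod (ball_part f z))\<^sup>2) \<partial>vol_ball)"
proof -
  have "(\<integral>\<^sup>+ z. ennreal ((cmod (f z))\<^sup>2) \<partial>bergman_measure s) = (\<integral>\<^sup>+ z. ennreal ((cmod (ball_part f z))\<^sup>2) \<partial>bergman_measure s)"
    by (rule nn_integral_cong_AE) (use AE_bergman_measure in eventually_elim, simp add: ball_part_def)
  also have "\<dots> = (\<integral>\<^sup>+ z. ennreal (bergman_weight s z) * ennreal ((cmod (ball_part f z))\<^sup>2) \<partial>vol_ball)"
    unfolding bergman_measure_def
    using borel_measurable_ball_part_scaled[OF f, of "\<lambda>z. z"] by (intro nn_integral_density) simp_all
  finally show ?thesis .
qed

lemma function_space_bergman: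
  assumes s: "s > -1"
  obtains m0 c0 q where
    "function_space (\<lambda>_. bergman_measure s) (bergman_norm2 s :: (complex ^ 'n \<Rightarrow> complex) \<Rightarrow> ennreal) m0 c0 q"
proof -
  define \<kappa> where "\<kappa> = Gamma (real CARD('n) + s + 1) / (fact CARD('n) * Gamma (s + 1))"
  have \<kappa>: "\<kappa> > 0" unfolding \<kappa>_def using s by (intro divide_pos_pos mult_pos_pos Gamma_real_pos) auto
  have weight: "bergman_weight s z = \<kappa> * (1 - (norm z)\<^sup>2) powr s" for z :: "complex ^ 'n"
    by (simp add: bergman_weight_def \<kappa>_def)
  obtain K where K: "(\<integral>\<^sup>+ z. ennreal ((1 - (norm z)\<^sup>2) powr s) \<partial>(vol_ball :: (complex ^ 'n) measure)) \<le> ennreal K" "K > 0"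
    by (rule bergman_weight_integrable[OF s])
  \<comment> \<open>An integer exponent at least \<open>\<bar>s\<bar>\<close> serves either sign of
    \<open>s\<close>: inside radius \<open>1 - \<epsilon>\<close> the weight is at least
    \<open>\<kappa> * \<epsilon> ^ m\<close>.\<close>
  define m where "m = nat \<lceil>\<bar>s\<bar>\<rceil>"
  have m: "\<bar>s\<bar> \<le> real m" unfolding m_def by linarith
  define q where "q = 2 * CARD('n) + m"
  show ?thesis
  proof (rule that[of "\<kappa> * K" "2 ^ q / \<kappa>" q], unfold_locales)
    fix f :: "complex ^ 'n \<Rightarrow> complex" assume f: "holo_ball f"
    show "bergman_norm2 s f = (SUP n::nat. \<integral>\<^sup>+ z. ennreal ((cmod (f z))\<^sup>2) \<partial>bergman_measure s)"
      by (simp add: nn_integral_bergman_measure[OF f] bergman_norm2_eq[OF f s])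
    show "incseq (\<lambda>n::nat. \<integral>\<^sup>+ z. ennreal ((cmod (f z))\<^sup>2) \<partial>bergman_measure s)"
      by (simp add: incseq_def)
    fix w :: "complex ^ 'n" assume w: "w \<in> ball 0 1"
    define \<epsilon> where "\<epsilon> = (1 - norm w) / 2"
    have \<epsilon>: "0 < \<epsilon>" "\<epsilon> \<le> 1 / 2" using w by (auto simp: \<epsilon>_def field_simps)
    have weight_ge: "\<kappa> * \<epsilon> ^ m \<le> bergman_weight s z" if z: "z \<in> ball 0 (1 - \<epsilon>)" for z :: "complex ^ 'n"
    proof -
      define x where "x = 1 - (norm z)\<^sup>2"
      have "(norm z)\<^sup>2 \<le> norm z"
        using z \<epsilon> mult_left_le[of "norm z" "norm z"] by (simp add: power2_eq_square)
      then have x: "\<epsilon> \<le> x" "x \<le> 1" using z by (auto simp: x_def)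
      have "\<epsilon> ^ m = \<epsilon> powr real m" using \<epsilon>(1) by (simp add: powr_realpow)
      also have "\<dots> \<le> \<epsilon> powr \<bar>s\<bar>" using \<epsilon> m by (intro powr_mono') auto
      also have "\<dots> \<le> x powr \<bar>s\<bar>" using \<epsilon> x by (intro powr_mono2) auto
      also have "\<dots> \<le> x powr s" using \<epsilon> x by (intro powr_mono') auto
      finally show ?thesis using \<kappa> by (simp add: weight x_def)
    qed
    have "ennreal ((cmod (f w))\<^sup>2) * ennreal (\<epsilon> ^ (2 * CARD('n))) * ennreal (\<kappa> * \<epsilon> ^ m)
      \<le> (\<integral>\<^sup>+ z. ennreal ((cmod (ball_part f z))\<^sup>2) * indicator (ball 0 (1 - \<epsilon>)) z \<partial>vol_ball) * ennreal (\<kappa> * \<epsilon> ^ m)"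
      unfolding \<epsilon>_def by (intro mult_right_mono point_evaluation_vol_ball[OF f w]) simp
    also have "\<dots> = (\<integral>\<^sup>+ z. ennreal ((cmod (ball_part f z))\<^sup>2) * indicator (ball 0 (1 - \<epsilon>)) z * ennreal (\<kappa> * \<epsilon> ^ m) \<partial>vol_ball)"
    proof (rule nn_integral_multc[symmetric])
      have "(\<lambda>z. ennreal ((cmod (ball_part f z))\<^sup>2) * indicator (ball 0 (1 - \<epsilon>)) z) \<in> borel_measurable borel"
        by (intro borel_measurable_times_ennreal borel_measurable_ball_part_scaled f borel_measurable_indicator) auto
      then show "(\<lambda>z. ennreal ((cmod (ball_part f z))\<^sup>2) * indicator (ball 0 (1 - \<epsilon>)) z) \<in> borel_measurable vol_ball"
        by simp
    qed
    also have "\<dots> \<le> (\<integral>\<^sup>+ z. ennreal (bergman_weight s z) * ennreal ((cmod (ball_part f z))\<^sup>2) \<partial>vol_ball)"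
    proof (rule nn_integral_mono)
      fix z :: "complex ^ 'n"
      show "ennreal ((cmod (ball_part f z))\<^sup>2) * indicator (ball 0 (1 - \<epsilon>)) z * ennreal (\<kappa> * \<epsilon> ^ m)
        \<le> ennreal (bergman_weight s z) * ennreal ((cmod (ball_part f z))\<^sup>2)"
      proof (cases "z \<in> ball 0 (1 - \<epsilon>)")
        case True
        then have "ennreal (\<kappa> * \<epsilon> ^ m) \<le> ennreal (bergman_weight s z)" by (intro ennreal_leI weight_ge)
        from mult_left_mono[OF this, of "ennreal ((cmod (ball_part f z))\<^sup>2)"] show ?thesis
          using True by (simp add: mult.commute)
      qed simp
    qed
    finally have *: "ennreal ((cmod (f w))\<^sup>2) * ennreal (\<epsilon> ^ (2 * CARD('n))) * ennreal (\<kappa> * \<epsilon> ^ m) \<le> bergman_norm2 s f"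
      by (simp only: bergman_norm2_eq[OF f s])
    have "(1 - norm w) ^ q = 2 ^ q / \<kappa> * (\<epsilon> ^ (2 * CARD('n)) * (\<kappa> * \<epsilon> ^ m))"
      using \<kappa> by (simp add: \<epsilon>_def q_def power_divide power_add)
    also have "ennreal \<dots> = ennreal (2 ^ q / \<kappa>) * (ennreal (\<epsilon> ^ (2 * CARD('n))) * ennreal (\<kappa> * \<epsilon> ^ m))"
    proof -
      have "ennreal (x * (y * z)) = ennreal x * (ennreal y * ennreal z)" if "x \<ge> 0" "y \<ge> 0" "z \<ge> 0" for x y z
        using that by (simp add: ennreal_mult)
      from this[of "2 ^ q / \<kappa>" "\<epsilon> ^ (2 * CARD('n))" "\<kappa> * \<epsilon> ^ m"] show ?thesis
        using \<kappa> \<epsilon> by simp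
    qed
    finally have "ennreal ((cmod (f w))\<^sup>2) * ennreal ((1 - norm w) ^ q)
        = ennreal (2 ^ q / \<kappa>) * (ennreal ((cmod (f w))\<^sup>2) * ennreal (\<epsilon> ^ (2 * CARD('n))) * ennreal (\<kappa> * \<epsilon> ^ m))"
      by (simp only: mult_ac)
    also have "\<dots> \<le> ennreal (2 ^ q / \<kappa>) * bergman_norm2 s f"
      using * by (rule mult_left_mono) simp
    finally show "ennreal ((cmod (f w))\<^sup>2) * ennreal ((1 - norm w) ^ q) \<le> ennreal (2 ^ q / \<kappa>) * bergman_norm2 s f" .
  next
    fix \<eta> \<zeta> :: "complex ^ 'n" and t assume \<eta>\<zeta>: "norm \<eta> = 1" "norm \<zeta> = 1"
    obtain T where T: "linear T" "\<And>x. norm (T x) = norm x"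
      "\<And>t x. cmod (ball_part (peak \<zeta> t) (T x)) = cmod (ball_part (peak \<eta> t) x)"
      using exists_peak_rotation[OF \<eta>\<zeta>] by blast
    have "(\<integral>\<^sup>+ z. ennreal (bergman_weight s z) * ennreal ((cmod (ball_part (peak \<zeta> t) z))\<^sup>2) \<partial>vol_ball)
      = (\<integral>\<^sup>+ z. ennreal (bergman_weight s (T z)) * ennreal ((cmod (ball_part (peak \<zeta> t) (T z)))\<^sup>2) \<partial>vol_ball)"
      using borel_measurable_ball_part_scaled[OF holo_ball_peak, of "\<lambda>z. z" \<zeta> t]
      by (intro nn_integral_vol_ball_isometry[OF T(1,2), symmetric] borel_measurable_times_ennreal) simp_all
    then show "bergman_norm2 s (peak \<eta> t) = bergman_norm2 s (peak \<zeta> t)"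
      by (simp only: bergman_norm2_eq[OF holo_ball_peak s] T(2,3) weight)
  next
    show "sets (bergman_measure s :: (complex ^ 'n) measure) = sets borel" by (simp add: bergman_measure_def)
    show "AE z in (bergman_measure s :: (complex ^ 'n) measure). z \<in> ball 0 1" by (rule AE_bergman_measure)
    have "emeasure (bergman_measure s :: (complex ^ 'n) measure) UNIV
      = (\<integral>\<^sup>+ z. ennreal (bergman_weight s z) \<partial>(vol_ball :: (complex ^ 'n) measure))"
      unfolding bergman_measure_def by (subst emeasure_density) auto
    also have "\<dots> = ennreal \<kappa> * (\<integral>\<^sup>+ z. ennreal ((1 - (norm z)\<^sup>2) powr s) \<partial>(vol_ball :: (complex ^ 'n) measure))"
      unfolding weight using \<kappa> by (subst nn_integral_cmult[symmetric]) (simp_all add: ennreal_mult)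
    also have "\<dots> \<le> ennreal \<kappa> * ennreal K" by (rule mult_left_mono[OF K(1)]) simp
    also have "\<dots> = ennreal (\<kappa> * K)" using \<kappa> K(2) by (simp add: ennreal_mult)
    finally show "emeasure (bergman_measure s :: (complex ^ 'n) measure) UNIV \<le> ennreal (\<kappa> * K)" .
    show "0 < \<kappa> * K" "0 < 2 ^ q / \<kappa>" using \<kappa> K(2) by simp_all
  qed
qed

section \<open>Conclusion for linear fractional maps\<close>

lemma (in lfm_interior_fixed_point) not_ess_normal_comp_op:
  assumes "function_space \<mu> Q m0 c0 q"
  shows "\<not> ess_normal Q (comp_op \<phi>)"
proof -
  obtain \<zeta> where \<zeta>: "norm \<zeta> = 1" "norm (\<phi> \<zeta>) = 1" "norm (\<phi> (\<phi> \<zeta>)) < 1"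
    by (rule \<phi>_leaves_sphere)
  define \<eta> where "\<eta> = \<phi> \<zeta>"
  obtain M where M: "\<And>z. z \<in> cball 0 1 \<Longrightarrow> 1 - inner (\<phi> z) \<eta> \<le> M * (1 - inner z \<zeta>)"
    using boundary_contact[OF \<zeta>(1,2) refl] unfolding \<eta>_def by blast
  define r where "r = (1 + norm (\<phi> \<eta>)) / 2"
  have r: "norm (\<phi> \<eta>) < r" "r < 1" using \<zeta>(3) by (simp_all add: r_def \<eta>_def)
  have \<eta>: "norm \<eta> = 1" using \<zeta>(2) by (simp add: \<eta>_def)
  then obtain d' where d': "d' > 0" "\<And>z. z \<in> cball 0 1 \<Longrightarrow> dist z \<eta> < d' \<Longrightarrow> dist (\<phi> z) (\<phi> \<eta>) < r - norm (\<phi> \<eta>)"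
    using continuous_on_\<phi> r(1) unfolding continuous_on_iff
    by (metis diff_gt_0_iff_gt mem_cball_0 order_refl)
  show ?thesis
  proof (rule function_space.not_ess_normal[OF assms \<phi>_ball \<zeta>(1) \<eta> _ r(2)])
    show "1 - inner (\<phi> z) \<eta> \<le> M * (1 - inner z \<zeta>)" if "z \<in> ball 0 1" for z
      using that by (intro M) simp
    \<comment> \<open>The cap height matches
      \<open>(dist z \<eta>)\<^sup>2 \<le> 2 * (1 - inner z \<eta>)\<close>, which places the cap
      within the continuity radius \<open>d'\<close>.\<close>
    show "d'\<^sup>2 / 2 > 0" using d'(1) by simp
    show "norm (\<phi> z) \<le> r" if z: "z \<in> ball 0 1" "1 - inner z \<eta> < d'\<^sup>2 / 2" for z
    proof -
      have "(dist z \<eta>)\<^sup>2 = (norm z)\<^sup>2 + (norm \<eta>)\<^sup>2 - 2 * inner z \<eta>"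
        unfolding dist_norm power2_norm_eq_inner
        by (simp add: inner_diff_left inner_diff_right inner_commute[of \<eta> z])
      also have "\<dots> \<le> 1 + 1 - 2 * inner z \<eta>"
        using z \<eta> by (intro diff_right_mono add_mono) (simp_all add: power_le_one)
      also have "\<dots> < d'\<^sup>2" using z(2) by simp
      finally have "dist z \<eta> < d'" using d'(1) by (intro power2_less_imp_less[of "dist z \<eta>" d']) auto
      then have "dist (\<phi> z) (\<phi> \<eta>) < r - norm (\<phi> \<eta>)" using z(1) by (intro d'(2)) simp
      then show ?thesis using norm_triangle_sub[of "\<phi> z" "\<phi> \<eta>"] by (simp add: dist_norm)
    qed
  qed
qed


theorem theorem4p4:
  fixes A :: "complex ^ 'n ^ 'n" and B C z0 :: "complex ^ 'n" and d :: complex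
  assumes "lfm_self_map A B C d"
    and "lfm_fixed_points_closed A B C d = {z0}"
    and "z0 \<in> ball 0 1"
    and "dim (unitary_space (lfm A B C d) z0) = 0"
    and "sup_norm_ball (lfm A B C d) = 1"
  shows "\<not> ess_normal hardy_norm2 (comp_op (lfm A B C d)) \<and>
         (\<forall>s::real. s > -1 \<longrightarrow> \<not> ess_normal (bergman_norm2 s) (comp_op (lfm A B C d)))"
proof -
  interpret lfm_interior_fixed_point A B C z0 d
    by unfold_locales (fact assms)+
  have "\<not> ess_normal (bergman_norm2 s) (comp_op (lfm A B C d))" if s: "s > -1" for s
  proof -
    obtain m0 c0 q where
      "function_space (\<lambda>_. bergman_measure s) (bergman_norm2 s :: (complex ^ 'n \<Rightarrow> complex) \<Rightarrow> ennreal) m0 c0 q"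
      by (rule function_space_bergman[OF s])
    then show ?thesis by (rule not_ess_normal_comp_op)
  qed
  then show ?thesis using not_ess_normal_comp_op[OF function_space_hardy] by simp
qed

end
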